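(* Let $k$ be an algebraically closed field whose characteristic is not $2$, $3$, or $5$, and let $R=k\llbracket x,y,z\rrbracket/(z^2+x^3+xy^3)$. Then $\tau_{MCM}(R)=(x,y^3,z)$.
   Context: All rings are commutative, unital, Noetherian and local. A maximal Cohen-Macaulay (MCM) module over a ring $R$ is a finitely generated (nonzero) $R$-module $M$ such that the length of the longest regular sequence on $M$ equals the Krull dimension of $R$; a sequence $x_1,\ldots,x_n$ in $R$ is regular on $M$ if $(x_1,\ldots,x_n)M\ne M$, $x_1$ is a non-zerodivisor on $M$, and $x_i$ is a non-zerodivisor on $M/(x_1,\ldots,x_{i-1})M$ for $2\le i\le n$. For an $R$-module $M$ and $R$-modules $A\subseteq B$, let $A_B^{\mathrm{cl}_M}=\{b\in B : x\otimes b\in \operatorname{im}(M\otimes_R A\to M\otimes_R B)\text{ for all }x\in M\}$. The test ideal of $R$ associated to $M$ is $\tau_M(R)=\bigcap_{A\subseteq B}(A:_R A_B^{\mathrm{cl}_M})$, the intersection over all pairs of $R$-modules $A\subseteq B$. By a known theorem, when $R$ is local and $M$ is finitely generated, $\tau_M(R)$ equals the trace ideal $\sum_{f\in\operatorname{Hom}_R(M,R)}f(M)$, and $\tau_M(R)$ denotes this common ideal. $\tau_{MCM}(R)=\bigcap_M \tau_M(R)$, the intersection over all isomorphism classes of maximal Cohen-Macaulay $R$-modules $M$. *)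

theory Defs
  imports
    "HOL-Algebra.Algebra"
    "HOL-Algebra.Algebraic_Closure_Type"
    "HOL-Library.Extended_Nat"
begin

section \<open>Maximal Cohen-Macaulay modules\<close>

definition krull_dim :: "('r, 's) ring_scheme \<Rightarrow> enat" where
  "krull_dim R = Sup {enat n | n P. (\<forall>i\<le>n. primeideal (P i) R) \<and> (\<forall>i<n. P i \<subset> P (Suc i))}"

definition gen_submodule ::
    "('r, 's) ring_scheme \<Rightarrow> ('r, 'm, 't) module_scheme \<Rightarrow> 'm set \<Rightarrow> 'm set" where
  "gen_submodule R M S = \<Inter>{N. submodule N R M \<and> S \<subseteq> N}"

definition fin_gen_module ::
    "('r, 's) ring_scheme \<Rightarrow> ('r, 'm, 't) module_scheme \<Rightarrow> bool" where
  "fin_gen_module R M \<longleftrightarrow>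
     module R M \<and> (\<exists>S. finite S \<and> S \<subseteq> carrier M \<and> gen_submodule R M S = carrier M)"

definition ideal_smult ::
    "('r, 's) ring_scheme \<Rightarrow> 'r set \<Rightarrow> ('r, 'm, 't) module_scheme \<Rightarrow> 'm set" where
  "ideal_smult R I M = gen_submodule R M {a \<odot>\<^bsub>M\<^esub> m | a m. a \<in> I \<and> m \<in> carrier M}"

text \<open>
  With 0-based list indices, the last clause says that \<open>xs ! i\<close> is a non-zerodivisor on
  \<open>M / (xs ! 0, \<dots>, xs ! (i - 1)) M\<close>: the class of \<open>m\<close> in that quotient vanishes iff \<open>m\<close> lies in
  the submodule that is divided out.
\<close>

definition regular_sequence ::
    "('r, 's) ring_scheme \<Rightarrow> ('r, 'm, 't) module_scheme \<Rightarrow> 'r list \<Rightarrow> bool" where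
  "regular_sequence R M xs \<longleftrightarrow>
     set xs \<subseteq> carrier R \<and>
     ideal_smult R (Idl\<^bsub>R\<^esub> (set xs)) M \<noteq> carrier M \<and>
     (\<forall>i < length xs. \<forall>m \<in> carrier M.
        xs ! i \<odot>\<^bsub>M\<^esub> m \<in> ideal_smult R (Idl\<^bsub>R\<^esub> (set (take i xs))) M \<longrightarrow>
        m \<in> ideal_smult R (Idl\<^bsub>R\<^esub> (set (take i xs))) M)"

definition module_depth ::
    "('r, 's) ring_scheme \<Rightarrow> ('r, 'm, 't) module_scheme \<Rightarrow> enat" where
  "module_depth R M = Sup {enat (length xs) | xs. regular_sequence R M xs}"

definition MCM_module ::
    "('r, 's) ring_scheme \<Rightarrow> ('r, 'm, 't) module_scheme \<Rightarrow> bool" where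
  "MCM_module R M \<longleftrightarrow>
     fin_gen_module R M \<and> carrier M \<noteq> {\<zero>\<^bsub>M\<^esub>} \<and> module_depth R M = krull_dim R"


section \<open>Tensor products\<close>

text \<open>
  The tensor product over \<open>R\<close> is the quotient of the free Abelian group on \<open>M \<times> N\<close> by the
  biadditivity and balancing relations. Only its additive group is needed.
\<close>

definition tensor_free ::
    "('r, 'm, 't) module_scheme \<Rightarrow> ('r, 'n, 'u) module_scheme \<Rightarrow> (('m \<times> 'n) \<Rightarrow>\<^sub>0 int) monoid" where
  "tensor_free M N = free_Abelian_group (carrier M \<times> carrier N)"

definition tensor_rels ::
    "('r, 's) ring_scheme \<Rightarrow> ('r, 'm, 't) module_scheme \<Rightarrow> ('r, 'n, 'u) module_scheme \<Rightarrow>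
     (('m \<times> 'n) \<Rightarrow>\<^sub>0 int) set" where
  "tensor_rels R M N = generate (tensor_free M N)
     ({frag_of (m \<oplus>\<^bsub>M\<^esub> m', n) - frag_of (m, n) - frag_of (m', n) | m m' n.
         m \<in> carrier M \<and> m' \<in> carrier M \<and> n \<in> carrier N} \<union>
      {frag_of (m, n \<oplus>\<^bsub>N\<^esub> n') - frag_of (m, n) - frag_of (m, n') | m n n'.
         m \<in> carrier M \<and> n \<in> carrier N \<and> n' \<in> carrier N} \<union>
      {frag_of (r \<odot>\<^bsub>M\<^esub> m, n) - frag_of (m, r \<odot>\<^bsub>N\<^esub> n) | r m n.
         r \<in> carrier R \<and> m \<in> carrier M \<and> n \<in> carrier N})"

definition tensor_prod ::
    "('r, 's) ring_scheme \<Rightarrow> ('r, 'm, 't) module_scheme \<Rightarrow> ('r, 'n, 'u) module_scheme \<Rightarrow>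
     (('m \<times> 'n) \<Rightarrow>\<^sub>0 int) set monoid" where
  "tensor_prod R M N = tensor_free M N Mod tensor_rels R M N"

definition pure_tensor ::
    "('r, 's) ring_scheme \<Rightarrow> ('r, 'm, 't) module_scheme \<Rightarrow> ('r, 'n, 'u) module_scheme \<Rightarrow>
     'm \<Rightarrow> 'n \<Rightarrow> (('m \<times> 'n) \<Rightarrow>\<^sub>0 int) set" where
  "pure_tensor R M N m n = tensor_rels R M N #>\<^bsub>tensor_free M N\<^esub> frag_of (m, n)"

text \<open>
  \<open>tensor_map R M N f\<close> is the map \<open>M \<otimes> f\<close> from \<open>M \<otimes> N'\<close> to \<open>M \<otimes> N\<close> induced by an
  \<open>R\<close>-linear \<open>f\<close> from \<open>N'\<close> to \<open>N\<close>. An element \<open>T\<close> of \<open>M \<otimes> N'\<close> is a coset; its image under the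
  extension of \<open>(m, n') \<mapsto> (m, f n')\<close> to the free groups lies in a single coset of the relations
  of \<open>M \<otimes> N\<close>, which is recovered by adding those relations.
\<close>

definition tensor_map ::
    "('r, 's) ring_scheme \<Rightarrow> ('r, 'm, 't) module_scheme \<Rightarrow> ('r, 'n, 'u) module_scheme \<Rightarrow>
     ('l \<Rightarrow> 'n) \<Rightarrow> (('m \<times> 'l) \<Rightarrow>\<^sub>0 int) set \<Rightarrow> (('m \<times> 'n) \<Rightarrow>\<^sub>0 int) set" where
  "tensor_map R M N f T =
     set_mult (tensor_free M N) (tensor_rels R M N)
       (frag_extend (\<lambda>(m, l). frag_of (m, f l)) ` T)"


section \<open>Test ideals\<close>

definition module_closure ::
    "('r, 's) ring_scheme \<Rightarrow> ('r, 'm, 't) module_scheme \<Rightarrow> ('r, 'b, 'u) module_scheme \<Rightarrow>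
     'b set \<Rightarrow> 'b set" where
  "module_closure R M B A = {b \<in> carrier B. \<forall>x \<in> carrier M.
     pure_tensor R M B x b \<in>
       tensor_map R M B (\<lambda>a. a) ` carrier (tensor_prod R M (B\<lparr>carrier := A\<rparr>))}"

definition module_colon ::
    "('r, 's) ring_scheme \<Rightarrow> ('r, 'b, 'u) module_scheme \<Rightarrow> 'b set \<Rightarrow> 'b set \<Rightarrow> 'r set" where
  "module_colon R B A C = {r \<in> carrier R. \<forall>c \<in> C. r \<odot>\<^bsub>B\<^esub> c \<in> A}"

text \<open>
  HOL cannot quantify over all types inside a term, so the intersections over all modules take
  the type of the module elements as a parameter: they range over all modules whose carrier is a
  set of elements of that type, and so, up to isomorphism, over all modules of at most its
  cardinality.
\<close>

definition test_ideal ::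
    "'b itself \<Rightarrow> ('r, 's) ring_scheme \<Rightarrow> ('r, 'm, 't) module_scheme \<Rightarrow> 'r set" where
  "test_ideal U R M = {r \<in> carrier R. \<forall>(B :: ('r, 'b) module) A.
     module R B \<and> submodule A R B \<longrightarrow> r \<in> module_colon R B A (module_closure R M B A)}"

definition MCM_test_ideal :: "'b itself \<Rightarrow> ('r, 's) ring_scheme \<Rightarrow> 'r set" where
  "MCM_test_ideal U R =
     {r \<in> carrier R. \<forall>M :: ('r, 'b) module. MCM_module R M \<longrightarrow> r \<in> test_ideal U R M}"


section \<open>The \<open>E\<^sub>7\<close> surface singularity\<close>

text \<open>
  \<open>k\<lbrakk>x, y, z\<rbrakk>\<close> is the iterated power series ring \<open>k\<lbrakk>x\<rbrakk>\<lbrakk>y\<rbrakk>\<lbrakk>z\<rbrakk>\<close>.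
\<close>

type_synonym 'k fps3 = "'k fps fps fps"

definition var_x :: "'k::field fps3" where "var_x = fps_const (fps_const fps_X)"
definition var_y :: "'k::field fps3" where "var_y = fps_const fps_X"
definition var_z :: "'k::field fps3" where "var_z = fps_X"

definition E7_ideal :: "'k::field fps3 set" where
  "E7_ideal = Idl\<^bsub>ring_of_type_algebra\<^esub> {var_z ^ 2 + var_x ^ 3 + var_x * var_y ^ 3}"

definition E7_ring :: "'k::field fps3 set ring" where
  "E7_ring = ring_of_type_algebra Quot E7_ideal"

definition E7_class :: "'k::field fps3 \<Rightarrow> 'k fps3 set" where
  "E7_class p = E7_ideal +>\<^bsub>ring_of_type_algebra\<^esub> p"

text \<open>
  A type of module elements that contains a copy of \<open>E7_ring\<close>, hence is large enough for every
  finitely generated \<open>E7_ring\<close>-module, and that becomes arbitrarily large as \<open>'u\<close> varies.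
  A statement about all \<open>'u\<close> therefore covers all modules.
\<close>

type_synonym ('k, 'u) E7_universe = "'k fps3 set + 'u"

end

theory Submission
  imports Defs
begin

text \<open>
  Write \<open>S = k\<lbrakk>x, y\<rbrakk>\<close> and \<open>g = x ^ 3 + x * y ^ 3\<close>, so that the surface ring is \<open>R = S + S z\<close> with
  \<open>z\<^sup>2 = - g\<close>. The theorem says that the intersection of the traces of all maximal Cohen-Macaulay
  modules is already attained by one of them, the ideal \<open>(x, z)\<close>.

  Upper bound. The prime ideal \<open>P = (x, z)\<close> is a maximal Cohen-Macaulay module
  (\<open>line_MCM\<close>). Since \<open>z * x\<close> and \<open>z\<^sup>2 = - x * (x\<^sup>2 + y ^ 3)\<close> both lie in \<open>(x, y ^ 3) P\<close>, the element \<open>z\<close>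
  belongs to the closure of the ideal \<open>(x, y ^ 3)\<close> in \<open>R\<close> with respect to \<open>P\<close>, and \<open>(x, y ^ 3) : z\<close> is
  \<open>(x, y ^ 3, z)\<close> (\<open>MCM_test_ideal_upper_bound\<close>).

  Lower bound. For every linear functional \<open>f\<close> on a module \<open>M\<close>, the values of \<open>f\<close> lie in the test ideal
  of \<open>M\<close>, because \<open>f\<close> induces a map from \<open>M \<otimes> B\<close> to \<open>B\<close> that carries the image of \<open>M \<otimes> A\<close> into \<open>A\<close>
  (\<open>trace_subset_test_ideal\<close>). A maximal Cohen-Macaulay module is free over \<open>S\<close>, and \<open>z\<close> acts on a basis by a
  matrix \<open>\<phi>\<close> with \<open>\<phi>\<^sup>2 = - g\<close>. The functionals \<open>m \<mapsto> \<lambda> (z m) + z \<lambda> m\<close>, for the coordinates \<open>\<lambda>\<close>, take the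
  entries of \<open>\<phi> + z\<close> as values, so it suffices to show that any ideal \<open>T\<close> of \<open>R\<close> containing these entries
  contains \<open>x\<close>, \<open>y ^ 3\<close> and \<open>z\<close> (\<open>matrix_factorization_trace\<close>).

  This is a valuation argument. Let \<open>a\<close> be a diagonal entry of \<open>\<phi>\<close> and \<open>I\<close> the ideal of \<open>S\<close> generated by the
  entries of \<open>\<phi> - a\<close>, which \<open>T\<close> contains. From \<open>(\<phi> - a)\<^sup>2 = - (a\<^sup>2 + g) - 2 * a * (\<phi> - a)\<close> one reads off, the
  characteristic not being \<open>2\<close>, that \<open>a * I\<close> is contained in \<open>I\<^sup>2\<close> and that \<open>a\<^sup>2 + g\<close> lies in \<open>I\<^sup>2\<close>. So \<open>a\<close> is
  integral over \<open>I\<close> and \<open>g\<close> over \<open>I\<^sup>2\<close>: along every arc \<open>S \<rightarrow> k\<lbrakk>t\<rbrakk>\<close> the order of \<open>g\<close> is at least twice the order of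
  \<open>I\<close>. As \<open>g\<close> has order \<open>3\<close> along \<open>(t, c t)\<close> and order \<open>3 + ord H\<close>, for \<open>ord H \<ge> 2\<close>, along \<open>(H, t)\<close>, the ideal
  cannot be small, and \<open>(x, y ^ 3) \<subseteq> I\<close> follows. The order of \<open>a\<close> finally shows that \<open>a\<close> lies in \<open>I\<close>, while
  \<open>z + a\<close> lies in \<open>T\<close>.

  What remains is commutative algebra: \<open>R\<close> has dimension two (\<open>krull_dim_E7_ring\<close>), \<open>P\<close> has depth two
  (\<open>koszul_chase\<close>), and a finitely generated module with some regular sequence of length two in \<open>R\<close> has
  \<open>x, y\<close> as a regular sequence (\<open>x_regular\<close>, \<open>y_regular\<close>) and is therefore free over \<open>S\<close>
  (\<open>regular_pair_basis\<close>). Weierstrass division is the tool behind the dimension, the arcs, and the normal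
  form \<open>a + b z\<close> of the elements of \<open>R\<close>.
\<close>

section \<open>Division by distinguished power series\<close>

text \<open>
  Both halves of completeness are stated through divisibility by powers of \<open>t\<close>: separatedness, and
  limits of sequences whose \<open>n\<close>-th increment is divisible by \<open>t ^ n\<close>. In this form they pass to
  coefficients of power series.
\<close>

definition adic_complete :: "'a::comm_ring_1 \<Rightarrow> bool" where
  "adic_complete t \<longleftrightarrow>
     (\<forall>a. (\<forall>n. t ^ n dvd a) \<longrightarrow> a = 0) \<and>
     (\<forall>H. (\<forall>n. t ^ n dvd H (Suc n) - H n) \<longrightarrow> (\<exists>h. \<forall>n. t ^ n dvd h - H n))"

lemma fps_X_power_dvd_iff:
  "fps_X ^ n dvd (a :: 'a::comm_ring_1 fps) \<longleftrightarrow> (\<forall>i<n. fps_nth a i = 0)"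
proof
  assume "fps_X ^ n dvd a"
  then show "\<forall>i<n. fps_nth a i = 0" by (auto simp: fps_X_power_mult_nth)
next
  assume *: "\<forall>i<n. fps_nth a i = 0"
  have "a = fps_X ^ n * fps_shift n a"
    using * by (intro fps_ext) (auto simp: fps_X_power_mult_nth)
  then show "fps_X ^ n dvd a" by (rule dvdI)
qed

lemma fps_X_dvd_iff: "fps_X dvd (a :: 'a::comm_ring_1 fps) \<longleftrightarrow> fps_nth a 0 = 0"
  using fps_X_power_dvd_iff[of 1 a] by simp

lemma fps_const_dvd_iff:
  "fps_const c dvd (p :: 'a::comm_ring_1 fps) \<longleftrightarrow> (\<forall>i. c dvd fps_nth p i)"
proof
  assume "fps_const c dvd p"
  then show "\<forall>i. c dvd fps_nth p i" by auto
next
  assume "\<forall>i. c dvd fps_nth p i"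
  then have "\<forall>i. \<exists>u. fps_nth p i = c * u" by (auto simp: dvd_def)
  then obtain u where "\<forall>i. fps_nth p i = c * u i" by metis
  then have "p = fps_const c * Abs_fps u" by (intro fps_ext) simp
  then show "fps_const c dvd p" by (rule dvdI)
qed

lemma adic_complete_fps_X: "adic_complete (fps_X :: 'a::comm_ring_1 fps)"
  unfolding adic_complete_def
proof (intro conjI allI impI)
  fix a :: "'a fps"
  assume "\<forall>n. fps_X ^ n dvd a"
  then show "a = 0" by (intro fps_ext) (auto simp: fps_X_power_dvd_iff)
next
  fix H :: "nat \<Rightarrow> 'a fps"
  assume H: "\<forall>n. fps_X ^ n dvd H (Suc n) - H n"
  have stable: "fps_nth (H (Suc i + k)) i = fps_nth (H (Suc i)) i" for i k
  proof (induction k)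
    case (Suc k)
    have "fps_nth (H (Suc (Suc i + k)) - H (Suc i + k)) i = 0"
      using H[rule_format, of "Suc i + k"] unfolding fps_X_power_dvd_iff by auto
    then show ?case using Suc by simp
  qed simp
  show "\<exists>h. \<forall>n. fps_X ^ n dvd h - H n"
  proof (intro exI allI)
    fix n
    show "fps_X ^ n dvd Abs_fps (\<lambda>i. fps_nth (H (Suc i)) i) - H n"
      unfolding fps_X_power_dvd_iff
    proof (intro allI impI)
      fix i assume "i < n"
      then show "fps_nth (Abs_fps (\<lambda>i. fps_nth (H (Suc i)) i) - H n) i = 0"
        using stable[of i "n - Suc i"] by simp
    qed
  qed
qed

lemma adic_complete_fps_const:
  assumes "adic_complete (t :: 'a::comm_ring_1)"
  shows "adic_complete (fps_const t)"
  unfolding adic_complete_def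
proof (intro conjI allI impI)
  fix a :: "'a fps"
  assume "\<forall>n. fps_const t ^ n dvd a"
  then show "a = 0"
    using assms unfolding adic_complete_def
    by (intro fps_ext) (auto simp: fps_const_dvd_iff)
next
  fix H :: "nat \<Rightarrow> 'a fps"
  assume H: "\<forall>n. fps_const t ^ n dvd H (Suc n) - H n"
  have "\<exists>h. \<forall>n. t ^ n dvd h - fps_nth (H n) i" for i
  proof -
    have "\<forall>n. t ^ n dvd fps_nth (H (Suc n)) i - fps_nth (H n) i"
    proof
      fix n
      show "t ^ n dvd fps_nth (H (Suc n)) i - fps_nth (H n) i"
        using H[rule_format, of n] by (simp add: fps_const_dvd_iff)
    qed
    then show ?thesis using assms[unfolded adic_complete_def, THEN conjunct2, rule_format] by simp
  qed
  then obtain h where "\<And>i n. t ^ n dvd h i - fps_nth (H n) i" by metis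
  then have "\<forall>n. fps_const t ^ n dvd Abs_fps h - H n"
    by (simp add: fps_const_dvd_iff)
  then show "\<exists>h. \<forall>n. fps_const t ^ n dvd h - H n" by blast
qed

text \<open>
  The map \<open>h \<mapsto> c + t * T h\<close> contracts \<open>t\<close>-adically. Its iterates from \<open>0\<close> form a Cauchy sequence
  whose limit is a fixed point, and the difference of two fixed points is divisible by every power
  of \<open>t\<close>.
\<close>

lemma adic_contraction_fixpoint:
  fixes t :: "'a::comm_ring_1"
  assumes t: "adic_complete t"
    and add: "\<And>a b. T (a + b) = T a + T b" and lin: "\<And>a. T (t * a) = t * T a"
  shows "\<exists>!h. h = c + t * T h"
proof -
  have T0: "T 0 = 0" using add[of 0 0] by simp
  have Tm: "T (- a) = - T a" for a using add[of a "- a"] T0 by (simp add: eq_neg_iff_add_eq_0 add.commute)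
  have diff: "T (a - b) = T a - T b" for a b using add[of a "- b"] Tm by simp
  have pow: "t ^ n dvd T a" if "t ^ n dvd a" for n a
  proof -
    have "T (t ^ n * k) = t ^ n * T k" for k
      by (induction n) (simp_all add: lin mult.assoc)
    then show ?thesis using that by (auto simp: dvd_def)
  qed
  define H where "H = rec_nat 0 (\<lambda>_ h. c + t * T h)"
  have HS: "H (Suc n) = c + t * T (H n)" for n by (simp add: H_def)
  have "t ^ n dvd H (Suc n) - H n" for n
  proof (induction n)
    case (Suc n)
    have "H (Suc (Suc n)) - H (Suc n) = t * T (H (Suc n) - H n)"
      unfolding HS diff by (simp add: algebra_simps)
    then show ?case using mult_dvd_mono[OF dvd_refl[of t] pow[OF Suc]] by simp
  qed simp
  then obtain h where h: "\<And>n. t ^ n dvd h - H n"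
    using t unfolding adic_complete_def by blast
  have "t ^ n dvd h - (c + t * T h)" for n
  proof -
    have "h - (c + t * T h) = (h - H (Suc n)) - t * T (h - H n)"
      by (simp add: HS diff algebra_simps)
    moreover have "t ^ n dvd h - H (Suc n)"
      using h[of "Suc n"] by (auto intro: dvd_mult_right)
    ultimately show ?thesis using pow[OF h[of n]] by (simp only: dvd_diff dvd_mult)
  qed
  then have "h - (c + t * T h) = 0" using t unfolding adic_complete_def by blast
  then have fix_h: "h = c + t * T h" by (rule right_minus_eq[THEN iffD1])
  have "h' = h" if h': "h' = c + t * T h'" for h'
  proof -
    have "h' - h = (c + t * T h') - (c + t * T h)"
      by (rule arg_cong2[of _ _ _ _ minus]) (fact h', fact fix_h)
    also have "\<dots> = t * T (h' - h)"
      by (simp only: diff right_diff_distrib add_diff_cancel_left)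
    finally have eq: "h' - h = t * T (h' - h)" .
    have "t ^ n dvd h' - h" for n
    proof (induction n)
      case (Suc n)
      then show ?case using mult_dvd_mono[OF dvd_refl[of t] pow[OF Suc]] by (subst eq) simp
    qed simp
    then have "h' - h = 0" using t unfolding adic_complete_def by blast
    then show ?thesis by simp
  qed
  then show ?thesis by (intro ex1I[where a = h]) (rule fix_h)
qed

lemma fps_dvd_1_iff: "(f :: 'a::comm_ring_1 fps) dvd 1 \<longleftrightarrow> fps_nth f 0 dvd 1"
proof
  assume "f dvd 1"
  then obtain g where "1 = f * g" by (auto simp: dvd_def)
  then have "fps_nth 1 0 = fps_nth (f * g) 0" by simp
  then have "1 = fps_nth f 0 * fps_nth g 0" by simp
  then show "fps_nth f 0 dvd 1" by (rule dvdI)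
next
  assume "fps_nth f 0 dvd 1"
  then obtain c where "fps_nth f 0 * c = 1" by (metis dvdE)
  then have "f * fps_right_inverse f c = 1" by (rule fps_right_inverse)
  then show "f dvd 1" by (intro dvdI) (rule sym)
qed

text \<open>
  Weierstrass division. Write \<open>f = t * A + y ^ d * U\<close> with \<open>U * V = 1\<close> and let \<open>h = q * U\<close>. The
  remainder \<open>p - q * f\<close> has degree below \<open>d\<close> iff \<open>h\<close> is the fixed point of the contraction
  \<open>h \<mapsto> \<tau> p - t * \<tau> (A * V * h)\<close>, where \<open>\<tau>\<close> drops the coefficients below \<open>d\<close> and divides by
  \<open>y ^ d\<close>. So quotient and remainder exist and are unique.
\<close>

theorem distinguished_division:
  fixes f p :: "'a::comm_ring_1 fps"
  assumes t: "adic_complete t" and low: "\<And>j. j < d \<Longrightarrow> t dvd fps_nth f j"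
    and unit: "fps_nth f d dvd 1"
  obtains q r where "p = q * f + r" "fps_shift d r = 0"
    and "\<And>q' r'. p = q' * f + r' \<Longrightarrow> fps_shift d r' = 0 \<Longrightarrow> q' = q \<and> r' = r"
proof -
  define U where "U = fps_shift d f"
  have "U dvd 1" unfolding fps_dvd_1_iff U_def using unit by simp
  then obtain V where V: "U * V = 1" by (metis dvdE)
  have "\<forall>j. \<exists>a. j < d \<longrightarrow> fps_nth f j = t * a" using low by (auto simp: dvd_def)
  then obtain a where a: "\<And>j. j < d \<Longrightarrow> fps_nth f j = t * a j" by metis
  define A where "A = Abs_fps (\<lambda>j. if j < d then a j else 0)"
  have f: "f = fps_const t * A + fps_X ^ d * U"
    by (intro fps_ext) (auto simp: A_def U_def a fps_X_power_mult_nth)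
  define T where "T = (\<lambda>h. - fps_shift d (A * V * h))"
  have shift_qf: "fps_shift d (q * f) = q * U - fps_const t * T (q * U)" for q
  proof -
    have "q * f = (U * V) * q * f" by (simp only: V mult_1)
    also have "\<dots> = (U * V) * q * (fps_const t * A + fps_X ^ d * U)"
      by (simp only: f[symmetric])
    also have "\<dots> = fps_const t * (A * V * (q * U)) + (q * U * (U * V)) * fps_X ^ d"
      by (simp only: distrib_left mult_ac)
    finally have "q * f = fps_const t * (A * V * (q * U)) + (q * U) * fps_X ^ d"
      by (simp only: V mult_1_right)
    moreover have "fps_shift d (fps_const t * B) = fps_const t * fps_shift d B" for B
      by (intro fps_ext) simp
    moreover have "fps_shift d (B * fps_X ^ d) = B" for B :: "'a fps"
      by (intro fps_ext) (simp add: fps_X_power_mult_right_nth)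
    ultimately show ?thesis by (simp add: T_def fps_shift_add)
  qed
  have ex1: "\<exists>!h. h = c + fps_const t * T h" for c
  proof (rule adic_contraction_fixpoint[OF adic_complete_fps_const[OF t]])
    show "T (x + y) = T x + T y" for x y
      by (simp add: T_def distrib_left fps_shift_add)
    show "T (fps_const t * x) = fps_const t * T x" for x
      by (intro fps_ext) (simp add: T_def mult.left_commute)
  qed
  have ex1_unique: "h = h'" if "h = c + fps_const t * T h" "h' = c + fps_const t * T h'" for c h h'
    by (rule trans[OF the1_equality[OF ex1 that(1), symmetric] the1_equality[OF ex1 that(2)]])
  obtain h where h: "h = fps_shift d p + fps_const t * T h"
    using ex1_implies_ex[OF ex1] by (rule exE)
  define q where "q = h * V"
  have qU: "q * U = h" by (simp add: q_def mult.assoc V mult.commute[of V U])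
  show ?thesis
  proof (rule that[of q "p - q * f"])
    have "fps_shift d (p - q * f) = fps_shift d p - fps_shift d (q * f)"
      by (intro fps_ext) simp
    also have "\<dots> = fps_shift d p + fps_const t * T h - h"
      unfolding shift_qf qU by (simp only: diff_diff_eq2)
    also have "\<dots> = 0" unfolding h[symmetric] by simp
    finally show "fps_shift d (p - q * f) = 0" .
    fix q' r' assume *: "p = q' * f + r'" "fps_shift d r' = 0"
    then have "fps_shift d p = fps_shift d (q' * f)" by (simp add: fps_shift_add)
    then have "q' * U = fps_shift d p + fps_const t * T (q' * U)"
      unfolding shift_qf by simp
    from ex1_unique[OF this h] have "q' * U = h" .
    then have "q' * (U * V) = q" unfolding q_def by (simp only: mult.assoc[symmetric])
    then have "q' = q" by (simp only: V mult_1_right)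
    then show "q' = q \<and> r' = p - q * f" using * by simp
  qed simp
qed

definition ring_map :: "('a::comm_ring_1 \<Rightarrow> 'b::comm_ring_1) \<Rightarrow> bool" where
  "ring_map h \<longleftrightarrow> h 1 = 1 \<and> (\<forall>a b. h (a + b) = h a + h b) \<and> (\<forall>a b. h (a * b) = h a * h b)"

lemma ring_map_simps:
  assumes "ring_map h"
  shows "h 1 = 1" "h (a + b) = h a + h b" "h (a * b) = h a * h b" "h 0 = 0"
    "h (- a) = - h a" "h (a - b) = h a - h b" "h (a ^ n) = h a ^ n"
proof -
  show 1: "h 1 = 1" and add: "h (a + b) = h a + h b" and 2: "h (a * b) = h a * h b" for a b
    using assms by (auto simp: ring_map_def)
  show 0: "h 0 = 0" using add[of 0 0] by simp
  show m: "h (- a) = - h a" for a using add[of a "- a"] 0 by (simp add: eq_neg_iff_add_eq_0 add.commute)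
  show "h (a - b) = h a - h b" using add[of a "- b"] m[of b] by simp
  show "h (a ^ n) = h a ^ n" by (induction n) (simp_all add: 1 2)
qed

lemma ring_map_dvd: "ring_map h \<Longrightarrow> a dvd b \<Longrightarrow> h a dvd h b"
  by (auto simp: dvd_def ring_map_simps)

lemma ring_map_comp: "ring_map h \<Longrightarrow> ring_map h' \<Longrightarrow> ring_map (\<lambda>a. h' (h a))"
  by (auto simp: ring_map_def)

text \<open>
  Uniqueness of remainders turns division by \<open>f\<close> into a ring homomorphism. The remainders need not
  form a subring: \<open>emb\<close> identifies them additively with a ring whose multiplication agrees with
  that of power series only modulo \<open>f\<close>.
\<close>

lemma quotient_by_distinguished:
  fixes f :: "'a::comm_ring_1 fps" and emb :: "'b::comm_ring_1 \<Rightarrow> 'a fps"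
  assumes t: "adic_complete t" and low: "\<And>j. j < d \<Longrightarrow> t dvd fps_nth f j"
    and unit: "fps_nth f d dvd 1"
    and emb: "\<And>r. fps_shift d r = 0 \<Longrightarrow> \<exists>u. r = emb u" "\<And>u. fps_shift d (emb u) = 0" "inj emb"
    and hom: "emb 1 = 1" "\<And>u v. emb (u + v) = emb u + emb v"
      "\<And>u v. f dvd emb u * emb v - emb (u * v)"
  obtains \<pi> where "ring_map \<pi>" "\<And>p. f dvd p - emb (\<pi> p)" "\<And>p u. f dvd p - emb u \<Longrightarrow> \<pi> p = u"
proof -
  have ex: "\<exists>u. f dvd p - emb u" and
    uniq: "f dvd p - emb u \<Longrightarrow> f dvd p - emb v \<Longrightarrow> u = v" for p u v
  proof -
    obtain q r where qr: "p = q * f + r" "fps_shift d r = 0"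
      and un: "\<And>q' r'. p = q' * f + r' \<Longrightarrow> fps_shift d r' = 0 \<Longrightarrow> q' = q \<and> r' = r"
      using distinguished_division[where p = p, OF t low unit] by metis
    obtain c where c: "r = emb c" using emb(1) qr(2) by blast
    show "\<exists>u. f dvd p - emb u"
      using qr(1) by (intro exI[of _ c]) (simp add: c)
    have *: "emb e = r" if "f dvd p - emb e" for e
    proof -
      from that obtain k where "p - emb e = f * k" by (rule dvdE)
      then have "p = k * f + emb e" by (simp add: algebra_simps)
      then show ?thesis using un[of k "emb e"] emb(2) by blast
    qed
    assume u: "f dvd p - emb u" and v: "f dvd p - emb v"
    show "u = v" by (rule injD[OF emb(3)]) (simp only: *[OF u] *[OF v])
  qed
  define \<pi> where "\<pi> p = (SOME u. f dvd p - emb u)" for p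
  have \<pi>: "f dvd p - emb (\<pi> p)" for p unfolding \<pi>_def by (rule someI_ex[OF ex])
  have eq: "\<pi> p = u" if "f dvd p - emb u" for p u by (rule uniq[OF \<pi> that])
  have "\<pi> (p + q) = \<pi> p + \<pi> q" for p q
  proof (rule eq)
    have "p + q - emb (\<pi> p + \<pi> q) = (p - emb (\<pi> p)) + (q - emb (\<pi> q))"
      by (simp add: hom(2))
    then show "f dvd p + q - emb (\<pi> p + \<pi> q)" using dvd_add[OF \<pi>[of p] \<pi>[of q]] by (simp only:)
  qed
  moreover have "\<pi> (p * q) = \<pi> p * \<pi> q" for p q
  proof (rule eq)
    have "p * q - emb (\<pi> p * \<pi> q) = (p - emb (\<pi> p)) * q + emb (\<pi> p) * (q - emb (\<pi> q))
        + (emb (\<pi> p) * emb (\<pi> q) - emb (\<pi> p * \<pi> q))"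
      by (simp add: algebra_simps)
    then show "f dvd p * q - emb (\<pi> p * \<pi> q)"
      using dvd_add[OF dvd_add[OF dvd_mult2[OF \<pi>[of p]] dvd_mult[OF \<pi>[of q]]] hom(3)] by (simp only:)
  qed
  moreover have "\<pi> 1 = 1" by (rule eq) (simp add: hom(1))
  ultimately have "ring_map \<pi>" by (simp add: ring_map_def)
  then show ?thesis using that \<pi> eq by blast
qed

text \<open>The value of a power series at \<open>s\<close> is its remainder modulo \<open>y - s\<close>.\<close>

lemma adic_evaluation:
  fixes t s :: "'a::comm_ring_1"
  assumes t: "adic_complete t" and s: "t dvd s"
  obtains \<sigma> :: "'a fps \<Rightarrow> 'a"
  where "ring_map \<sigma>" "\<And>a. \<sigma> (fps_const a) = a" "\<sigma> fps_X = s"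
proof -
  define f where "f = fps_X - fps_const s"
  have const: "\<exists>c. r = fps_const c" if "fps_shift 1 r = 0" for r :: "'a fps"
  proof (rule exI, rule fps_ext)
    fix n
    have "fps_nth (fps_shift 1 r) m = 0" for m using that by simp
    then show "fps_nth r n = fps_nth (fps_const (fps_nth r 0)) n" by (cases n) auto
  qed
  have inj: "inj (fps_const :: 'a \<Rightarrow> 'a fps)"
  proof (rule injI)
    fix a b :: 'a assume "fps_const a = fps_const b"
    then have "fps_nth (fps_const a) 0 = fps_nth (fps_const b) 0" by simp
    then show "a = b" by simp
  qed
  have low: "t dvd fps_nth f j" if "j < 1" for j using that s by (simp add: f_def)
  have unit: "fps_nth f 1 dvd 1" by (simp add: f_def)
  obtain \<sigma> where \<sigma>: "ring_map \<sigma>" "\<And>p c. f dvd p - fps_const c \<Longrightarrow> \<sigma> p = c"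
    by (rule quotient_by_distinguished[OF t low unit const _ inj]) (simp_all add: fps_shift_fps_const)
  show ?thesis
    by (rule that[OF \<sigma>(1)]; rule \<sigma>(2)) (simp_all add: f_def)
qed

section \<open>Plane power series and their restriction to arcs\<close>

type_synonym 'k fps2 = "'k fps fps"

abbreviation xS :: "'k::field fps2" where "xS \<equiv> fps_const fps_X"
abbreviation yS :: "'k::field fps2" where "yS \<equiv> fps_X"
abbreviation kS :: "'k::field \<Rightarrow> 'k fps2" where "kS c \<equiv> fps_const (fps_const c)"

lemma adic_complete_xS: "adic_complete (xS :: 'k::field fps2)"
  by (intro adic_complete_fps_const adic_complete_fps_X)

text \<open>
  An arc through the origin substitutes \<open>H1\<close> for \<open>x\<close> in every coefficient and then evaluates at
  \<open>y = H2\<close>.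
\<close>

lemma arc_restriction:
  fixes H1 H2 :: "'k::field fps"
  assumes "fps_nth H1 0 = 0" "fps_nth H2 0 = 0"
  obtains \<sigma> :: "'k fps2 \<Rightarrow> 'k fps"
  where "ring_map \<sigma>" "\<sigma> xS = H1" "\<sigma> yS = H2" "\<And>c. \<sigma> (kS c) = fps_const c"
proof -
  obtain ev :: "'k fps2 \<Rightarrow> 'k fps" where ev: "ring_map ev"
    "\<And>a. ev (fps_const a) = a" "ev fps_X = H2"
    using adic_evaluation[OF adic_complete_fps_X, of H2] assms(2) by (auto simp: fps_X_dvd_iff)
  define m :: "'k fps2 \<Rightarrow> 'k fps2" where "m p = Abs_fps (\<lambda>i. fps_compose (fps_nth p i) H1)" for p
  have m_const: "m (fps_const a) = fps_const (fps_compose a H1)" for a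
    by (intro fps_ext) (simp add: m_def)
  have "ring_map m"
    unfolding ring_map_def
  proof (intro conjI allI)
    show "m 1 = 1" using m_const[of 1] by simp
    show "m (a + b) = m a + m b" for a b
      by (intro fps_ext) (simp add: m_def fps_compose_add_distrib)
    show "m (a * b) = m a * m b" for a b
      by (intro fps_ext)
        (simp add: m_def fps_mult_nth fps_compose_sum_distrib fps_compose_mult_distrib[OF assms(1)])
  qed
  then have "ring_map (\<lambda>p. ev (m p))" using ev(1) by (rule ring_map_comp)
  moreover have "m fps_X = fps_X" by (intro fps_ext) (simp add: m_def)
  ultimately show ?thesis
    using that[of "\<lambda>p. ev (m p)"] assms by (simp add: m_const ev)
qed

text \<open>The coefficient of \<open>x ^ i * y ^ j\<close>.\<close>

abbreviation coeff2 :: "'k::field fps2 \<Rightarrow> nat \<Rightarrow> nat \<Rightarrow> 'k" where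
  "coeff2 s i j \<equiv> fps_nth (fps_nth s j) i"

lemma fps2_unit_iff: "(s :: 'k::field fps2) dvd 1 \<longleftrightarrow> coeff2 s 0 0 \<noteq> 0"
  by (simp add: fps_dvd_1_iff)

lemma xS_dvd_iff: "xS dvd (s :: 'k::field fps2) \<longleftrightarrow> (\<forall>j. coeff2 s 0 j = 0)"
  by (simp add: fps_const_dvd_iff fps_X_dvd_iff)

text \<open>
  The part of \<open>s\<close> free of \<open>x\<close> is \<open>yS ^ N * v\<close>. When \<open>N\<close> is its exact order, \<open>v\<close> is a unit.
\<close>

lemma fps2_mod_xS_truncate:
  fixes s :: "'k::field fps2"
  assumes "\<And>j. j < N \<Longrightarrow> coeff2 s 0 j = 0"
  obtains s' v where "s = xS * s' + yS ^ N * v" "coeff2 v 0 0 = coeff2 s 0 N"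
proof -
  define v where "v = Abs_fps (\<lambda>j. fps_const (coeff2 s 0 (j + N)))"
  have "xS dvd s - yS ^ N * v"
    unfolding xS_dvd_iff using assms by (auto simp: v_def fps_X_power_mult_nth)
  then obtain s' where "s - yS ^ N * v = xS * s'" by (rule dvdE)
  then have "s = xS * s' + yS ^ N * v" by (simp add: algebra_simps)
  moreover have "coeff2 v 0 0 = coeff2 s 0 N" by (simp add: v_def)
  ultimately show ?thesis by (rule that)
qed

lemma fps2_mod_xS:
  fixes s :: "'k::field fps2"
  assumes "\<not> xS dvd s"
  obtains s' N v where "s = xS * s' + yS ^ N * v" "v dvd 1"
    "\<And>j. j < N \<Longrightarrow> coeff2 s 0 j = 0" "coeff2 s 0 N \<noteq> 0"
proof -
  define N where "N = (LEAST j. coeff2 s 0 j \<noteq> 0)"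
  have "\<exists>j. coeff2 s 0 j \<noteq> 0" using assms by (auto simp: xS_dvd_iff)
  then have N: "coeff2 s 0 N \<noteq> 0" unfolding N_def by (rule LeastI_ex)
  have less: "coeff2 s 0 j = 0" if "j < N" for j
    using not_less_Least[OF that[unfolded N_def]] by simp
  obtain s' v where "s = xS * s' + yS ^ N * v" "coeff2 v 0 0 = coeff2 s 0 N"
    using fps2_mod_xS_truncate[OF less] .
  then show ?thesis using that[of s' N v] N less by (simp add: fps2_unit_iff)
qed

lemma fps2_maximal_decomp:
  fixes s :: "'k::field fps2"
  obtains p q where "s = kS (coeff2 s 0 0) + xS * p + yS * q"
proof -
  define q where "q = fps_shift 1 s"
  have "s - yS * q = fps_const (fps_nth s 0)"
  proof (rule fps_ext)
    show "fps_nth (s - yS * q) n = fps_nth (fps_const (fps_nth s 0)) n" for n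
      by (cases n) (simp_all add: q_def)
  qed
  then have s: "s = fps_const (fps_nth s 0) + yS * q" by (rule diff_eq_eq[THEN iffD1])
  define a c where "a = fps_nth s 0" and "c = fps_nth a 0"
  have "fps_X dvd a - fps_const c" by (simp add: fps_X_dvd_iff c_def)
  then obtain p where "a - fps_const c = fps_X * p" by (rule dvdE)
  then have a: "a = fps_const c + fps_X * p" by (simp add: algebra_simps)
  have "fps_const a = kS c + xS * fps_const p" by (subst a) simp
  then have "s = kS c + xS * fps_const p + yS * q" using s by (simp add: a_def)
  then show ?thesis using that unfolding c_def a_def by blast
qed

section \<open>The ring of the surface\<close>

abbreviation gS :: "'k::field fps2" where "gS \<equiv> xS ^ 3 + xS * yS ^ 3"

text \<open>
  Otherwise \<open>a\<^sup>2 = - g * b\<^sup>2\<close>. Since \<open>g\<close> has \<open>y\<close>-order \<open>0\<close>, comparing the lowest coefficients in \<open>y\<close>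
  gives \<open>u\<^sup>2 = - x ^ 3 * v\<^sup>2\<close> for nonzero \<open>u\<close> and \<open>v\<close> in \<open>k\<lbrakk>x\<rbrakk>\<close>, where the orders have different parity.
\<close>

lemma norm_form_anisotropic:
  fixes a b :: "'k::field fps2"
  assumes "a\<^sup>2 + gS * b\<^sup>2 = 0"
  shows "a = 0 \<and> b = 0"
proof (rule ccontr)
  assume *: "\<not> (a = 0 \<and> b = 0)"
  have eq: "a\<^sup>2 = - (gS * b\<^sup>2)" using assms by (simp add: eq_neg_iff_add_eq_0)
  have g0: "fps_nth (gS :: 'k fps2) 0 = fps_X ^ 3" by simp
  have g: "(gS :: 'k fps2) \<noteq> 0"
  proof
    assume "(gS :: 'k fps2) = 0"
    then have "fps_nth (gS :: 'k fps2) 0 = 0" by (simp only: fps_zero_nth)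
    then have "(fps_X :: 'k fps) ^ 3 = 0" by (simp only: g0)
    then show False by simp
  qed
  with * eq have nz: "a \<noteq> 0" "b \<noteq> 0" by auto
  have sg: "subdegree (gS :: 'k fps2) = 0" using g0 by (simp add: subdegree_eq_0_iff)
  have "subdegree (a\<^sup>2) = subdegree (gS * b\<^sup>2)" using eq by simp
  then have sd: "subdegree a = subdegree b" using g nz by (simp add: sg)
  define u v where "u = fps_nth a (subdegree a)" and "v = fps_nth b (subdegree b)"
  have bb: "fps_nth (b * b) (subdegree (b * b)) = v * v"
    using nz by (simp add: v_def)
  have "fps_nth (a * a) (subdegree a + subdegree a) = fps_nth (- (gS * (b * b))) (subdegree a + subdegree a)"
    using eq by (simp add: power2_eq_square)
  also have "\<dots> = - fps_nth (gS * (b * b)) (subdegree (gS :: 'k fps2) + subdegree (b * b))"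
    using nz by (simp add: sg sd)
  also have "fps_nth (gS * (b * b)) (subdegree (gS :: 'k fps2) + subdegree (b * b)) = fps_X ^ 3 * (v * v)"
    unfolding nth_subdegree_mult by (simp only: sg g0 bb)
  finally have "u * u = - (fps_X ^ 3 * (v * v))"
    by (simp add: u_def)
  then have "subdegree (u * u) = subdegree (fps_X ^ 3 * (v * v))" by simp
  moreover have "u \<noteq> 0" "v \<noteq> 0" using nz by (simp_all add: u_def v_def)
  ultimately have "2 * subdegree u = 3 + 2 * subdegree v" by (simp add: fps_X_power_subdegree)
  then show False by presburger
qed

text \<open>
  \<open>E7 a b\<close> stands for \<open>a + b * z\<close> with \<open>z\<^sup>2 = - g\<close>: the surface ring is free over \<open>k\<lbrakk>x, y\<rbrakk>\<close> with basis
  \<open>1, z\<close>. As a type it carries the class of integral domains, so its arithmetic is within reach of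
  the algebraic simplification rules.
\<close>

datatype 'k e7 = E7 (cpart: "'k fps2") (zpart: "'k fps2")

lemma e7_eq_iff: "u = v \<longleftrightarrow> cpart u = cpart v \<and> zpart u = zpart v"
  by (cases u; cases v) auto

instantiation e7 :: (field) comm_ring_1
begin

definition "0 = E7 0 0"
definition "1 = E7 1 0"
definition "u + v = E7 (cpart u + cpart v) (zpart u + zpart v)"
definition "u - v = E7 (cpart u - cpart v) (zpart u - zpart v)"
definition "- u = E7 (- cpart u) (- zpart u)"
definition "u * v = E7 (cpart u * cpart v - gS * (zpart u * zpart v))
                       (cpart u * zpart v + zpart u * cpart v)"

instance
  by standard
    (auto simp: zero_e7_def one_e7_def plus_e7_def minus_e7_def uminus_e7_def times_e7_def
      algebra_simps)

end

lemmas e7_defs = zero_e7_def one_e7_def plus_e7_def minus_e7_def uminus_e7_def times_e7_def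

definition e7_conj :: "'k::field e7 \<Rightarrow> 'k e7" where "e7_conj u = E7 (cpart u) (- zpart u)"
definition e7_norm :: "'k::field e7 \<Rightarrow> 'k fps2" where "e7_norm u = (cpart u)\<^sup>2 + gS * (zpart u)\<^sup>2"
abbreviation cS :: "'k::field fps2 \<Rightarrow> 'k e7" where "cS s \<equiv> E7 s 0"
abbreviation zR :: "'k::field e7" where "zR \<equiv> E7 0 1"

lemma mult_e7_conj: "u * e7_conj u = cS (e7_norm u)"
  by (simp add: e7_defs e7_conj_def e7_norm_def power2_eq_square algebra_simps)

lemma add_e7_conj: "u + e7_conj u = cS (2 * cpart u)"
  by (simp add: e7_defs e7_conj_def)

lemma e7_norm_mult: "e7_norm (u * v) = e7_norm u * e7_norm v"
  by (simp add: e7_defs e7_norm_def power2_eq_square algebra_simps)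

lemma e7_norm_eq_0_iff: "e7_norm u = 0 \<longleftrightarrow> u = 0"
  using norm_form_anisotropic[of "cpart u" "zpart u"]
  by (auto simp: e7_norm_def e7_eq_iff zero_e7_def)

instance e7 :: (field) idom
proof
  fix u v :: "'a e7" assume "u \<noteq> 0" "v \<noteq> 0"
  then show "u * v \<noteq> 0" using e7_norm_mult[of u v] by (metis e7_norm_eq_0_iff mult_eq_0_iff)
qed

lemma ring_map_cS: "ring_map (cS :: 'k::field fps2 \<Rightarrow> 'k e7)"
  by (simp add: ring_map_def e7_defs)

lemmas cS_simps = ring_map_simps[OF ring_map_cS]

lemma E7_decomp: "E7 a b = cS a + zR * cS b"
  by (simp add: e7_defs)

lemma zR_square: "zR * zR = - cS gS"
  by (simp add: e7_defs)

lemma e7_unit: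
  assumes "coeff2 (cpart (u :: 'k::field e7)) 0 0 \<noteq> 0"
  shows "u dvd 1"
proof -
  have "e7_norm u dvd 1" using assms by (simp add: fps2_unit_iff e7_norm_def power2_eq_square)
  then have "cS (e7_norm u) dvd cS 1" by (rule ring_map_dvd[OF ring_map_cS])
  then have "u * e7_conj u dvd 1" by (simp add: mult_e7_conj one_e7_def)
  then show ?thesis by (rule dvd_mult_left)
qed

text \<open>
  The equation \<open>z\<^sup>2 + g\<close> is distinguished of degree \<open>2\<close> over \<open>k\<lbrakk>x, y\<rbrakk>\<close>, because \<open>x\<close> divides \<open>g\<close>. Its
  remainders \<open>a + b * z\<close> are the elements of \<open>e7\<close>.
\<close>

theorem e7_presentation:
  obtains \<pi> :: "'k::field fps3 \<Rightarrow> 'k e7"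
  where "ring_map \<pi>" "\<And>s. \<pi> (fps_const s) = cS s" "\<pi> fps_X = zR"
    "\<And>p. \<pi> p = 0 \<longleftrightarrow> fps_X\<^sup>2 + fps_const gS dvd p"
proof -
  define f :: "'k fps3" where "f = fps_X\<^sup>2 + fps_const gS"
  define emb :: "'k e7 \<Rightarrow> 'k fps3" where "emb u = fps_const (cpart u) + fps_const (zpart u) * fps_X" for u
  have emb: "\<exists>u. r = emb u" if "fps_shift 2 r = 0" for r :: "'k fps3"
  proof (rule exI, rule fps_ext)
    fix n
    have *: "fps_nth (fps_shift 2 r) m = 0" for m using that by simp
    show "fps_nth r n = fps_nth (emb (E7 (fps_nth r 0) (fps_nth r 1))) n"
    proof (cases "n < 2")
      case True
      then have "n = 0 \<or> n = 1" by auto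
      then show ?thesis by (auto simp: emb_def)
    next
      case False
      then obtain m where "n = m + 2" by (metis add.commute le_Suc_ex not_less)
      then show ?thesis using *[of m] by (auto simp: emb_def)
    qed
  qed
  have emb_shift: "fps_shift 2 (emb u) = 0" for u by (intro fps_ext) (simp add: emb_def)
  have emb_inj: "inj emb"
  proof (rule injI)
    fix u v assume eq: "emb u = emb v"
    have "fps_nth (emb u) 0 = fps_nth (emb v) 0" "fps_nth (emb u) 1 = fps_nth (emb v) 1"
      using eq by simp_all
    then show "u = v" by (simp add: emb_def e7_eq_iff)
  qed
  have emb_add: "emb (u + v) = emb u + emb v" for u v
    by (simp add: emb_def plus_e7_def algebra_simps flip: fps_const_add)
  have emb_mult: "f dvd emb u * emb v - emb (u * v)" for u v
  proof
    show "emb u * emb v - emb (u * v) = f * fps_const (zpart u * zpart v)"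
      by (simp add: emb_def times_e7_def f_def algebra_simps power2_eq_square
          flip: fps_const_add fps_const_mult fps_const_sub)
  qed
  have emb_1: "emb 1 = 1" by (simp add: emb_def one_e7_def)
  have low: "xS dvd fps_nth f j" if "j < 2" for j
  proof -
    have "(gS :: 'k fps2) = xS * (xS\<^sup>2 + yS ^ 3)"
      by (simp only: distrib_left power2_eq_square power3_eq_cube mult.assoc)
    then have "xS dvd (gS :: 'k fps2)" by (rule dvdI)
    moreover have "j = 0 \<or> j = 1" using that by auto
    ultimately show ?thesis by (auto simp: f_def power2_eq_square)
  qed
  have unit: "fps_nth f 2 dvd 1" by (simp add: f_def)
  obtain \<pi> where \<pi>: "ring_map \<pi>" "\<And>p. f dvd p - emb (\<pi> p)" and eq: "\<And>p u. f dvd p - emb u \<Longrightarrow> \<pi> p = u"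
    using quotient_by_distinguished[OF adic_complete_xS low unit emb emb_shift emb_inj emb_1 emb_add emb_mult]
    by metis
  show ?thesis
  proof (rule that[OF \<pi>(1)])
    show "\<pi> (fps_const s) = cS s" for s by (rule eq) (simp add: emb_def)
    show "\<pi> fps_X = zR" by (rule eq) (simp add: emb_def)
    have "emb 0 = 0" by (simp add: emb_def zero_e7_def)
    then show "\<pi> p = 0 \<longleftrightarrow> fps_X\<^sup>2 + fps_const gS dvd p" for p
      using \<pi>(2)[of p] eq[of p 0] by (auto simp: f_def)
  qed
qed

definition ideal_set :: "'a::comm_ring_1 set \<Rightarrow> bool" where
  "ideal_set T \<longleftrightarrow> 0 \<in> T \<and> (\<forall>a\<in>T. \<forall>b\<in>T. a + b \<in> T) \<and> (\<forall>r. \<forall>a\<in>T. r * a \<in> T)"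

lemma ideal_setD:
  assumes "ideal_set T"
  shows "0 \<in> T" "a \<in> T \<Longrightarrow> b \<in> T \<Longrightarrow> a + b \<in> T" "a \<in> T \<Longrightarrow> r * a \<in> T" "a \<in> T \<Longrightarrow> a * r \<in> T"
    "a \<in> T \<Longrightarrow> b \<in> T \<Longrightarrow> a - b \<in> T"
proof -
  show "0 \<in> T" and p: "a \<in> T \<Longrightarrow> b \<in> T \<Longrightarrow> a + b \<in> T" and m: "a \<in> T \<Longrightarrow> r * a \<in> T" for a b r
    using assms by (auto simp: ideal_set_def)
  then show "a \<in> T \<Longrightarrow> a * r \<in> T" by (simp add: mult.commute)
  show "a \<in> T \<Longrightarrow> b \<in> T \<Longrightarrow> a - b \<in> T" using p[of a "- 1 * b"] m[of b "- 1"] by simp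
qed

lemma ideal_set_cancel_unit:
  assumes "ideal_set T" "u dvd 1" "a * u \<in> T"
  shows "a \<in> T"
proof -
  from assms(2) obtain w where "1 = u * w" by (rule dvdE)
  then have "a = (a * u) * w" by (simp add: mult.assoc)
  then show ?thesis using ideal_setD(4)[OF assms(1,3), of w] by simp
qed

text \<open>
  The value at \<open>kS c\<close> is part of the notion, since a ring homomorphism may move the constants.
\<close>

definition arc :: "('k::field fps2 \<Rightarrow> 'k fps) \<Rightarrow> 'k fps \<Rightarrow> 'k fps \<Rightarrow> bool" where
  "arc \<sigma> H1 H2 \<longleftrightarrow> ring_map \<sigma> \<and> \<sigma> xS = H1 \<and> \<sigma> yS = H2 \<and> (\<forall>c. \<sigma> (kS c) = fps_const c)
     \<and> fps_nth H1 0 = 0 \<and> fps_nth H2 0 = 0"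

lemma arc_exists:
  assumes "fps_nth H1 0 = 0" "fps_nth H2 0 = 0"
  obtains \<sigma> where "arc \<sigma> H1 H2"
  using arc_restriction[OF assms] assms unfolding arc_def by metis

lemma arc_expand:
  assumes "arc \<sigma> H1 H2"
  obtains p q where "s = kS (coeff2 s 0 0) + xS * p + yS * q"
    "\<sigma> s = fps_const (coeff2 s 0 0) + H1 * \<sigma> p + H2 * \<sigma> q"
proof -
  have r: "ring_map \<sigma>" using assms by (simp add: arc_def)
  obtain p q where pq: "s = kS (coeff2 s 0 0) + xS * p + yS * q" by (rule fps2_maximal_decomp)
  have "\<sigma> (kS c + xS * p + yS * q) = fps_const c + H1 * \<sigma> p + H2 * \<sigma> q" for c
    using assms by (simp only: ring_map_simps[OF r]) (simp add: arc_def)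
  with pq have "\<sigma> s = fps_const (coeff2 s 0 0) + H1 * \<sigma> p + H2 * \<sigma> q" by metis
  with pq show ?thesis by (rule that)
qed

lemma arc_coeff_0:
  assumes "arc \<sigma> H1 H2"
  shows "fps_nth (\<sigma> s) 0 = coeff2 s 0 0"
proof -
  obtain p q where "\<sigma> s = fps_const (coeff2 s 0 0) + H1 * \<sigma> p + H2 * \<sigma> q"
    using arc_expand[OF assms] by metis
  then show ?thesis using assms by (simp add: arc_def)
qed

lemma arc_coeff_1:
  assumes "arc \<sigma> H1 H2"
  shows "fps_nth (\<sigma> s) 1 = coeff2 s 1 0 * fps_nth H1 1 + coeff2 s 0 1 * fps_nth H2 1"
proof -
  obtain p q where s: "s = kS (coeff2 s 0 0) + xS * p + yS * q"
    and "\<sigma> s = fps_const (coeff2 s 0 0) + H1 * \<sigma> p + H2 * \<sigma> q"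
    using arc_expand[OF assms] by metis
  then have "fps_nth (\<sigma> s) 1 = fps_nth H1 1 * fps_nth (\<sigma> p) 0 + fps_nth H2 1 * fps_nth (\<sigma> q) 0"
    using assms by (simp add: arc_def)
  moreover have "coeff2 s 1 0 = coeff2 p 0 0" by (subst s) simp
  moreover have "coeff2 s 0 1 = coeff2 q 0 0" by (subst s) simp
  ultimately show ?thesis by (simp add: arc_coeff_0[OF assms])
qed

lemma fps2_linear_decomp:
  assumes "coeff2 s 0 0 = 0"
  obtains A B where "s = xS * A + yS * B" "coeff2 A 0 0 = coeff2 s 1 0" "coeff2 B 0 0 = coeff2 s 0 1"
proof -
  obtain p q where s: "s = xS * p + yS * q" using fps2_maximal_decomp[of s] assms by auto
  moreover have "coeff2 s 1 0 = coeff2 p 0 0" by (subst s) simp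
  moreover have "coeff2 s 0 1 = coeff2 q 0 0" by (subst s) simp
  ultimately show ?thesis using that by simp
qed

lemma fps2_tangent_decomp:
  assumes "coeff2 s 0 0 = 0" "coeff2 s 0 1 = 0"
  obtains A B where "s = xS * A + yS\<^sup>2 * B" "coeff2 A 0 0 = coeff2 s 1 0"
proof -
  obtain p q where s: "s = xS * p + yS * q" "coeff2 p 0 0 = coeff2 s 1 0" "coeff2 q 0 0 = 0"
    using fps2_linear_decomp[OF assms(1)] assms(2) by metis
  obtain q1 q2 where q: "q = xS * q1 + yS * q2" using fps2_linear_decomp[OF s(3)] by metis
  have "s = xS * (p + yS * q1) + yS\<^sup>2 * q2"
    by (simp add: s(1) q algebra_simps power2_eq_square)
  moreover have "coeff2 (p + yS * q1) 0 0 = coeff2 s 1 0" using s(2) by simp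
  ultimately show ?thesis using that by blast
qed

section \<open>Test ideals of matrix factorizations\<close>

text \<open>
  The situation left by a matrix \<open>\<phi>\<close> with \<open>\<phi>\<^sup>2 = - g\<close>, once a diagonal entry \<open>a\<close> has been subtracted from
  its diagonal: \<open>\<Psi>\<close> is the set of entries of \<open>\<phi> - a\<close>, and \<open>J\<close> an ideal containing them. The two
  divisibility conditions say that \<open>a\<^sup>2 + g\<close> and \<open>a * \<Psi>\<close> lie in the square of the ideal generated by
  \<open>\<Psi>\<close>, expressed through the orders along homomorphisms to \<open>k\<lbrakk>t\<rbrakk>\<close>, on which the argument rests.
\<close>

locale reduced_z =
  fixes J :: "'k::field fps2 set" and \<Psi> :: "'k fps2 set" and a :: "'k fps2"
  assumes J: "ideal_set J" and sub: "\<Psi> \<subseteq> J"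
    and square: "\<And>(\<sigma> :: 'k fps2 \<Rightarrow> 'k fps) v. ring_map \<sigma> \<Longrightarrow> (\<And>q. q \<in> \<Psi> \<Longrightarrow> fps_X ^ v dvd \<sigma> q) \<Longrightarrow>
      fps_X ^ (2 * v) dvd \<sigma> (a\<^sup>2 + gS)"
    and linear: "\<And>(\<sigma> :: 'k fps2 \<Rightarrow> 'k fps) v q. ring_map \<sigma> \<Longrightarrow> (\<And>q. q \<in> \<Psi> \<Longrightarrow> fps_X ^ v dvd \<sigma> q) \<Longrightarrow>
      q \<in> \<Psi> \<Longrightarrow> fps_X ^ (2 * v) dvd \<sigma> (a * q)"
    and two: "(2 :: 'k) \<noteq> 0"
begin

text \<open>
  Let \<open>v\<close> be the least order of \<open>\<Psi>\<close> along \<open>\<sigma>\<close>, attained at \<open>q0\<close>. The order of \<open>a * q0\<close> is at least \<open>2 * v\<close>,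
  so that of \<open>a\<close> is at least \<open>v\<close>; hence \<open>a\<^sup>2\<close>, and with it \<open>g\<close>, has order at least \<open>2 * v\<close>. In other
  words, \<open>a\<close> is integral over the ideal of \<open>\<Psi>\<close> and \<open>g\<close> over its square.
\<close>

lemma arc_order:
  fixes \<sigma> :: "'k fps2 \<Rightarrow> 'k fps"
  assumes r: "ring_map \<sigma>" and q1: "q1 \<in> \<Psi>" "\<sigma> q1 \<noteq> 0"
    and N: "\<And>q. q \<in> \<Psi> \<Longrightarrow> fps_X ^ N dvd \<sigma> q"
  shows "fps_X ^ (2 * N) dvd \<sigma> gS" "fps_X ^ N dvd \<sigma> a"
proof -
  let ?P = "\<lambda>n. \<exists>q\<in>\<Psi>. \<sigma> q \<noteq> 0 \<and> subdegree (\<sigma> q) = n"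
  define v where "v = (LEAST n. ?P n)"
  have "\<exists>n. ?P n" using q1 by blast
  then have "?P v" unfolding v_def by (rule LeastI_ex)
  then obtain q0 where q0: "q0 \<in> \<Psi>" "\<sigma> q0 \<noteq> 0" "subdegree (\<sigma> q0) = v" by blast
  have v: "fps_X ^ v dvd \<sigma> q" if "q \<in> \<Psi>" for q
  proof (cases "\<sigma> q = 0")
    case False
    then have "?P (subdegree (\<sigma> q))" using that by blast
    then have "v \<le> subdegree (\<sigma> q)" unfolding v_def by (rule Least_le)
    then show ?thesis by (simp add: fps_dvd_iff False fps_X_power_subdegree)
  qed simp
  have "N \<le> v" using N[OF q0(1)] q0 by (simp add: fps_dvd_iff fps_X_power_subdegree)
  then have Nv: "fps_X ^ N dvd (fps_X ^ v :: 'k fps)" "fps_X ^ (2 * N) dvd (fps_X ^ (2 * v) :: 'k fps)"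
    by (simp_all add: le_imp_power_dvd)
  have a: "fps_X ^ v dvd \<sigma> a"
  proof (cases "\<sigma> a = 0")
    case False
    have "fps_X ^ (2 * v) dvd \<sigma> a * \<sigma> q0"
      using linear[OF r v q0(1)] by (simp add: ring_map_simps[OF r])
    then show ?thesis using False q0 by (simp add: fps_dvd_iff fps_X_power_subdegree)
  qed simp
  then show "fps_X ^ N dvd \<sigma> a" using Nv by (blast intro: dvd_trans)
  have "fps_X ^ (2 * v) dvd (\<sigma> a)\<^sup>2 + \<sigma> gS"
    using square[OF r v] by (simp only: ring_map_simps[OF r])
  moreover have "fps_X ^ (2 * v) dvd (\<sigma> a)\<^sup>2"
    using dvd_power_same[OF a, of 2] by (simp add: mult.commute flip: power_mult)
  ultimately have "fps_X ^ (2 * v) dvd \<sigma> gS" using dvd_add_right_iff by blast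
  then show "fps_X ^ (2 * N) dvd \<sigma> gS" using Nv by (blast intro: dvd_trans)
qed

text \<open>
  If \<open>\<Psi>\<close> vanished along \<open>\<sigma>\<close>, then \<open>g\<close> would become \<open>- a\<^sup>2\<close>, which has even order.
\<close>

lemma odd_arc:
  fixes \<sigma> :: "'k fps2 \<Rightarrow> 'k fps"
  assumes r: "ring_map \<sigma>" and odd: "odd (subdegree (\<sigma> gS))" and N: "2 * N > subdegree (\<sigma> gS)"
  obtains q where "q \<in> \<Psi>" "\<not> fps_X ^ N dvd \<sigma> q"
proof -
  have nz: "\<sigma> gS \<noteq> 0" using odd by (intro notI) simp
  have "\<exists>q\<in>\<Psi>. \<not> fps_X ^ N dvd \<sigma> q"
  proof (rule ccontr)
    assume "\<not> ?thesis"
    then have all: "fps_X ^ N dvd \<sigma> q" if "q \<in> \<Psi>" for q using that by blast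
    show False
    proof (cases "\<exists>q\<in>\<Psi>. \<sigma> q \<noteq> 0")
      case True
      then have "fps_X ^ (2 * N) dvd \<sigma> gS" using arc_order(1)[OF r _ _ all] by blast
      then show False using N nz by (simp add: fps_dvd_iff fps_X_power_subdegree)
    next
      case False
      then have zero: "fps_X ^ v dvd \<sigma> q" if "q \<in> \<Psi>" for q v using that by simp
      have div: "fps_X ^ (2 * v) dvd (\<sigma> a)\<^sup>2 + \<sigma> gS" for v
        using square[OF r zero] by (simp only: ring_map_simps[OF r])
      have "fps_nth ((\<sigma> a)\<^sup>2 + \<sigma> gS) n = 0" for n
        using div[of "Suc n"] unfolding fps_X_power_dvd_iff by simp
      then have "(\<sigma> a)\<^sup>2 + \<sigma> gS = 0" by (intro fps_ext) simp
      then have "\<sigma> gS = - ((\<sigma> a)\<^sup>2)" by (simp add: eq_neg_iff_add_eq_0 add.commute)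
      then have "subdegree (\<sigma> gS) = 2 * subdegree (\<sigma> a)" by (simp add: subdegree_power)
      then show False using odd by simp
    qed
  qed
  then show ?thesis using that by blast
qed

lemma arc_gS: "arc \<sigma> H1 H2 \<Longrightarrow> \<sigma> gS = H1 ^ 3 + H1 * H2 ^ 3"
proof -
  assume "arc \<sigma> H1 H2"
  then have "ring_map \<sigma>" "\<sigma> xS = H1" "\<sigma> yS = H2" by (auto simp: arc_def)
  then show ?thesis by (simp only: ring_map_simps)
qed

lemma all_vanish_imp_a_vanishes:
  assumes "\<And>q. q \<in> \<Psi> \<Longrightarrow> coeff2 q 0 0 = 0"
  shows "coeff2 a 0 0 = 0"
proof -
  obtain \<sigma> :: "'k fps2 \<Rightarrow> 'k fps" where s: "arc \<sigma> fps_X fps_X"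
    using arc_exists[of "fps_X :: 'k fps" fps_X] by auto
  then have r: "ring_map \<sigma>" by (simp add: arc_def)
  have "fps_X ^ 1 dvd \<sigma> q" if "q \<in> \<Psi>" for q
    using assms[OF that] arc_coeff_0[OF s, of q] by (simp add: fps_X_dvd_iff)
  then have "fps_X ^ (2 * 1) dvd \<sigma> (a\<^sup>2 + gS)" by (rule square[OF r])
  then have "fps_nth (\<sigma> (a\<^sup>2 + gS)) 0 = 0" by (simp add: fps_X_power_dvd_iff)
  then have "coeff2 (a\<^sup>2 + gS) 0 0 = 0" by (simp only: arc_coeff_0[OF s])
  then show ?thesis by (simp add: power2_eq_square)
qed

text \<open>
  Along the smooth arc \<open>(t, c * t)\<close> the function \<open>g\<close> has order \<open>3\<close>, so some element of \<open>\<Psi>\<close> has order at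
  most \<open>1\<close>: its linear form does not vanish on the tangent direction \<open>(1, c)\<close>.
\<close>

lemma linear_form_off_direction:
  assumes "\<And>q. q \<in> \<Psi> \<Longrightarrow> coeff2 q 0 0 = 0"
  obtains q where "q \<in> \<Psi>" "coeff2 q 1 0 + coeff2 q 0 1 * c \<noteq> 0"
proof -
  obtain \<sigma> :: "'k fps2 \<Rightarrow> 'k fps" where s: "arc \<sigma> fps_X (fps_const c * fps_X)"
    using arc_exists[of "fps_X :: 'k fps" "fps_const c * fps_X"] by auto
  then have r: "ring_map \<sigma>" by (simp add: arc_def)
  have "\<sigma> gS = fps_X ^ 3 * (1 + fps_const (c ^ 3) * fps_X)"
    unfolding arc_gS[OF s] by (simp add: power_mult_distrib algebra_simps power3_eq_cube flip: fps_const_power)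
  moreover have "subdegree (1 + fps_const (c ^ 3) * fps_X :: 'k fps) = 0" by (simp add: subdegree_eq_0_iff)
  moreover have "(1 + fps_const (c ^ 3) * fps_X :: 'k fps) \<noteq> 0" by (intro fps_nonzeroI[of _ 0]) simp
  ultimately have "subdegree (\<sigma> gS) = 3" by (simp add: fps_X_power_subdegree)
  then obtain q where q: "q \<in> \<Psi>" "\<not> fps_X ^ 2 dvd \<sigma> q" using odd_arc[OF r, of 2] by auto
  have "fps_nth (\<sigma> q) 1 \<noteq> 0"
    using q arc_coeff_0[OF s, of q] assms[OF q(1)] unfolding fps_X_power_dvd_iff
    by (auto simp: less_2_cases_iff)
  then have "coeff2 q 1 0 + coeff2 q 0 1 * c \<noteq> 0" unfolding arc_coeff_1[OF s] by simp
  then show ?thesis using q(1) that by blast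
qed

lemma two_linear_forms:
  assumes "p \<in> J" "q \<in> J" "coeff2 p 0 0 = 0" "coeff2 q 0 0 = 0"
    and det: "coeff2 p 1 0 * coeff2 q 0 1 - coeff2 p 0 1 * coeff2 q 1 0 \<noteq> 0"
  shows "xS \<in> J" "yS \<in> J"
proof -
  obtain A B where p: "p = xS * A + yS * B" "coeff2 A 0 0 = coeff2 p 1 0" "coeff2 B 0 0 = coeff2 p 0 1"
    using fps2_linear_decomp[OF assms(3)] by metis
  obtain C D where q: "q = xS * C + yS * D" "coeff2 C 0 0 = coeff2 q 1 0" "coeff2 D 0 0 = coeff2 q 0 1"
    using fps2_linear_decomp[OF assms(4)] by metis
  have u: "(A * D - B * C) dvd 1" using det p(2,3) q(2,3) by (simp add: fps2_unit_iff)
  have mem: "D * p - B * q \<in> J" "A * q - C * p \<in> J"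
    using assms(1,2) ideal_setD(3,5)[OF J] by blast+
  have "D * p - B * q = xS * (A * D - B * C)"
    unfolding p(1) q(1) by (simp add: algebra_simps)
  then show "xS \<in> J" using ideal_set_cancel_unit[OF J u, of xS] mem by simp
  have "A * q - C * p = yS * (A * D - B * C)"
    unfolding p(1) q(1) by (simp add: algebra_simps)
  then show "yS \<in> J" using ideal_set_cancel_unit[OF J u, of yS] mem by simp
qed

text \<open>
  If some element of \<open>\<Psi>\<close> involves \<open>y\<close> linearly, an arc tangent to the kernel of its linear form gives
  a second, independent linear form, and \<open>J\<close> contains the maximal ideal. Otherwise \<open>J\<close> contains
  \<open>f1 = x - y\<^sup>2 * b\<close>, and modulo \<open>f1\<close> every element of \<open>\<Psi>\<close> is a multiple of \<open>y\<^sup>2\<close>. Along an arc \<open>(H, t)\<close> that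
  agrees with the curve \<open>f1 = 0\<close> up to order \<open>3\<close>, the order of \<open>g = H * (H\<^sup>2 + t\<^sup>3)\<close> is \<open>3\<close> plus that of \<open>H\<close>,
  hence below \<open>8\<close>. So some element of \<open>\<Psi>\<close> has order below \<open>4\<close>, which puts \<open>y\<^sup>2\<close> or \<open>y\<^sup>3\<close> into \<open>J\<close>. The order
  of \<open>a\<close> along the same arc then shows that \<open>a\<close> lies in \<open>J\<close> too.
\<close>

theorem x_y3_a_mem: "xS \<in> J \<and> yS ^ 3 \<in> J \<and> a \<in> J"
proof (cases "\<exists>q\<in>\<Psi>. coeff2 q 0 0 \<noteq> 0")
  case True
  then obtain q where "q \<in> J" "1 * q \<in> J" "q dvd 1" using sub by (auto simp: fps2_unit_iff)
  then have "1 \<in> J" using ideal_set_cancel_unit[OF J] by blast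
  then have "s \<in> J" for s using ideal_setD(3)[OF J, of 1 s] by simp
  then show ?thesis by blast
next
  case False
  then have const0: "coeff2 q 0 0 = 0" if "q \<in> \<Psi>" for q using that by blast
  have a0: "coeff2 a 0 0 = 0" using all_vanish_imp_a_vanishes const0 by blast
  show ?thesis
  proof (cases "\<exists>p\<in>\<Psi>. coeff2 p 0 1 \<noteq> 0")
    case True
    then obtain p where p: "p \<in> \<Psi>" "coeff2 p 0 1 \<noteq> 0" by blast
    define c where "c = - (coeff2 p 1 0 / coeff2 p 0 1)"
    obtain q where q: "q \<in> \<Psi>" "coeff2 q 1 0 + coeff2 q 0 1 * c \<noteq> 0"
      using linear_form_off_direction const0 by metis
    then have "coeff2 p 1 0 * coeff2 q 0 1 - coeff2 p 0 1 * coeff2 q 1 0 \<noteq> 0"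
      using p(2) by (simp add: c_def field_simps)
    then have xy: "xS \<in> J" "yS \<in> J" using two_linear_forms[of p q] p q sub const0 by auto
    obtain A B where "a = xS * A + yS * B" using fps2_linear_decomp[OF a0] by metis
    then have "a \<in> J" using xy by (auto intro: ideal_setD[OF J])
    moreover have "yS ^ 3 \<in> J" using ideal_setD(3)[OF J xy(2), of "yS\<^sup>2"]
      by (simp add: power2_eq_square power3_eq_cube mult.assoc)
    ultimately show ?thesis using xy by blast
  next
    case False
    then have y0: "coeff2 q 0 1 = 0" if "q \<in> \<Psi>" for q using that by blast
    obtain f where f: "f \<in> \<Psi>" "coeff2 f 1 0 + coeff2 f 0 1 * 0 \<noteq> 0"
      using linear_form_off_direction[OF const0] by metis
    obtain U B where fUB: "f = xS * U + yS\<^sup>2 * B" "coeff2 U 0 0 = coeff2 f 1 0"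
      using fps2_tangent_decomp[OF const0[OF f(1)] y0[OF f(1)]] by metis
    have "U dvd 1" using f(2) fUB(2) by (simp add: fps2_unit_iff)
    then obtain V where V: "1 = U * V" by (rule dvdE)
    define b where "b = - (V * B)"
    define f1 where "f1 = xS - yS\<^sup>2 * b"
    have "f * V = xS * (U * V) + yS\<^sup>2 * (V * B)" unfolding fUB(1) by (simp only: distrib_right distrib_left mult_ac)
    then have f1V: "f1 = f * V" by (simp add: f1_def b_def flip: V)
    then have f1J: "f1 \<in> J" using f sub by (auto intro: ideal_setD[OF J])
    have x_eq: "xS = f1 + yS\<^sup>2 * b" by (simp add: f1_def)
    define b0 where "b0 = coeff2 b 0 0"
    obtain p b' where b: "b = kS b0 + xS * p + yS * b'" unfolding b0_def by (rule fps2_maximal_decomp)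
    define b1 where "b1 = coeff2 b' 0 0"
    obtain p' b'' where b': "b' = kS b1 + xS * p' + yS * b''" unfolding b1_def by (rule fps2_maximal_decomp)
    (* The t^4 coefficient of the arc: h nonzero bounds the order of H by 4, and the other
       condition keeps f1 from vanishing to higher order, so that f is nonzero on the arc. *)
    obtain h where h: "h \<noteq> 0" "h \<noteq> b0 * coeff2 p 0 0 + coeff2 b'' 0 0"
    proof -
      have "(- 1 :: 'k) \<noteq> 1" using two by (metis add.right_inverse one_add_one)
      then show ?thesis using that[of 1] that[of "- 1"] by (metis neg_equal_0_iff_equal zero_neq_one)
    qed
    define H' :: "'k fps" where "H' = fps_const b0 + fps_const b1 * fps_X + fps_const h * fps_X\<^sup>2"
    have H'_coeffs: "fps_nth H' 0 = b0" "fps_nth H' 2 = h"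
      by (simp_all add: H'_def)
    have H'nz: "H' \<noteq> 0" using H'_coeffs h by (intro fps_nonzeroI[of _ 2]) simp
    have sdH': "subdegree H' \<le> 2" using H'_coeffs h by (intro subdegree_leI) simp
    obtain \<sigma> :: "'k fps2 \<Rightarrow> 'k fps" where s: "arc \<sigma> (fps_X\<^sup>2 * H') fps_X"
      using arc_exists[of "fps_X\<^sup>2 * H'" fps_X] by auto
    then have r: "ring_map \<sigma>" and sx: "\<sigma> xS = fps_X\<^sup>2 * H'" and sy: "\<sigma> yS = fps_X"
      and sk: "\<And>c. \<sigma> (kS c) = fps_const c" by (auto simp: arc_def)
    note sr = ring_map_simps[OF r]
    have H1_1: "fps_nth (fps_X\<^sup>2 * H') 1 = 0" by (simp add: fps_X_power_mult_nth)
    define e where "e = fps_const h - H' * \<sigma> p - fps_X * H' * \<sigma> p' - \<sigma> b''"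
    have sf1: "\<sigma> f1 = fps_X ^ 4 * e"
    proof -
      have "\<sigma> f1 = fps_X\<^sup>2 * H' - fps_X\<^sup>2 * (fps_const b0 + fps_X\<^sup>2 * H' * \<sigma> p
          + fps_X * (fps_const b1 + fps_X\<^sup>2 * H' * \<sigma> p' + fps_X * \<sigma> b''))"
        unfolding f1_def b b' by (simp only: sr sx sy sk)
      also have "\<dots> = fps_X ^ 4 * e"
        unfolding e_def by (subst (1) H'_def) (simp add: algebra_simps power2_eq_square power4_eq_xxxx)
      finally show ?thesis .
    qed
    have "fps_nth e 0 = h - b0 * coeff2 p 0 0 - coeff2 b'' 0 0"
      by (simp add: e_def H'_coeffs arc_coeff_0[OF s])
    then have "fps_nth e 0 \<noteq> 0" using h(2) by (simp add: diff_diff_eq)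
    then have "e \<noteq> 0" by (rule fps_nonzeroI)
    then have "\<sigma> f1 \<noteq> 0" by (simp add: sf1)
    then have sf: "\<sigma> f \<noteq> 0" unfolding f1V by (simp add: sr)
    have sg: "\<sigma> gS = fps_X ^ 5 * (H' * (1 + fps_X * H'\<^sup>2))"
      unfolding arc_gS[OF s] by (simp add: algebra_simps power2_eq_square power3_eq_cube eval_nat_numeral)
    have "subdegree (1 + fps_X * H'\<^sup>2) = 0" "1 + fps_X * H'\<^sup>2 \<noteq> 0"
      by (simp add: subdegree_eq_0_iff) (intro fps_nonzeroI[of _ 0], simp)
    then have sdg: "\<sigma> gS \<noteq> 0" "subdegree (\<sigma> gS) = 5 + subdegree H'"
      using H'nz unfolding sg by (simp_all add: fps_X_power_subdegree)
    (* Substituting x = f1 + y^2 b writes q as y^2 s plus a multiple of f1, and f1 has order at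
       least 4 on the arc. *)
    have reduce: "\<exists>s. yS\<^sup>2 * s \<in> J \<and> (\<forall>k\<le>2. fps_X ^ k dvd \<sigma> s \<longrightarrow> fps_X ^ (k + 2) dvd \<sigma> q)"
      if q: "q \<in> \<Psi>" for q
    proof -
      obtain A C where qAC: "q = xS * A + yS\<^sup>2 * C"
        using fps2_tangent_decomp[OF const0[OF q] y0[OF q]] by metis
      have q_eq: "q = yS\<^sup>2 * (C + A * b) + A * f1" by (simp add: qAC f1_def algebra_simps)
      then have "yS\<^sup>2 * (C + A * b) = q - A * f1" by simp
      then have "yS\<^sup>2 * (C + A * b) \<in> J" using q sub f1J by (auto intro: ideal_setD[OF J])
      moreover have "fps_X ^ (k + 2) dvd \<sigma> q" if "k \<le> 2" "fps_X ^ k dvd \<sigma> (C + A * b)" for k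
      proof -
        have "\<sigma> q = fps_X\<^sup>2 * \<sigma> (C + A * b) + \<sigma> A * \<sigma> f1"
          by (subst q_eq) (simp only: sr sy)
        moreover have "fps_X ^ (k + 2) dvd fps_X\<^sup>2 * \<sigma> (C + A * b)"
          using mult_dvd_mono[OF dvd_refl[of "fps_X\<^sup>2"] that(2)]
          by (simp only: power_add mult.commute[of "fps_X\<^sup>2" "fps_X ^ k"])
        moreover have "fps_X ^ (k + 2) dvd \<sigma> f1"
          unfolding sf1 using that(1) by (intro dvd_mult2 le_imp_power_dvd) simp
        ultimately show ?thesis by simp
      qed
      ultimately show ?thesis by blast
    qed
    have x_if_y2: "xS \<in> J" if "yS\<^sup>2 \<in> J"
      using x_eq f1J that by (metis ideal_setD(2,4)[OF J])
    have y3_if_y2: "yS ^ 3 \<in> J" if "yS\<^sup>2 \<in> J"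
      using ideal_setD(4)[OF J that, of yS] by (simp add: power2_eq_square power3_eq_cube)
    have y2_if_unit: "yS\<^sup>2 \<in> J" if "yS\<^sup>2 * s \<in> J" "coeff2 s 0 0 \<noteq> 0" for s
      using ideal_set_cancel_unit[OF J _ that(1)] that(2) by (simp add: fps2_unit_iff)
    have dvd1: "fps_X ^ 1 dvd \<sigma> s \<longleftrightarrow> coeff2 s 0 0 = 0" for s
      by (simp add: fps_X_dvd_iff arc_coeff_0[OF s])
    show ?thesis
    proof (cases "yS\<^sup>2 \<in> J")
      case True
      have "fps_X ^ (0 + 2) dvd \<sigma> q" if q: "q \<in> \<Psi>" for q
        using reduce[OF q] by (metis dvd_triv_left le0 mult_1 power_0)
      then have "fps_X ^ (0 + 2) dvd \<sigma> a" by (rule arc_order(2)[OF r f(1) sf])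
      then have "fps_X ^ 2 dvd \<sigma> a" by (simp only: add_0)
      then have "fps_nth (\<sigma> a) 1 = 0" by (simp add: fps_X_power_dvd_iff)
      then have "coeff2 a 0 1 = 0" unfolding arc_coeff_1[OF s] H1_1 by simp
      then obtain A C where "a = xS * A + yS\<^sup>2 * C" using fps2_tangent_decomp[OF a0] by metis
      then have "a \<in> J" using True x_if_y2 by (auto intro: ideal_setD[OF J])
      then show ?thesis using True x_if_y2 y3_if_y2 by blast
    next
      case False
      have ord3: "fps_X ^ 3 dvd \<sigma> q" if q: "q \<in> \<Psi>" for q
      proof -
        obtain s where s: "yS\<^sup>2 * s \<in> J" "\<forall>k\<le>2. fps_X ^ k dvd \<sigma> s \<longrightarrow> fps_X ^ (k + 2) dvd \<sigma> q"
          using reduce[OF q] by blast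
        have "fps_X ^ 1 dvd \<sigma> s" unfolding dvd1 using y2_if_unit[OF s(1)] False by blast
        with s(2) have "fps_X ^ (1 + 2) dvd \<sigma> q" by (metis one_le_numeral)
        moreover have "1 + 2 = (3 :: nat)" by simp
        ultimately show ?thesis by (simp only:)
      qed
      have "fps_X ^ (2 * 3) dvd \<sigma> gS" using arc_order(1)[OF r f(1) sf ord3] .
      then have "subdegree H' \<noteq> 0" using sdg by (simp add: fps_dvd_iff fps_X_power_subdegree)
      then have b00: "b0 = 0" using H'_coeffs H'nz by (metis subdegree_eq_0)
      have "\<not> (\<forall>q\<in>\<Psi>. fps_X ^ 4 dvd \<sigma> q)"
      proof
        assume "\<forall>q\<in>\<Psi>. fps_X ^ 4 dvd \<sigma> q"
        then have "fps_X ^ (2 * 4) dvd \<sigma> gS" using arc_order(1)[OF r f(1) sf] by blast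
        then show False using sdg sdH' by (simp add: fps_dvd_iff fps_X_power_subdegree)
      qed
      then obtain q where q: "q \<in> \<Psi>" "\<not> fps_X ^ 4 dvd \<sigma> q" by blast
      obtain w where w: "yS\<^sup>2 * w \<in> J" "\<forall>k\<le>2. fps_X ^ k dvd \<sigma> w \<longrightarrow> fps_X ^ (k + 2) dvd \<sigma> q"
        using reduce[OF q(1)] by blast
      have w0: "coeff2 w 0 0 = 0" using y2_if_unit[OF w(1)] False by blast
      have "\<not> fps_X ^ 2 dvd \<sigma> w" using w(2)[rule_format, of 2] q(2) by auto
      then have "fps_nth (\<sigma> w) 1 \<noteq> 0"
        using w0 arc_coeff_0[OF s, of w] unfolding fps_X_power_dvd_iff by (auto simp: less_2_cases_iff)
      then have w1: "coeff2 w 0 1 \<noteq> 0" unfolding arc_coeff_1[OF s] H1_1 by simp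
      obtain D E where wDE: "w = xS * D + yS * E" "coeff2 E 0 0 = coeff2 w 0 1"
        using fps2_linear_decomp[OF w0] by metis
      have "yS ^ 3 * (E + yS * b * D) = yS\<^sup>2 * w - yS\<^sup>2 * D * f1"
        by (simp add: wDE(1) f1_def algebra_simps power2_eq_square power3_eq_cube)
      also have "\<dots> \<in> J" using w(1) f1J by (auto intro: ideal_setD[OF J])
      finally have "yS ^ 3 * (E + yS * b * D) \<in> J" .
      moreover have "(E + yS * b * D) dvd 1" using w1 wDE(2) by (simp add: fps2_unit_iff)
      ultimately have y3: "yS ^ 3 \<in> J" using ideal_set_cancel_unit[OF J] by blast
      have "xS * (1 - yS\<^sup>2 * p) = f1 + yS ^ 3 * b'"
        by (simp add: f1_def b b00 algebra_simps power2_eq_square power3_eq_cube)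
      also have "\<dots> \<in> J" using y3 f1J by (auto intro: ideal_setD[OF J])
      finally have "xS * (1 - yS\<^sup>2 * p) \<in> J" .
      moreover have "(1 - yS\<^sup>2 * p) dvd 1" by (simp add: fps2_unit_iff power2_eq_square)
      ultimately have x: "xS \<in> J" using ideal_set_cancel_unit[OF J] by blast
      have a3: "fps_X ^ 3 dvd \<sigma> a" using arc_order(2)[OF r f(1) sf ord3] .
      then have "fps_nth (\<sigma> a) 1 = 0" by (simp add: fps_X_power_dvd_iff)
      then have "coeff2 a 0 1 = 0" unfolding arc_coeff_1[OF s] H1_1 by simp
      then obtain A C where aAC: "a = xS * A + yS\<^sup>2 * C" using fps2_tangent_decomp[OF a0] by metis
      have "\<sigma> a = fps_X\<^sup>2 * (H' * \<sigma> A + \<sigma> C)"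
        unfolding aAC by (simp only: sr sx sy) (simp add: algebra_simps)
      then have "fps_nth (\<sigma> a) 2 = fps_nth (H' * \<sigma> A + \<sigma> C) 0" by (simp add: fps_X_power_mult_nth)
      also have "\<dots> = coeff2 C 0 0" using H'_coeffs b00 by (simp add: arc_coeff_0[OF s])
      finally have "coeff2 C 0 0 = 0" using a3 by (simp add: fps_X_power_dvd_iff)
      then obtain C1 C2 where "C = xS * C1 + yS * C2" using fps2_linear_decomp by metis
      then have "a = xS * (A + yS\<^sup>2 * C1) + yS ^ 3 * C2"
        by (simp add: aAC algebra_simps power2_eq_square power3_eq_cube)
      then have "a \<in> J" using x y3 by (auto intro: ideal_setD[OF J])
      then show ?thesis using x y3 by blast
    qed
  qed
qed

end

text \<open>
  The condition on \<open>T\<close> says that it contains the entries of \<open>\<phi> + z\<close>. Differences of those entries put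
  all entries of \<open>\<phi> - a\<close> into \<open>J = T \<inter> k\<lbrakk>x, y\<rbrakk>\<close>. Expanding \<open>\<phi>\<^sup>2 = - g\<close> around \<open>a\<close> gives
  \<open>(\<phi> - a)\<^sup>2 = - (a\<^sup>2 + g) - 2 * a * (\<phi> - a)\<close>; the entry in position \<open>(o', o')\<close>, where \<open>\<phi> - a\<close> vanishes, isolates
  \<open>a\<^sup>2 + g\<close>, and the others give \<open>a * (\<phi> - a)\<close> after division by \<open>2\<close>. Finally \<open>z\<close> is congruent to \<open>- a\<close>
  modulo \<open>T\<close>.
\<close>

theorem matrix_factorization_trace:
  fixes \<phi> :: "'i \<Rightarrow> 'i \<Rightarrow> 'k::field fps2" and T :: "'k e7 set"
  assumes two: "(2 :: 'k) \<noteq> 0" and E: "finite E" "E \<noteq> {}"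
    and sq: "\<And>i j. i \<in> E \<Longrightarrow> j \<in> E \<Longrightarrow> (\<Sum>l\<in>E. \<phi> i l * \<phi> l j) = (if i = j then - gS else 0)"
    and T: "ideal_set T"
    and mem: "\<And>i j. i \<in> E \<Longrightarrow> j \<in> E \<Longrightarrow> E7 (\<phi> i j) (if i = j then 1 else 0) \<in> T"
  shows "cS xS \<in> T" "cS (yS ^ 3) \<in> T" "zR \<in> T"
proof -
  obtain o' where o: "o' \<in> E" using E by blast
  define a where "a = \<phi> o' o'"
  define \<psi> where "\<psi> i j = \<phi> i j - (if i = j then a else 0)" for i j
  define J where "J = {s. cS s \<in> T}"
  define \<Psi> where "\<Psi> = {\<psi> i j | i j. i \<in> E \<and> j \<in> E}"
  have J: "ideal_set J"
    using T by (auto simp: ideal_set_def J_def cS_simps)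
  have sub: "\<Psi> \<subseteq> J"
  proof -
    have "cS (\<psi> i j) \<in> T" if "i \<in> E" "j \<in> E" for i j
    proof (cases "i = j")
      case True
      then have "cS (\<psi> i j) = E7 (\<phi> i i) 1 - E7 a 1" by (simp add: \<psi>_def e7_defs)
      then show ?thesis using ideal_setD(5)[OF T mem[of i i] mem[of o' o']] that o True by (simp add: a_def)
    next
      case False
      then show ?thesis using mem[OF that] by (simp add: \<psi>_def)
    qed
    then show ?thesis by (auto simp: \<Psi>_def J_def)
  qed
  have prod: "(\<Sum>l\<in>E. \<psi> i l * \<psi> l j) = (if i = j then - gS - a\<^sup>2 else 0) - 2 * a * \<psi> i j"
    if "i \<in> E" "j \<in> E" for i j
  proof -
    have "(\<Sum>l\<in>E. \<psi> i l * \<psi> l j) = (\<Sum>l\<in>E. \<phi> i l * \<phi> l j - (if l = j then \<phi> i l * a else 0)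
        - (if l = i then a * \<phi> l j else 0) + (if l = i then (if i = j then a * a else 0) else 0))"
      by (intro sum.cong refl) (auto simp: \<psi>_def algebra_simps)
    also have "\<dots> = (if i = j then - gS else 0) - \<phi> i j * a - a * \<phi> i j + (if i = j then a * a else 0)"
      using that E(1) sq[OF that] by (simp add: sum.distrib sum_subtractf sum.delta)
    also have "\<dots> = (if i = j then - gS - a\<^sup>2 else 0) - 2 * a * \<psi> i j"
      by (auto simp: \<psi>_def algebra_simps power2_eq_square)
    finally show ?thesis .
  qed
  have two_unit: "\<exists>w. w * (2 :: 'k fps2) = 1"
  proof -
    have "(2 :: 'k fps2) dvd 1" using two by (simp add: fps2_unit_iff)
    then show ?thesis by (metis dvdE mult.commute)
  qed
  then obtain half :: "'k fps2" where half: "half * 2 = 1" by blast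
  have dvd_prod: "fps_X ^ (2 * v) dvd \<sigma> (\<Sum>l\<in>E. \<psi> i l * \<psi> l j)"
    if r: "ring_map \<sigma>" and v: "\<And>q. q \<in> \<Psi> \<Longrightarrow> fps_X ^ v dvd \<sigma> q" and ij: "i \<in> E" "j \<in> E"
    for \<sigma> :: "'k fps2 \<Rightarrow> 'k fps" and v i j
  proof -
    have "\<sigma> (\<Sum>l\<in>E'. \<psi> i l * \<psi> l j) = (\<Sum>l\<in>E'. \<sigma> (\<psi> i l) * \<sigma> (\<psi> l j))" for E'
      by (induction E' rule: infinite_finite_induct) (simp_all add: ring_map_simps[OF r])
    moreover have "fps_X ^ (2 * v) dvd \<sigma> (\<psi> i l) * \<sigma> (\<psi> l j)" if "l \<in> E" for l
      using mult_dvd_mono[OF v[of "\<psi> i l"] v[of "\<psi> l j"]] ij that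
      by (auto simp: \<Psi>_def mult_2 power_add)
    ultimately show ?thesis by (simp add: dvd_sum)
  qed
  interpret reduced_z J \<Psi> a
  proof
    show "ideal_set J" "\<Psi> \<subseteq> J" "(2 :: 'k) \<noteq> 0" by fact+
    fix \<sigma> :: "'k fps2 \<Rightarrow> 'k fps" and v
    assume r: "ring_map \<sigma>" and v: "\<And>q. q \<in> \<Psi> \<Longrightarrow> fps_X ^ v dvd \<sigma> q"
    have psi_oo: "\<psi> o' o' = 0" by (simp add: \<psi>_def a_def)
    have "a\<^sup>2 + gS = - (\<Sum>l\<in>E. \<psi> o' l * \<psi> l o')"
      using prod[OF o o] by (simp add: psi_oo)
    then show sq': "fps_X ^ (2 * v) dvd \<sigma> (a\<^sup>2 + gS)"
      using dvd_prod[OF r v o o] by (simp only: ring_map_simps[OF r] dvd_minus_iff)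
    fix q assume "q \<in> \<Psi>"
    then obtain i j where ij: "i \<in> E" "j \<in> E" "q = \<psi> i j" by (auto simp: \<Psi>_def)
    have c: "(if i = j then - gS - a\<^sup>2 else 0) = (if i = j then - (a\<^sup>2 + gS) else 0)"
      by (simp only: minus_add_distrib minus_add add.commute diff_conv_add_uminus)
    have "(if i = j then - (a\<^sup>2 + gS) else 0) - (\<Sum>l\<in>E. \<psi> i l * \<psi> l j) = 2 * a * \<psi> i j"
      unfolding prod[OF ij(1,2)] c by (simp only: diff_diff_eq2 add_diff_cancel_left')
    moreover have "a * q = (half * 2) * (a * q)" by (simp only: half mult_1)
    ultimately have "a * q = half * ((if i = j then - (a\<^sup>2 + gS) else 0) - (\<Sum>l\<in>E. \<psi> i l * \<psi> l j))"
      by (simp only: ij(3) mult.assoc)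
    then have "\<sigma> (a * q) = \<sigma> (half * ((if i = j then - (a\<^sup>2 + gS) else 0) - (\<Sum>l\<in>E. \<psi> i l * \<psi> l j)))"
      by (rule arg_cong)
    also have "\<dots> = \<sigma> half * ((if i = j then - \<sigma> (a\<^sup>2 + gS) else 0) - \<sigma> (\<Sum>l\<in>E. \<psi> i l * \<psi> l j))"
      by (simp only: if_distrib[of \<sigma>] ring_map_simps(3-6)[OF r])
    finally have "\<sigma> (a * q) = \<sigma> half * ((if i = j then - \<sigma> (a\<^sup>2 + gS) else 0) - \<sigma> (\<Sum>l\<in>E. \<psi> i l * \<psi> l j))" .
    then show "fps_X ^ (2 * v) dvd \<sigma> (a * q)"
      using sq' dvd_prod[OF r v ij(1,2)] by (auto intro!: dvd_mult)
  qed
  have *: "xS \<in> J" "yS ^ 3 \<in> J" "a \<in> J" using x_y3_a_mem by auto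
  then show "cS xS \<in> T" "cS (yS ^ 3) \<in> T" by (simp_all add: J_def)
  have "zR = E7 (\<phi> o' o') 1 - cS a" by (simp add: a_def e7_defs)
  then show "zR \<in> T" using ideal_setD(5)[OF T mem[OF o o]] *(3) by (simp add: J_def)
qed

section \<open>Prime ideals of the surface ring\<close>

definition prime_set :: "'a::comm_ring_1 set \<Rightarrow> bool" where
  "prime_set P \<longleftrightarrow> ideal_set P \<and> 1 \<notin> P \<and> (\<forall>a b. a * b \<in> P \<longrightarrow> a \<in> P \<or> b \<in> P)"

lemma prime_setD:
  assumes "prime_set P"
  shows "ideal_set P" "1 \<notin> P" "a * b \<in> P \<Longrightarrow> a \<in> P \<or> b \<in> P"
  using assms by (auto simp: prime_set_def)

lemma prime_set_power:
  assumes "prime_set P" "a ^ n \<in> P"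
  shows "a \<in> P"
  using assms(2)
proof (induction n)
  case 0
  then show ?case using prime_setD(2)[OF assms(1)] by simp
next
  case (Suc n)
  then show ?case using prime_setD(3)[OF assms(1), of a "a ^ n"] by auto
qed

lemma prime_set_unit: "prime_set P \<Longrightarrow> u dvd 1 \<Longrightarrow> u \<notin> P"
  using ideal_set_cancel_unit[of P u 1] by (auto simp: prime_set_def)

lemma prime_set_kernel:
  fixes h :: "'a::comm_ring_1 \<Rightarrow> 'b::idom"
  assumes "ring_map h"
  shows "prime_set {u. h u = 0}"
  using ring_map_simps[OF assms] by (auto simp: prime_set_def ideal_set_def)

lemma prime_set_vimage:
  assumes "prime_set P" "ring_map h"
  shows "prime_set {s. h s \<in> P}"
  using assms ring_map_simps[OF assms(2)] by (auto simp: prime_set_def ideal_set_def)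

text \<open>Gaussian elimination without division: \<open>o'\<close> is the pivot row.\<close>

lemma linear_dependence:
  fixes v :: "'i \<Rightarrow> nat \<Rightarrow> 'a::idom"
  assumes "finite I" "card I > d"
  shows "\<exists>b. (\<exists>i\<in>I. b i \<noteq> 0) \<and> (\<forall>j<d. (\<Sum>i\<in>I. b i * v i j) = 0)"
  using assms
proof (induction d arbitrary: I v)
  case 0
  then obtain i where "i \<in> I" by (metis card.empty ex_in_conv less_irrefl)
  then show ?case by (intro exI[of _ "\<lambda>_. 1"]) auto
next
  case (Suc d)
  show ?case
  proof (cases "\<forall>i\<in>I. v i d = 0")
    case True
    obtain b where b: "\<exists>i\<in>I. b i \<noteq> 0" "\<forall>j<d. (\<Sum>i\<in>I. b i * v i j) = 0"
      using Suc.IH[of I v] Suc.prems by auto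
    have "(\<Sum>i\<in>I. b i * v i d) = 0" using True by simp
    then show ?thesis using b by (intro exI[of _ b]) (auto simp: less_Suc_eq)
  next
    case False
    then obtain o' where o: "o' \<in> I" "v o' d \<noteq> 0" by blast
    define c where "c = v o' d"
    define w where "w i j = c * v i j - v i d * v o' j" for i j
    have fin: "finite (I - {o'})" using Suc.prems by simp
    moreover have "card (I - {o'}) > d" using Suc.prems o by simp
    ultimately obtain b where b: "\<exists>i\<in>I - {o'}. b i \<noteq> 0" "\<forall>j<d. (\<Sum>i\<in>I - {o'}. b i * w i j) = 0"
      using Suc.IH[of "I - {o'}" w] by blast
    define b' where "b' i = (if i = o' then - (\<Sum>i\<in>I - {o'}. b i * v i d) else c * b i)" for i
    have split: "(\<Sum>i\<in>I. b' i * v i j) = (\<Sum>i\<in>I - {o'}. b i * w i j)" for j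
    proof -
      have "(\<Sum>i\<in>I. b' i * v i j) = b' o' * v o' j + (\<Sum>i\<in>I - {o'}. b' i * v i j)"
        using Suc.prems o by (simp add: sum.remove)
      also have "(\<Sum>i\<in>I - {o'}. b' i * v i j) = (\<Sum>i\<in>I - {o'}. b i * w i j + (b i * v i d) * v o' j)"
        by (intro sum.cong refl) (auto simp: b'_def w_def algebra_simps)
      also have "\<dots> = (\<Sum>i\<in>I - {o'}. b i * w i j) + (\<Sum>i\<in>I - {o'}. b i * v i d) * v o' j"
        by (simp add: sum.distrib sum_distrib_right)
      finally show ?thesis by (simp add: b'_def)
    qed
    have "(\<Sum>i\<in>I - {o'}. b i * w i d) = 0" by (simp add: w_def c_def mult.commute)
    then have "(\<Sum>i\<in>I. b' i * v i j) = 0" if "j < Suc d" for j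
      unfolding split using b(2) that by (auto simp: less_Suc_eq)
    moreover have "\<exists>i\<in>I. b' i \<noteq> 0" using b(1) o(2) by (auto simp: b'_def c_def)
    ultimately show ?thesis by blast
  qed
qed

lemma xS_adic_factor:
  fixes f :: "'k::field fps2"
  assumes "f \<noteq> 0"
  obtains e f' where "f = xS ^ e * f'" "\<not> xS dvd f'"
proof -
  have ex: "\<exists>n. \<not> xS ^ n dvd f"
    using adic_complete_xS assms unfolding adic_complete_def by blast
  define n where "n = (LEAST n. \<not> xS ^ n dvd f)"
  have n: "\<not> xS ^ n dvd f" unfolding n_def using ex by (rule LeastI_ex)
  then obtain e where e: "n = Suc e" by (cases n) auto
  have "xS ^ e dvd f" using not_less_Least[of e "\<lambda>n. \<not> xS ^ n dvd f"] e by (simp add: n_def)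
  then obtain f' where f': "f = xS ^ e * f'" by (rule dvdE)
  have "\<not> xS dvd f'"
  proof
    assume "xS dvd f'"
    then have "xS ^ e * xS dvd f" unfolding f' by (intro mult_dvd_mono dvd_refl)
    then show False using n unfolding e power_Suc2 by (rule notE[rotated])
  qed
  then show ?thesis using that f' by blast
qed

text \<open>
  The plane has dimension two. If \<open>x\<close> is not in \<open>P\<close>, remove powers of \<open>x\<close> from \<open>f\<close> to make it
  distinguished of some degree \<open>d\<close> in \<open>y\<close>. Modulo \<open>f'\<close> the \<open>d + 1\<close> powers \<open>1, g, \<dots>, g ^ d\<close> have
  remainders of degree below \<open>d\<close>, so they are linearly dependent over \<open>k\<lbrakk>x\<rbrakk>\<close>. Cancelling the lowest
  power of \<open>g\<close> from the relation, which is possible modulo \<open>P\<close>, puts a nonzero element of \<open>k\<lbrakk>x\<rbrakk>\<close>, and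
  so \<open>x\<close> itself, into \<open>Q\<close>.
\<close>

lemma fps2_prime_chain:
  fixes P Q :: "'k::field fps2 set"
  assumes P: "prime_set P" and Q: "prime_set Q" and sub: "P \<subseteq> Q"
    and f: "f \<in> P" "f \<noteq> 0" and g: "g \<in> Q" "g \<notin> P"
  shows "xS \<in> Q \<and> yS \<in> Q"
proof -
  note PI = prime_setD(1)[OF P] and QI = prime_setD(1)[OF Q]
  have y_mem: "yS \<in> Q" if x: "xS \<in> Q" and s: "s \<in> Q" "\<not> xS dvd s" for s
  proof -
    obtain s' N v where s': "s = xS * s' + yS ^ N * v" "v dvd 1"
      using fps2_mod_xS[OF s(2)] by metis
    have "s - xS * s' \<in> Q" using x s(1) by (auto intro: ideal_setD[OF QI])
    then have "yS ^ N * v \<in> Q" using s'(1) by simp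
    then show ?thesis using prime_setD(3)[OF Q] prime_set_unit[OF Q s'(2)] prime_set_power[OF Q] by blast
  qed
  show ?thesis
  proof (cases "xS \<in> P")
    case True
    moreover have "\<not> xS dvd g" using g(2) True ideal_setD(4)[OF PI] by (auto elim!: dvdE)
    ultimately show ?thesis using y_mem[of g] g(1) sub by blast
  next
    case False
    obtain e f' where f': "f = xS ^ e * f'" "\<not> xS dvd f'" using xS_adic_factor[OF f(2)] .
    have f'P: "f' \<in> P" using f(1) f'(1) False prime_setD(3)[OF P] prime_set_power[OF P] by metis
    obtain d where d: "\<And>j. j < d \<Longrightarrow> fps_nth (fps_nth f' j) 0 = 0" "fps_nth (fps_nth f' d) 0 \<noteq> 0"
      using fps2_mod_xS[OF f'(2)] by metis
    have "\<exists>q r. g ^ i = q * f' + r \<and> fps_shift d r = 0" for i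
    proof -
      have low: "fps_X dvd fps_nth f' j" if "j < d" for j using d(1)[OF that] by (simp add: fps_X_dvd_iff)
      have un: "fps_nth f' d dvd 1" using d(2) by simp
      obtain q r where "g ^ i = q * f' + r" "fps_shift d r = 0"
        by (rule distinguished_division[where p = "g ^ i", OF adic_complete_fps_X low un])
      then show ?thesis by (intro exI conjI)
    qed
    then obtain q r where qr: "\<And>i. g ^ i = q i * f' + r i" "\<And>i. fps_shift d (r i) = 0" by metis
    have r_high: "fps_nth (r i) j = 0" if "j \<ge> d" for i j
    proof -
      have "fps_nth (fps_shift d (r i)) (j - d) = 0" by (simp only: qr(2) fps_zero_nth)
      then show ?thesis using that by simp
    qed
    obtain b where b: "\<exists>i\<in>{..d}. b i \<noteq> 0" "\<forall>j<d. (\<Sum>i\<in>{..d}. b i * fps_nth (r i) j) = 0"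
      using linear_dependence[of "{..d}" d "\<lambda>i j. fps_nth (r i) j"] by auto
    have "(\<Sum>i\<le>d. fps_const (b i) * r i) = 0"
    proof (rule fps_ext)
      fix j
      show "fps_nth (\<Sum>i\<le>d. fps_const (b i) * r i) j = fps_nth 0 j"
        using b(2) r_high by (cases "j < d") (simp_all add: fps_sum_nth)
    qed
    then have rel: "(\<Sum>i\<le>d. fps_const (b i) * g ^ i) = (\<Sum>i\<le>d. fps_const (b i) * q i) * f'"
      by (simp add: qr(1) distrib_left sum.distrib sum_distrib_right mult.assoc)
    define m where "m = (LEAST i. b i \<noteq> 0)"
    have "\<exists>i. b i \<noteq> 0" using b(1) by blast
    then have bm: "b m \<noteq> 0" unfolding m_def by (rule LeastI_ex)
    obtain i where "i \<le> d" "b i \<noteq> 0" using b(1) by blast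
    then have md: "m \<le> d" unfolding m_def using Least_le[of "\<lambda>i. b i \<noteq> 0" i] by simp
    have small: "b i = 0" if "i < m" for i using not_less_Least[OF that[unfolded m_def]] by simp
    have "(\<Sum>i\<le>d. fps_const (b i) * g ^ i) = (\<Sum>i\<in>{m..d}. fps_const (b i) * g ^ i)"
      by (intro sum.mono_neutral_right) (auto simp: small)
    also have "\<dots> = fps_const (b m) * g ^ m + (\<Sum>i\<in>{Suc m..d}. fps_const (b i) * g ^ i)"
      using md by (simp add: sum.atLeast_Suc_atMost)
    finally have low: "(\<Sum>i\<le>d. fps_const (b i) * g ^ i) = \<dots>" .
    have "g ^ Suc m dvd (\<Sum>i\<in>{Suc m..d}. fps_const (b i) * g ^ i)"
      by (intro dvd_sum dvd_mult le_imp_power_dvd) auto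
    then obtain w where "(\<Sum>i\<in>{Suc m..d}. fps_const (b i) * g ^ i) = g ^ Suc m * w" by (rule dvdE)
    with low have "(\<Sum>i\<le>d. fps_const (b i) * g ^ i) = g ^ m * (fps_const (b m) + g * w)"
      by (simp add: algebra_simps)
    with rel have "g ^ m * (fps_const (b m) + g * w) = (\<Sum>i\<le>d. fps_const (b i) * q i) * f'" by simp
    then have "g ^ m * (fps_const (b m) + g * w) \<in> P" using ideal_setD(3)[OF PI f'P] by simp
    then have "fps_const (b m) + g * w \<in> Q"
      using prime_setD(3)[OF P] prime_set_power[OF P] g(2) sub by blast
    then have "fps_const (b m) + g * w - g * w \<in> Q"
      using g(1) by (intro ideal_setD(5)[OF QI] ideal_setD(4)[OF QI])
    then have bQ: "fps_const (b m) \<in> Q" by simp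
    have "b m = fps_X ^ subdegree (b m) * unit_factor (b m)" by (rule fps_unit_factor_decompose')
    then have "fps_const (b m) = xS ^ subdegree (b m) * fps_const (unit_factor (b m))"
      by (metis fps_const_mult fps_const_power)
    moreover have "fps_const (unit_factor (b m)) dvd 1"
      using bm by (simp add: fps2_unit_iff)
    ultimately have "xS \<in> Q"
      using bQ prime_setD(3)[OF Q] prime_set_unit[OF Q] prime_set_power[OF Q] by metis
    then show ?thesis using y_mem[of f'] f'P f'(2) sub by blast
  qed
qed

text \<open>
  An element \<open>u\<close> of \<open>Q\<close> outside \<open>P\<close> satisfies \<open>u\<^sup>2 - tr u * u + norm u = 0\<close>. Either its norm lies outside
  \<open>P\<close>, or its conjugate lies in \<open>P\<close> and then its trace lies outside.
\<close>

lemma e7_incomparability: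
  fixes P Q :: "'k::field e7 set"
  assumes P: "prime_set P" and Q: "prime_set Q" and sub: "P \<subset> Q"
  obtains s where "cS s \<in> Q" "cS s \<notin> P"
proof -
  note PI = prime_setD(1)[OF P] and QI = prime_setD(1)[OF Q]
  obtain u where u: "u \<in> Q" "u \<notin> P" using sub by blast
  show ?thesis
  proof (cases "cS (e7_norm u) \<in> P")
    case False
    moreover have "cS (e7_norm u) \<in> Q" using ideal_setD(4)[OF QI u(1)] by (simp flip: mult_e7_conj)
    ultimately show ?thesis using that by blast
  next
    case True
    then have c: "e7_conj u \<in> P" using prime_setD(3)[OF P] u(2) by (simp flip: mult_e7_conj) blast
    then have "u + e7_conj u \<in> Q" using u(1) sub ideal_setD(2)[OF QI] by blast
    moreover have "u + e7_conj u \<notin> P"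
      using ideal_setD(5)[OF PI _ c, of "u + e7_conj u"] u(2) by auto
    ultimately show ?thesis using that by (simp add: add_e7_conj)
  qed
qed

lemma e7_no_prime_chain:
  fixes P0 P1 P2 P3 :: "'k::field e7 set"
  assumes "prime_set P0" "prime_set P1" "prime_set P2" "prime_set P3"
    and "P0 \<subset> P1" "P1 \<subset> P2" "P2 \<subset> P3"
  shows False
proof -
  note I2 = prime_setD(1)[OF assms(3)]
  obtain f where f: "cS f \<in> P1" "cS f \<notin> P0" using e7_incomparability[OF assms(1,2,5)] .
  obtain g where g: "cS g \<in> P2" "cS g \<notin> P1" using e7_incomparability[OF assms(2,3,6)] .
  have "f \<noteq> 0" using f(2) ideal_setD(1)[OF prime_setD(1)[OF assms(1)]] by (auto simp: zero_e7_def)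
  then have xy: "cS xS \<in> P2" "cS yS \<in> P2"
    using fps2_prime_chain[OF prime_set_vimage[OF assms(2) ring_map_cS]
        prime_set_vimage[OF assms(3) ring_map_cS], of f g] f g assms(6) by auto
  have eq: "- cS gS = - cS (xS\<^sup>2 + yS ^ 3) * cS xS"
    by (simp only: minus_mult_left[symmetric] ring_map_simps(3)[OF ring_map_cS, symmetric])
      (simp add: algebra_simps power2_eq_square power3_eq_cube)
  have "- cS gS \<in> P2" unfolding eq by (rule ideal_setD(3)[OF I2 xy(1)])
  then have "zR * zR \<in> P2" by (simp only: zR_square)
  then have z: "zR \<in> P2" using prime_setD(3)[OF assms(3)] by blast
  obtain u where u: "u \<in> P3" "u \<notin> P2" using assms(7) by blast
  have "coeff2 (cpart u) 0 0 = 0" using e7_unit[of u] prime_set_unit[OF assms(4)] u(1) by blast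
  then obtain A B where "cpart u = xS * A + yS * B" using fps2_linear_decomp by metis
  then have "u = E7 (xS * A + yS * B) (zpart u)" by (simp add: e7_eq_iff)
  also have "\<dots> = cS xS * cS A + cS yS * cS B + zR * cS (zpart u)"
    by (simp add: E7_decomp[of _ "zpart u"] cS_simps)
  also have "\<dots> \<in> P2" using xy z by (intro ideal_setD(2)[OF I2] ideal_setD(4)[OF I2])
  finally show False using u(2) by simp
qed

text \<open>The prime ideal \<open>(x, z)\<close> of the line \<open>x = z = 0\<close>.\<close>

definition e7_line :: "'k::field e7 set" where "e7_line = {u. xS dvd cpart u}"
definition e7_max :: "'k::field e7 set" where "e7_max = {u. coeff2 (cpart u) 0 0 = 0}"

text \<open>Restriction to the line \<open>x = 0\<close>.\<close>

lemma xS_dvd_arc: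
  assumes "arc \<sigma> 0 fps_X"
  shows "xS dvd s \<longleftrightarrow> \<sigma> s = 0"
proof -
  have r: "ring_map \<sigma>" and v: "\<sigma> xS = 0" "\<sigma> yS = fps_X" using assms by (auto simp: arc_def)
  note sr = ring_map_simps[OF r]
  have "\<sigma> s \<noteq> 0" if s: "\<not> xS dvd s"
  proof -
    obtain s' N w where s': "s = xS * s' + yS ^ N * w" "w dvd 1"
      using fps2_mod_xS[OF s] by metis
    have "\<sigma> w \<noteq> 0" using ring_map_dvd[OF r s'(2)] by (auto simp: sr)
    then show ?thesis unfolding s' by (simp add: sr v)
  qed
  moreover have "\<sigma> s = 0" if "xS dvd s" using ring_map_dvd[OF r that] v by simp
  ultimately show ?thesis by blast
qed

lemma xS_prime:
  assumes "\<not> xS dvd s" "\<not> xS dvd t"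
  shows "\<not> xS dvd s * (t :: 'k::field fps2)"
proof -
  obtain \<sigma> :: "'k fps2 \<Rightarrow> 'k fps" where s: "arc \<sigma> 0 fps_X"
    using arc_exists[of "0 :: 'k fps" fps_X] by auto
  then have "ring_map \<sigma>" by (simp add: arc_def)
  then show ?thesis using assms by (simp add: xS_dvd_arc[OF s] ring_map_simps)
qed

lemma prime_e7_line: "prime_set (e7_line :: 'k::field e7 set)"
proof -
  obtain \<sigma> :: "'k fps2 \<Rightarrow> 'k fps" where s: "arc \<sigma> 0 fps_X"
    using arc_exists[of "0 :: 'k fps" fps_X] by auto
  then have r: "ring_map \<sigma>" and v: "\<sigma> xS = 0" "\<sigma> yS = fps_X" by (auto simp: arc_def)
  have "\<sigma> gS = 0" by (simp only: ring_map_simps[OF r] v) simp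
  then have "ring_map (\<lambda>u. \<sigma> (cpart u))"
    unfolding ring_map_def
    by (simp add: e7_defs ring_map_simps(1-3,6)[OF r])
  from prime_set_kernel[OF this] show ?thesis by (simp add: e7_line_def xS_dvd_arc[OF s])
qed

lemma prime_e7_max: "prime_set (e7_max :: 'k::field e7 set)"
proof -
  have "ring_map (\<lambda>u :: 'k e7. coeff2 (cpart u) 0 0)"
    by (simp add: ring_map_def e7_defs)
  from prime_set_kernel[OF this] show ?thesis by (simp add: e7_max_def)
qed

lemma e7_prime_chain:
  "prime_set {0 :: 'k::field e7}" "{0 :: 'k e7} \<subset> e7_line" "e7_line \<subset> (e7_max :: 'k e7 set)"
proof -
  have "ring_map (\<lambda>u :: 'k e7. u)" by (simp add: ring_map_def)
  from prime_set_kernel[OF this] show "prime_set {0 :: 'k e7}" by simp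
  have "cS xS \<in> (e7_line :: 'k e7 set)" "cS xS \<noteq> (0 :: 'k e7)" by (simp_all add: e7_line_def zero_e7_def)
  moreover have "0 \<in> (e7_line :: 'k e7 set)" by (simp add: e7_line_def zero_e7_def)
  ultimately show "{0 :: 'k e7} \<subset> e7_line" by auto
  have "cS yS \<in> (e7_max :: 'k e7 set)" by (simp add: e7_max_def)
  moreover have "cS yS \<notin> (e7_line :: 'k e7 set)" by (auto simp: e7_line_def xS_dvd_iff intro!: exI[of _ 1])
  moreover have "e7_line \<subseteq> (e7_max :: 'k e7 set)" by (auto simp: e7_line_def e7_max_def xS_dvd_iff)
  ultimately show "e7_line \<subset> (e7_max :: 'k e7 set)" by blast
qed

section \<open>Depth\<close>

definition two_gen :: "'a::comm_ring_1 \<Rightarrow> 'a \<Rightarrow> 'a set \<Rightarrow> 'a set" where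
  "two_gen a b I = {a * i + b * j | i j. i \<in> I \<and> j \<in> I}"

text \<open>
  Exactness of a Koszul complex in elementary terms: modulo the regular pair \<open>x, y\<close>, an element that
  is annihilated by a regular sequence \<open>a, b, c\<close> on \<open>I\<close> vanishes. Comparing the expressions of
  \<open>a * w\<close>, \<open>b * w\<close> and \<open>c * w\<close> yields syzygies \<open>r12\<close>, \<open>r13\<close>, \<open>r23\<close> whose Koszul relation, by regularity of
  \<open>c\<close>, makes \<open>r12\<close> a combination of \<open>a\<close> and \<open>b\<close>. With that, \<open>p1\<close> and \<open>q1\<close> can be changed into multiples
  of \<open>a\<close>, and \<open>a\<close> is cancelled. Together with a socle element \<open>w\<close> this bounds the depth of \<open>I\<close> by two.
\<close>

lemma koszul_chase:
  fixes x y :: "'a::idom"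
  assumes I: "ideal_set I" and x: "x \<noteq> 0" and a: "a \<noteq> 0"
    and y: "\<And>u. u \<in> I \<Longrightarrow> y * u \<in> times x ` I \<Longrightarrow> u \<in> times x ` I"
    and b: "\<And>u. u \<in> I \<Longrightarrow> b * u \<in> times a ` I \<Longrightarrow> u \<in> times a ` I"
    and c: "\<And>u. u \<in> I \<Longrightarrow> c * u \<in> two_gen a b I \<Longrightarrow> u \<in> two_gen a b I"
    and w: "w \<in> I" "a * w \<in> two_gen x y I" "b * w \<in> two_gen x y I" "c * w \<in> two_gen x y I"
  shows "w \<in> two_gen x y I"
proof -
  note D = ideal_setD[OF I]
  obtain p1 q1 where 1: "a * w = x * p1 + y * q1" "p1 \<in> I" "q1 \<in> I" using w by (auto simp: two_gen_def)
  obtain p2 q2 where 2: "b * w = x * p2 + y * q2" "p2 \<in> I" "q2 \<in> I" using w by (auto simp: two_gen_def)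
  obtain p3 q3 where 3: "c * w = x * p3 + y * q3" "p3 \<in> I" "q3 \<in> I" using w by (auto simp: two_gen_def)
  have syzygy: "\<exists>r\<in>I. s * q' - s' * q = x * r \<and> s' * p - s * p' = y * r"
    if "s * w = x * p + y * q" "s' * w = x * p' + y * q'" "p \<in> I" "q \<in> I" "p' \<in> I" "q' \<in> I"
    for s s' p p' q q'
  proof -
    have "s' * (x * p + y * q) = s * (x * p' + y * q')" using that(1,2) by (metis mult.left_commute)
    then have eq: "y * (s * q' - s' * q) = x * (s' * p - s * p')" by (simp add: algebra_simps)
    have mem: "s * q' - s' * q \<in> I" "s' * p - s * p' \<in> I" using that D(3,5) by blast+
    have "s * q' - s' * q \<in> times x ` I"
      by (rule y[OF mem(1)]) (use eq mem(2) in blast)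
    then obtain r where r: "r \<in> I" "s * q' - s' * q = x * r" by auto
    then have "x * (s' * p - s * p') = x * (y * r)" using eq by (metis mult.left_commute)
    then show ?thesis using r x by auto
  qed
  obtain r12 where r12: "r12 \<in> I" "a * q2 - b * q1 = x * r12" "b * p1 - a * p2 = y * r12"
    using syzygy[OF 1(1) 2(1)] 1 2 by blast
  obtain r13 where r13: "r13 \<in> I" "a * q3 - c * q1 = x * r13"
    using syzygy[OF 1(1) 3(1)] 1 3 by blast
  obtain r23 where r23: "r23 \<in> I" "b * q3 - c * q2 = x * r23"
    using syzygy[OF 2(1) 3(1)] 2 3 by blast
  have "x * (c * r12) = x * (a * (- r23) + b * r13)"
  proof -
    have "x * (c * r12) = c * (a * q2 - b * q1)" unfolding r12(2) by (simp add: mult_ac)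
    also have "\<dots> = - a * (b * q3 - c * q2) + b * (a * q3 - c * q1)" by (simp add: algebra_simps)
    also have "\<dots> = x * (a * (- r23) + b * r13)" unfolding r13(2) r23(2) by (simp add: algebra_simps)
    finally show ?thesis .
  qed
  then have "c * r12 = a * (- 1 * r23) + b * r13" using x by simp
  moreover have "- 1 * r23 \<in> I" using D(3)[OF r23(1)] .
  ultimately have "c * r12 \<in> two_gen a b I" using r13(1) unfolding two_gen_def by blast
  then obtain s t where st: "r12 = a * s + b * t" "s \<in> I" "t \<in> I"
    using c[OF r12(1)] by (auto simp: two_gen_def)
  have "b * (q1 + x * t) = a * (q2 - x * s)" using r12(2) unfolding st(1) by (simp add: algebra_simps)
  moreover have "q2 - x * s \<in> I" "q1 + x * t \<in> I" using 1 2 st D(2,3,5) by blast+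
  ultimately obtain v where v: "v \<in> I" "q1 + x * t = a * v" using b[of "q1 + x * t"] by auto
  have "b * (p1 - y * t) = a * (p2 + y * s)" using r12(3) unfolding st(1) by (simp add: algebra_simps)
  moreover have "p2 + y * s \<in> I" "p1 - y * t \<in> I" using 1 2 st D(2,3,5) by blast+
  ultimately obtain v' where v': "v' \<in> I" "p1 - y * t = a * v'" using b[of "p1 - y * t"] by auto
  have "a * w = x * (p1 - y * t) + y * (q1 + x * t)" unfolding 1(1) by (simp add: algebra_simps)
  also have "\<dots> = a * (x * v' + y * v)" unfolding v v' by (simp add: algebra_simps)
  finally have "w = x * v' + y * v" using a by simp
  then show ?thesis using v v' by (auto simp: two_gen_def)
qed

lemma e7_line_regular:
  fixes u :: "'k::field e7"
  assumes "u \<in> e7_line" "cS yS * u \<in> times (cS xS) ` e7_line"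
  shows "(u :: 'k::field e7) \<in> times (cS xS) ` e7_line"
proof -
  obtain \<sigma> :: "'k fps2 \<Rightarrow> 'k fps" where s: "arc \<sigma> 0 fps_X"
    using arc_exists[of "0 :: 'k fps" fps_X] by auto
  then have r: "ring_map \<sigma>" and v: "\<sigma> xS = 0" "\<sigma> yS = fps_X" by (auto simp: arc_def)
  have cancel: "xS dvd t" if "yS * t = xS * t'" for t t' :: "'k fps2"
    using arg_cong[OF that, of \<sigma>] by (simp add: ring_map_simps[OF r] v xS_dvd_arc[OF s])
  obtain i where i: "xS dvd cpart i" "cS yS * u = cS xS * i" using assms(2) by (auto simp: e7_line_def)
  obtain i' where i': "cpart i = xS * i'" using i(1) by (rule dvdE)
  obtain u' where u': "cpart u = xS * u'" using assms(1) unfolding e7_line_def by (auto elim: dvdE)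
  have eqs: "yS * cpart u = xS * cpart i" "yS * zpart u = xS * zpart i"
    using i(2) by (simp_all add: e7_defs)
  have "xS * (yS * u') = xS * (xS * i')" using eqs(1) unfolding u' i' by (simp only: mult.left_commute)
  then have "yS * u' = xS * i'" by (simp only: mult_cancel_left) auto
  then obtain u'' where u'': "u' = xS * u''" using cancel by (metis dvdE)
  obtain c where c: "zpart u = xS * c" using cancel[OF eqs(2)] by (rule dvdE)
  have "u = cS xS * E7 (xS * u'') c" by (simp add: e7_eq_iff times_e7_def u' u'' c)
  moreover have "E7 (xS * u'') c \<in> e7_line" by (simp add: e7_line_def)
  ultimately show ?thesis by blast
qed

text \<open>
  The ideal is free over \<open>k\<lbrakk>x, y\<rbrakk>\<close> with basis \<open>x, z\<close>, and \<open>z * x = x * z\<close> is \<open>x\<close> times the second basis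
  element. So \<open>x\<close> spans part of the socle of the ideal modulo \<open>(x, y)\<close>.
\<close>

lemma e7_line_socle:
  "cS xS \<in> (e7_line :: 'k::field e7 set)"
  "a \<in> e7_max \<Longrightarrow> a * cS xS \<in> two_gen (cS xS) (cS yS) (e7_line :: 'k e7 set)"
  "cS xS \<notin> two_gen (cS xS) (cS yS) (e7_line :: 'k e7 set)"
proof -
  show "cS xS \<in> (e7_line :: 'k e7 set)" by (simp add: e7_line_def)
next
  assume "a \<in> e7_max"
  then have "coeff2 (cpart a) 0 0 = 0" by (simp add: e7_max_def)
  then obtain A B where AB: "cpart a = xS * A + yS * B" using fps2_linear_decomp by metis
  have "a * cS xS = cS xS * E7 (xS * A) (zpart a) + cS yS * E7 (xS * B) 0"
    by (simp add: e7_eq_iff e7_defs AB algebra_simps)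
  then show "a * cS xS \<in> two_gen (cS xS) (cS yS) (e7_line :: 'k e7 set)"
    unfolding two_gen_def e7_line_def by (intro CollectI exI conjI) auto
next
  show "cS xS \<notin> two_gen (cS xS) (cS yS) (e7_line :: 'k e7 set)"
  proof
    assume "cS xS \<in> two_gen (cS xS) (cS yS) (e7_line :: 'k e7 set)"
    then obtain i j :: "'k e7" where ij: "cS xS = cS xS * i + cS yS * j" "xS dvd cpart i" "xS dvd cpart j"
      by (auto simp: two_gen_def e7_line_def)
    then obtain i' j' where ij': "cpart i = xS * i'" "cpart j = xS * j'" by (metis dvdE)
    have "cpart (cS xS) = cpart (cS xS * i + cS yS * j)" using ij(1) by (rule arg_cong)
    then have "xS = xS * (xS * i' + yS * j')" using ij' by (simp add: e7_defs algebra_simps)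
    then have "1 = xS * i' + yS * j'" by (metis fps_X_neq_zero fps_const_eq_0_iff mult_cancel_left1)
    then have "fps_nth (fps_nth 1 0) 0 = fps_nth (fps_nth (xS * i' + yS * j') 0) 0" by (rule arg_cong)
    then show False by simp
  qed
qed

theorem e7_line_no_three_term_regular_sequence:
  fixes a b c :: "'k::field e7"
  assumes max: "a \<in> e7_max" "b \<in> e7_max" "c \<in> e7_max" and a: "a \<noteq> 0"
    and b: "\<And>u. u \<in> e7_line \<Longrightarrow> b * u \<in> times a ` e7_line \<Longrightarrow> u \<in> times a ` e7_line"
    and c: "\<And>u. u \<in> e7_line \<Longrightarrow> c * u \<in> two_gen a b e7_line \<Longrightarrow> u \<in> two_gen a b e7_line"
  shows False
proof -
  have "cS xS \<noteq> (0 :: 'k e7)" by (simp add: zero_e7_def)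
  from koszul_chase[OF prime_setD(1)[OF prime_e7_line] this a e7_line_regular b c
      e7_line_socle(1) e7_line_socle(2)[OF max(1)] e7_line_socle(2)[OF max(2)] e7_line_socle(2)[OF max(3)]]
  show False using e7_line_socle(3) by blast
qed

section \<open>Modules over the surface ring\<close>

text \<open>
  Scalars are elements of a type, so that equations between them are decided by the simplifier, while
  the module keeps its carrier set.
\<close>

locale type_module = abelian_group M for M :: "('m, 'e) ring_scheme" (structure) +
  fixes act :: "'r::comm_ring_1 \<Rightarrow> 'm \<Rightarrow> 'm" (infixr "\<bullet>" 75)
  assumes act_closed [simp, intro]: "m \<in> carrier M \<Longrightarrow> u \<bullet> m \<in> carrier M"
    and act_add: "m \<in> carrier M \<Longrightarrow> (u + v) \<bullet> m = u \<bullet> m \<oplus> v \<bullet> m"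
    and act_r_add: "m \<in> carrier M \<Longrightarrow> n \<in> carrier M \<Longrightarrow> u \<bullet> (m \<oplus> n) = u \<bullet> m \<oplus> u \<bullet> n"
    and act_mult: "m \<in> carrier M \<Longrightarrow> (u * v) \<bullet> m = u \<bullet> v \<bullet> m"
    and act_one [simp]: "m \<in> carrier M \<Longrightarrow> 1 \<bullet> m = m"
begin

lemma act_0 [simp]: "m \<in> carrier M \<Longrightarrow> 0 \<bullet> m = \<zero>"
  using act_add[of m 0 0] by simp

lemma act_r_0 [simp]: "u \<bullet> \<zero> = \<zero>"
  using act_r_add[of \<zero> \<zero> u] by simp

lemma act_minus: "m \<in> carrier M \<Longrightarrow> (- u) \<bullet> m = \<ominus> (u \<bullet> m)"
  using act_add[of m "- u" u] by (simp add: minus_equality)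

lemma act_r_minus: "m \<in> carrier M \<Longrightarrow> u \<bullet> (\<ominus> m) = \<ominus> (u \<bullet> m)"
  using act_r_add[of "\<ominus> m" m u] by (simp add: minus_equality l_neg)

lemma act_diff: "m \<in> carrier M \<Longrightarrow> (u - v) \<bullet> m = u \<bullet> m \<ominus> v \<bullet> m"
  using act_add[of m u "- v"] by (simp add: act_minus minus_eq)

lemma act_r_diff: "m \<in> carrier M \<Longrightarrow> n \<in> carrier M \<Longrightarrow> u \<bullet> (m \<ominus> n) = u \<bullet> m \<ominus> u \<bullet> n"
  by (simp add: act_r_add act_r_minus minus_eq)

lemma act_commute: "m \<in> carrier M \<Longrightarrow> u \<bullet> v \<bullet> m = v \<bullet> u \<bullet> m"
  by (simp add: mult.commute flip: act_mult)

lemma minus_eq_0_iff: "m \<in> carrier M \<Longrightarrow> n \<in> carrier M \<Longrightarrow> m \<ominus> n = \<zero> \<longleftrightarrow> m = n"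
  by (metis minus_eq a_inv_closed add.inv_comm l_neg minus_equality minus_minus r_neg)

lemma add_exchange:
  assumes c: "p \<in> carrier M" "q \<in> carrier M" "r \<in> carrier M" "s \<in> carrier M" and eq: "p \<oplus> q = r \<oplus> s"
  shows "p \<ominus> r = s \<ominus> q"
proof -
  have "p \<ominus> r = (p \<ominus> r) \<oplus> (q \<ominus> q)" using c by (simp add: minus_eq r_neg)
  also have "\<dots> = (p \<oplus> q) \<oplus> (\<ominus> r \<oplus> \<ominus> q)" using c by (simp add: minus_eq a_ac)
  also have "\<dots> = (r \<ominus> r) \<oplus> (s \<ominus> q)" unfolding eq using c by (simp add: minus_eq a_ac)
  also have "\<dots> = s \<ominus> q" using c by (simp add: minus_eq r_neg)
  finally show ?thesis .
qed

lemma add_minus_cancel: "p \<in> carrier M \<Longrightarrow> q \<in> carrier M \<Longrightarrow> p \<oplus> q \<ominus> p = q"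
  using add_exchange[of "p \<oplus> q" \<zero> p q] by (simp add: minus_eq)

lemma act_cancel:
  assumes "\<And>m. m \<in> carrier M \<Longrightarrow> u \<bullet> m = \<zero> \<Longrightarrow> m = \<zero>"
    and "m \<in> carrier M" "n \<in> carrier M" "u \<bullet> m = u \<bullet> n"
  shows "m = n"
proof -
  have "u \<bullet> (m \<ominus> n) = \<zero>" using assms(2-4) by (simp add: act_r_diff minus_eq_0_iff)
  then have "m \<ominus> n = \<zero>" using assms(1)[of "m \<ominus> n"] assms(2,3) by simp
  then show ?thesis using assms(2,3) by (simp add: minus_eq_0_iff)
qed

definition act_image :: "'r \<Rightarrow> 'm set" where
  "act_image u = {u \<bullet> m | m. m \<in> carrier M}"

definition act_submodule :: "'m set \<Rightarrow> bool" where
  "act_submodule L \<longleftrightarrow> L \<subseteq> carrier M \<and> \<zero> \<in> L \<and> (\<forall>m\<in>L. \<forall>n\<in>L. m \<oplus> n \<in> L) \<and> (\<forall>u. \<forall>m\<in>L. u \<bullet> m \<in> L)"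

lemma act_submoduleD:
  assumes "act_submodule L"
  shows "m \<in> L \<Longrightarrow> m \<in> carrier M" "\<zero> \<in> L" "m \<in> L \<Longrightarrow> n \<in> L \<Longrightarrow> m \<oplus> n \<in> L" "m \<in> L \<Longrightarrow> u \<bullet> m \<in> L"
    "m \<in> L \<Longrightarrow> n \<in> L \<Longrightarrow> m \<ominus> n \<in> L" "m \<in> L \<Longrightarrow> \<ominus> m \<in> L"
proof -
  show 1: "m \<in> L \<Longrightarrow> m \<in> carrier M" and "\<zero> \<in> L" and 3: "m \<in> L \<Longrightarrow> n \<in> L \<Longrightarrow> m \<oplus> n \<in> L"
    and 4: "m \<in> L \<Longrightarrow> u \<bullet> m \<in> L" for m n u
    using assms by (auto simp: act_submodule_def)
  show 5: "m \<in> L \<Longrightarrow> \<ominus> m \<in> L" for m using 4[of m "- 1"] 1[of m] by (simp add: act_minus)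
  show "m \<in> L \<Longrightarrow> n \<in> L \<Longrightarrow> m \<ominus> n \<in> L" using 3[of m "\<ominus> n"] 5[of n] by (simp add: minus_eq)
qed

lemma act_submodule_0: "act_submodule {\<zero>}"
  by (simp add: act_submodule_def)

lemma act_submodule_image: "act_submodule (act_image u)"
  unfolding act_submodule_def act_image_def
proof (intro conjI ballI allI)
  show "\<zero> \<in> {u \<bullet> m | m. m \<in> carrier M}" using act_r_0[of u] zero_closed by force
next
  fix m n assume "m \<in> {u \<bullet> m | m. m \<in> carrier M}" "n \<in> {u \<bullet> m | m. m \<in> carrier M}"
  then show "m \<oplus> n \<in> {u \<bullet> m | m. m \<in> carrier M}" by (smt (verit) a_closed act_r_add mem_Collect_eq)
next
  fix v m assume "m \<in> {u \<bullet> m | m. m \<in> carrier M}"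
  then show "v \<bullet> m \<in> {u \<bullet> m | m. m \<in> carrier M}" using act_commute by (smt (verit) act_closed mem_Collect_eq)
qed auto

lemma act_submodule_sum:
  assumes "act_submodule L" "e \<in> carrier M"
  shows "act_submodule {s \<bullet> e \<oplus> l | s l. l \<in> L}"
  unfolding act_submodule_def
proof (intro conjI ballI allI)
  note D = act_submoduleD[OF assms(1)]
  show "{s \<bullet> e \<oplus> l | s l. l \<in> L} \<subseteq> carrier M" using D(1) assms(2) by auto
  show "\<zero> \<in> {s \<bullet> e \<oplus> l | s l. l \<in> L}"
    using assms(2) D(2) by (intro CollectI exI[of _ 0] exI[of _ \<zero>]) simp
  fix m assume "m \<in> {s \<bullet> e \<oplus> l | s l. l \<in> L}"
  then obtain s l where m: "m = s \<bullet> e \<oplus> l" "l \<in> L" by blast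
  have "u \<bullet> m = (u * s) \<bullet> e \<oplus> u \<bullet> l" for u
    using m D(1)[OF m(2)] assms(2) by (simp add: act_r_add act_mult)
  then show "u \<bullet> m \<in> {s \<bullet> e \<oplus> l | s l. l \<in> L}" for u using D(4)[OF m(2)] by blast
  fix n assume "n \<in> {s \<bullet> e \<oplus> l | s l. l \<in> L}"
  then obtain s' l' where n: "n = s' \<bullet> e \<oplus> l'" "l' \<in> L" by blast
  have "m \<oplus> n = (s + s') \<bullet> e \<oplus> (l \<oplus> l')"
    using m n D(1)[OF m(2)] D(1)[OF n(2)] assms(2) by (simp add: act_add a_ac)
  then show "m \<oplus> n \<in> {s \<bullet> e \<oplus> l | s l. l \<in> L}" using D(3)[OF m(2) n(2)] by blast
qed

text \<open>
  The vectors themselves serve as indices, so a linear combination is given by a coefficient function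
  and a finite set of vectors, and removing a generator needs no renumbering.
\<close>

definition lin :: "('m \<Rightarrow> 'r) \<Rightarrow> 'm set \<Rightarrow> 'm" where
  "lin s E = (\<Oplus>e\<in>E. s e \<bullet> e)"

lemma lin_closed [simp]: "E \<subseteq> carrier M \<Longrightarrow> lin s E \<in> carrier M"
  unfolding lin_def by (intro finsum_closed) auto

lemma lin_empty [simp]: "lin s {} = \<zero>" by (simp add: lin_def)

lemma lin_insert:
  "finite E \<Longrightarrow> e \<notin> E \<Longrightarrow> insert e E \<subseteq> carrier M \<Longrightarrow> lin s (insert e E) = s e \<bullet> e \<oplus> lin s E"
  unfolding lin_def by (intro finsum_insert) auto

lemma lin_cong: "E \<subseteq> carrier M \<Longrightarrow> (\<And>e. e \<in> E \<Longrightarrow> s e = t e) \<Longrightarrow> lin s E = lin t E"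
  unfolding lin_def by (intro finsum_cong') auto

lemma lin_add: "E \<subseteq> carrier M \<Longrightarrow> lin (\<lambda>e. s e + t e) E = lin s E \<oplus> lin t E"
proof -
  assume E: "E \<subseteq> carrier M"
  have "(\<Oplus>e\<in>E. (s e + t e) \<bullet> e) = (\<Oplus>e\<in>E. s e \<bullet> e \<oplus> t e \<bullet> e)"
    using E by (intro finsum_cong') (auto simp: act_add)
  also have "\<dots> = (\<Oplus>e\<in>E. s e \<bullet> e) \<oplus> (\<Oplus>e\<in>E. t e \<bullet> e)"
    using E by (intro finsum_addf) auto
  finally show ?thesis by (simp add: lin_def)
qed

lemma lin_act: "finite E \<Longrightarrow> E \<subseteq> carrier M \<Longrightarrow> lin (\<lambda>e. c * s e) E = c \<bullet> lin s E"
proof (induction E rule: finite_induct)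
  case (insert e E)
  then show ?case by (simp add: lin_insert act_r_add act_mult)
qed simp

lemma lin_diff: "finite E \<Longrightarrow> E \<subseteq> carrier M \<Longrightarrow> lin (\<lambda>e. s e - t e) E = lin s E \<ominus> lin t E"
  using lin_add[of E s "\<lambda>e. - 1 * t e"] lin_act[of E "- 1" t] by (simp add: minus_eq act_minus)

lemma lin_zero: "E \<subseteq> carrier M \<Longrightarrow> (\<And>e. e \<in> E \<Longrightarrow> s e = 0) \<Longrightarrow> lin s E = \<zero>"
proof -
  assume E: "E \<subseteq> carrier M" and "\<And>e. e \<in> E \<Longrightarrow> s e = 0"
  then have "lin s E = (\<Oplus>e\<in>E. \<zero>)" unfolding lin_def by (intro finsum_cong') auto
  then show ?thesis by simp
qed

lemma lin_remove:
  assumes "finite E" "E \<subseteq> carrier M" "e \<in> E"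
  shows "lin s E = s e \<bullet> e \<oplus> lin s (E - {e})"
  using lin_insert[of "E - {e}" e s] assms by (simp add: insert_absorb)

lemma lin_single:
  assumes "finite E" "E \<subseteq> carrier M" "e \<in> E"
  shows "lin (\<lambda>e'. if e' = e then 1 else 0) E = e"
proof -
  have "lin (\<lambda>e'. if e' = e then 1 else 0) (E - {e}) = \<zero>"
    using assms by (intro lin_zero) auto
  then show ?thesis using lin_remove[OF assms] assms by auto
qed

lemma finsum_lin:
  assumes "finite F" "E \<subseteq> carrier M" "\<And>f. f \<in> F \<Longrightarrow> g f = lin (\<phi> f) E"
  shows "(\<Oplus>f\<in>F. g f) = lin (\<lambda>e. \<Sum>f\<in>F. \<phi> f e) E"
  using assms(1,3)
proof (induction F rule: finite_induct)
  case empty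
  then show ?case using assms(2) by (simp add: lin_zero)
next
  case (insert f F)
  then have "(\<Oplus>f\<in>insert f F. g f) = g f \<oplus> (\<Oplus>f\<in>F. g f)"
    using assms(2) by (intro finsum_insert) auto
  also have "\<dots> = lin (\<lambda>e. \<phi> f e + (\<Sum>f\<in>F. \<phi> f e)) E"
    using insert assms(2) by (simp add: lin_add)
  finally show ?case using insert by simp
qed

end

lemma (in type_module) restrict_scalars:
  assumes "ring_map h"
  shows "type_module M (\<lambda>s. act (h s))"
  by unfold_locales (simp_all add: ring_map_simps[OF assms] act_add act_r_add act_mult)


locale fps2_module = type_module M act
  for M :: "('m, 'e) ring_scheme" (structure) and act :: "'k::field fps2 \<Rightarrow> 'm \<Rightarrow> 'm" (infixr "\<bullet>" 75)
begin

text \<open>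
  Elements of \<open>K\<close> are \<open>s \<bullet> e\<close> modulo \<open>L\<close>. Let \<open>x ^ i\<close> be the highest power of \<open>x\<close> that divides all coefficients
  \<open>s\<close>, and \<open>s0 = x ^ i * t\<close> one for which \<open>t\<close> has finite order \<open>N\<close> in \<open>y\<close> modulo \<open>x\<close>. Dividing \<open>N + 1\<close> times by \<open>y\<close>
  gives a second coefficient \<open>y ^ (N + 1) * x ^ i * t'\<close> of the same element. The difference
  \<open>c = t - y ^ (N + 1) * t'\<close> is not divisible by \<open>x\<close>, and \<open>c * x ^ i\<close> carries \<open>e\<close>, hence \<open>c\<close> carries \<open>K\<close>, into \<open>L\<close>.
\<close>

lemma divisible_cyclic:
  assumes L: "act_submodule L" and e: "e \<in> carrier M"
    and K: "\<And>u. u \<in> K \<Longrightarrow> \<exists>s l. l \<in> L \<and> u = s \<bullet> e \<oplus> l"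
    and div: "\<And>u. u \<in> K \<Longrightarrow> \<exists>u'\<in>K. \<exists>l\<in>L. u = yS \<bullet> u' \<oplus> l"
  shows "\<exists>d. \<not> xS dvd d \<and> (\<forall>u\<in>K. d \<bullet> u \<in> L)"
proof -
  note LD = act_submoduleD[OF L]
  define A where "A = {s. \<exists>u\<in>K. \<exists>l\<in>L. u = s \<bullet> e \<oplus> l}"
  show ?thesis
  proof (cases "\<exists>s\<in>A. s \<noteq> 0")
    case False
    have "u \<in> L" if u: "u \<in> K" for u
    proof -
      obtain s l where "l \<in> L" "u = s \<bullet> e \<oplus> l" using K[OF u] by blast
      moreover from this have "s = 0" using False u by (auto simp: A_def)
      ultimately show ?thesis using e LD(1) by simp
    qed
    moreover have "u \<in> carrier M" if "u \<in> L" for u using LD(1) that .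
    ultimately show ?thesis by (intro exI[of _ 1]) (auto simp: xS_dvd_iff intro: exI[of _ 0])
  next
    case True
    let ?P = "\<lambda>i. \<exists>s\<in>A. \<not> xS ^ Suc i dvd s"
    define i where "i = (LEAST i. ?P i)"
    have "\<exists>i. ?P i"
    proof -
      obtain s where s: "s \<in> A" "s \<noteq> 0" using True by blast
      then obtain n where n: "\<not> xS ^ n dvd s"
        using adic_complete_xS unfolding adic_complete_def by blast
      then show ?thesis using s by (cases n) auto
    qed
    then have "?P i" unfolding i_def by (rule LeastI_ex)
    then obtain s0 where s0: "s0 \<in> A" "\<not> xS ^ Suc i dvd s0" by blast
    have all: "xS ^ i dvd s" if s: "s \<in> A" for s
    proof (cases i)
      case (Suc i')
      then have "\<not> ?P i'" using not_less_Least[of i' ?P] by (simp add: i_def)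
      then show ?thesis using s Suc by auto
    qed simp
    obtain t where t: "s0 = xS ^ i * t" using all[OF s0(1)] by (rule dvdE)
    have "\<not> xS dvd t"
    proof
      assume "xS dvd t"
      then have "xS ^ i * xS dvd s0" unfolding t by (intro mult_dvd_mono dvd_refl)
      then show False using s0(2) unfolding power_Suc2 by (rule notE[rotated])
    qed
    then obtain N where N: "coeff2 t 0 N \<noteq> 0" using fps2_mod_xS by metis
    obtain u0 l0 where u0: "u0 \<in> K" "l0 \<in> L" "u0 = s0 \<bullet> e \<oplus> l0" using s0(1) by (auto simp: A_def)
    have K_car: "u \<in> carrier M" if u: "u \<in> K" for u
      using K[OF u] e LD(1) by auto
    have iter: "\<exists>u'\<in>K. \<exists>l\<in>L. u0 = yS ^ n \<bullet> u' \<oplus> l" for n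
    proof (induction n)
      case 0
      then show ?case using u0(1) K_car[OF u0(1)] LD(2) by (intro bexI[of _ u0] bexI[of _ \<zero>]) auto
    next
      case (Suc n)
      then obtain u' l where u': "u' \<in> K" "l \<in> L" "u0 = yS ^ n \<bullet> u' \<oplus> l" by blast
      obtain u'' l' where u'': "u'' \<in> K" "l' \<in> L" "u' = yS \<bullet> u'' \<oplus> l'" using div[OF u'(1)] by blast
      have c: "u'' \<in> carrier M" "l \<in> carrier M" "l' \<in> carrier M"
        using K_car[OF u''(1)] LD(1)[OF u'(2)] LD(1)[OF u''(2)] by auto
      have "u0 = yS ^ Suc n \<bullet> u'' \<oplus> (yS ^ n \<bullet> l' \<oplus> l)"
        unfolding u'(3) u''(3) power_Suc2 using c by (simp add: act_r_add act_mult a_assoc)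
      then show ?case using u''(1) LD(3)[OF LD(4)[OF u''(2)] u'(2)] by blast
    qed
    obtain u' l where u': "u' \<in> K" "l \<in> L" "u0 = yS ^ Suc N \<bullet> u' \<oplus> l" using iter by blast
    obtain s' l' where s': "l' \<in> L" "u' = s' \<bullet> e \<oplus> l'" using K[OF u'(1)] by blast
    then have "s' \<in> A" using u'(1) by (auto simp: A_def)
    then obtain t' where t': "s' = xS ^ i * t'" using all by (blast elim: dvdE)
    define c where "c = t - yS ^ Suc N * t'"
    have "coeff2 c 0 N = coeff2 t 0 N" unfolding c_def by (simp only: fps_sub_nth fps_X_power_mult_nth) simp
    then have c: "\<not> xS dvd c" using N unfolding xS_dvd_iff by metis
    have car: "l \<in> carrier M" "l' \<in> carrier M" "l0 \<in> carrier M"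
      using LD(1) u'(2) s'(1) u0(2) by auto
    have "s0 \<bullet> e \<oplus> l0 = yS ^ Suc N \<bullet> (s' \<bullet> e \<oplus> l') \<oplus> l" using u0(3) u'(3) s'(2) by simp
    then have "s0 \<bullet> e \<oplus> l0 = (yS ^ Suc N * s') \<bullet> e \<oplus> (yS ^ Suc N \<bullet> l' \<oplus> l)"
      using car e by (simp add: act_r_add act_mult a_assoc del: power_Suc)
    then have "s0 \<bullet> e \<ominus> (yS ^ Suc N * s') \<bullet> e = yS ^ Suc N \<bullet> l' \<oplus> l \<ominus> l0"
      using car e by (intro add_exchange) auto
    then have "(s0 - yS ^ Suc N * s') \<bullet> e = yS ^ Suc N \<bullet> l' \<oplus> l \<ominus> l0"
      using e by (simp only: act_diff)
    moreover have "s0 - yS ^ Suc N * s' = c * xS ^ i" unfolding c_def t t' by (simp only: left_diff_distrib right_diff_distrib mult_ac)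
    moreover have "yS ^ Suc N \<bullet> l' \<oplus> l \<ominus> l0 \<in> L"
      by (rule LD(5)[OF LD(3)[OF LD(4)[OF s'(1)] u'(2)] u0(2)])
    ultimately have ce: "(c * xS ^ i) \<bullet> e \<in> L" by simp
    have "c \<bullet> u \<in> L" if u: "u \<in> K" for u
    proof -
      obtain s l where sl: "l \<in> L" "u = s \<bullet> e \<oplus> l" using K[OF u] by blast
      then have "s \<in> A" using u by (auto simp: A_def)
      then obtain t'' where t'': "s = xS ^ i * t''" using all by (blast elim: dvdE)
      have "c \<bullet> u = c \<bullet> s \<bullet> e \<oplus> c \<bullet> l" using sl LD(1)[OF sl(1)] e by (simp add: act_r_add)
      also have "c \<bullet> s \<bullet> e = t'' \<bullet> (c * xS ^ i) \<bullet> e"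
        unfolding t'' using e by (simp add: mult_ac flip: act_mult)
      finally show ?thesis using LD(3)[OF LD(4)[OF ce] LD(4)[OF sl(1)]] by simp
    qed
    then show ?thesis using c by blast
  qed
qed

text \<open>
  A form of the Krull intersection theorem: infinitely \<open>y\<close>-divisible elements of a finitely generated module
  are torsion away from the line \<open>x = 0\<close>. Working modulo a varying submodule \<open>L\<close> replaces passage to quotients in
  the induction over the generators.
\<close>

lemma divisible_finitely_generated:
  assumes "finite E" "E \<subseteq> carrier M" and L: "act_submodule L" and Kc: "K \<subseteq> carrier M"
    and K: "\<And>u. u \<in> K \<Longrightarrow> \<exists>s l. l \<in> L \<and> u = lin s E \<oplus> l"
    and div: "\<And>u. u \<in> K \<Longrightarrow> \<exists>u'\<in>K. \<exists>l\<in>L. u = yS \<bullet> u' \<oplus> l"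
  shows "\<exists>d. \<not> xS dvd d \<and> (\<forall>u\<in>K. d \<bullet> u \<in> L)"
  using assms
proof (induction E arbitrary: L rule: finite_induct)
  case empty
  have "u \<in> L" if u: "u \<in> K" for u
    using empty.prems(4)[OF u] act_submoduleD(1)[OF empty.prems(2)] by auto
  moreover have "u \<in> carrier M" if "u \<in> K" for u using empty.prems(3) that by blast
  ultimately show ?case by (intro exI[of _ 1]) (auto simp: xS_dvd_iff intro: exI[of _ 0])
next
  case (insert e E)
  note LD = act_submoduleD[OF insert.prems(2)]
  have e: "e \<in> carrier M" and E: "E \<subseteq> carrier M" using insert.prems(1) by auto
  define L' where "L' = {s \<bullet> e \<oplus> l | s l. l \<in> L}"
  have L': "act_submodule L'" unfolding L'_def using insert.prems(2) e by (rule act_submodule_sum)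
  have sub: "l \<in> L'" if "l \<in> L" for l
    unfolding L'_def using e that LD(1)[OF that] by (intro CollectI exI[of _ 0] exI[of _ l]) simp
  have "\<exists>d. \<not> xS dvd d \<and> (\<forall>u\<in>K. d \<bullet> u \<in> L')"
  proof (rule insert.IH[OF E L' insert.prems(3)])
    fix u assume u: "u \<in> K"
    obtain s l where sl: "l \<in> L" "u = lin s (insert e E) \<oplus> l" using insert.prems(4)[OF u] by blast
    have "u = lin s E \<oplus> (s e \<bullet> e \<oplus> l)"
      using sl LD(1)[OF sl(1)] e E insert.hyps by (simp add: lin_insert a_ac)
    then show "\<exists>s l. l \<in> L' \<and> u = lin s E \<oplus> l" using sl(1) unfolding L'_def by blast
    show "\<exists>u'\<in>K. \<exists>l\<in>L'. u = yS \<bullet> u' \<oplus> l" using insert.prems(5)[OF u] sub by blast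
  qed
  then obtain d where d: "\<not> xS dvd d" "\<And>u. u \<in> K \<Longrightarrow> d \<bullet> u \<in> L'" by blast
  have "\<exists>d'. \<not> xS dvd d' \<and> (\<forall>w\<in>(\<lambda>u. d \<bullet> u) ` K. d' \<bullet> w \<in> L)"
  proof (rule divisible_cyclic[OF insert.prems(2) e])
    fix w assume "w \<in> (\<lambda>u. d \<bullet> u) ` K"
    then obtain u where u: "u \<in> K" "w = d \<bullet> u" by blast
    show "\<exists>s l. l \<in> L \<and> w = s \<bullet> e \<oplus> l" using d(2)[OF u(1)] u(2) unfolding L'_def by blast
    obtain u' l where u': "u' \<in> K" "l \<in> L" "u = yS \<bullet> u' \<oplus> l" using insert.prems(5)[OF u(1)] by blast
    have c: "u' \<in> carrier M" "l \<in> carrier M" using u'(1) insert.prems(3) LD(1)[OF u'(2)] by auto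
    have "w = yS \<bullet> d \<bullet> u' \<oplus> d \<bullet> l"
      unfolding u(2) u'(3) using c by (simp add: act_r_add act_commute[of u' d])
    then show "\<exists>w'\<in>(\<lambda>u. d \<bullet> u) ` K. \<exists>l\<in>L. w = yS \<bullet> w' \<oplus> l" using u'(1) LD(4)[OF u'(2)] by blast
  qed
  then obtain d' where d': "\<not> xS dvd d'" "\<And>u. u \<in> K \<Longrightarrow> d' \<bullet> d \<bullet> u \<in> L" by blast
  have "(d' * d) \<bullet> u \<in> L" if u: "u \<in> K" for u
    using d'(2)[OF u] u insert.prems(3) by (simp add: act_mult subsetD)
  then show ?case using xS_prime[OF d'(1) d(1)] by blast
qed

end

context fps2_module
begin

definition spans :: "'m set \<Rightarrow> bool" where
  "spans E \<longleftrightarrow> finite E \<and> E \<subseteq> carrier M \<and> (\<forall>m\<in>carrier M. \<exists>s. m = lin s E)"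

text \<open>
  A relation with a unit coefficient would allow one to omit a generator.
\<close>

lemma minimal_generators_relation:
  assumes E: "spans E" and min: "\<And>E'. spans E' \<Longrightarrow> card E \<le> card E'"
    and eq: "lin s E = lin t E" and t: "\<And>e. e \<in> E \<Longrightarrow> coeff2 (t e) 0 0 = 0"
    and e: "e \<in> E"
  shows "coeff2 (s e) 0 0 = 0"
proof (rule ccontr)
  assume *: "coeff2 (s e) 0 0 \<noteq> 0"
  have fin: "finite E" and car: "E \<subseteq> carrier M" using E by (auto simp: spans_def)
  define d where "d e' = s e' - t e'" for e'
  have "d e dvd 1" using * t[OF e] by (simp add: d_def fps2_unit_iff)
  then obtain w where w: "1 = d e * w" by (rule dvdE)
  have d0: "lin d E = \<zero>"
    unfolding d_def using fin car eq by (simp add: lin_diff minus_eq r_neg)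
  have "\<exists>r'. m = lin r' (E - {e})" if m: "m \<in> carrier M" for m
  proof -
    obtain r where r: "m = lin r E" using E m by (auto simp: spans_def)
    define r' where "r' e' = r e' - r e * w * d e'" for e'
    have "lin r' E = m"
      unfolding r'_def using fin car d0 m by (simp add: lin_diff lin_act minus_eq r flip: r)
    moreover have "r' e = 0" using w by (simp add: r'_def mult_ac)
    moreover have "e \<in> carrier M" "lin r' (E - {e}) \<in> carrier M" using car e by (auto intro!: lin_closed)
    ultimately have "m = lin r' (E - {e})" using lin_remove[OF fin car e, of r'] by simp
    then show ?thesis by blast
  qed
  then have "spans (E - {e})" using fin car by (auto simp: spans_def)
  from min[OF this] show False using fin e by (metis card_Diff1_less not_less)
qed

text \<open>
  Minimal generators are linearly independent modulo \<open>(x, y)\<close>. Regularity of \<open>y\<close> modulo \<open>x\<close> lifts this to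
  independence modulo \<open>x\<close>: cancel the lowest power of \<open>y\<close> among the coefficients taken modulo \<open>x\<close>. Regularity of \<open>x\<close>
  then lets one divide the coefficients of a relation by \<open>x\<close> indefinitely.
\<close>

theorem regular_pair_basis:
  assumes X: "\<And>m. m \<in> carrier M \<Longrightarrow> xS \<bullet> m = \<zero> \<Longrightarrow> m = \<zero>"
    and Y: "\<And>m. m \<in> carrier M \<Longrightarrow> yS \<bullet> m \<in> act_image xS \<Longrightarrow> m \<in> act_image xS"
    and E: "spans E" and min: "\<And>E'. spans E' \<Longrightarrow> card E \<le> card E'"
    and zero: "lin s E = \<zero>" and e: "e \<in> E"
  shows "s e = 0"
proof -
  have fin: "finite E" and car: "E \<subseteq> carrier M" using E by (auto simp: spans_def)
  have image_eq: "\<exists>t. m = lin (\<lambda>e. xS * t e) E" if "m \<in> act_image xS" for m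
  proof -
    obtain n where n: "n \<in> carrier M" "m = xS \<bullet> n" using \<open>m \<in> act_image xS\<close> by (auto simp: act_image_def)
    then obtain t where "n = lin t E" using E by (auto simp: spans_def)
    then have "m = lin (\<lambda>e. xS * t e) E" using n(2) fin car by (simp add: lin_act)
    then show ?thesis by blast
  qed
  have coeffs: "coeff2 (r e) 0 0 = 0" if r: "lin r E \<in> act_image xS" and "e \<in> E" for r e
  proof -
    obtain t where "lin r E = lin (\<lambda>e. xS * t e) E" using image_eq[OF r] by blast
    then show ?thesis using minimal_generators_relation[OF E min] \<open>e \<in> E\<close> by simp
  qed
  have Yn: "m \<in> act_image xS" if "m \<in> carrier M" "yS ^ n \<bullet> m \<in> act_image xS" for m n
    using that
  proof (induction n arbitrary: m)
    case (Suc n)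
    then have "yS ^ n \<bullet> yS \<bullet> m \<in> act_image xS" by (simp only: power_Suc2 act_mult)
    then have "yS \<bullet> m \<in> act_image xS" using Suc.IH[of "yS \<bullet> m"] Suc.prems(1) by simp
    then show ?case using Y Suc.prems(1) by blast
  qed simp
  have divisible: "xS dvd r e" if r: "lin r E \<in> act_image xS" and e: "e \<in> E" for r e
  proof (rule ccontr)
    assume not: "\<not> xS dvd r e"
    let ?P = "\<lambda>j. \<exists>e\<in>E. coeff2 (r e) 0 j \<noteq> 0"
    define N where "N = (LEAST j. ?P j)"
    have "\<exists>j. ?P j" using not e by (auto simp: xS_dvd_iff)
    then have "?P N" unfolding N_def by (rule LeastI_ex)
    then obtain e0 where e0: "e0 \<in> E" "coeff2 (r e0) 0 N \<noteq> 0" by blast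
    have low: "coeff2 (r e) 0 j = 0" if "j < N" "e \<in> E" for j e
      using not_less_Least[OF that(1)[unfolded N_def]] that(2) by blast
    have "\<forall>e. \<exists>p v. e \<in> E \<longrightarrow> r e = xS * p + yS ^ N * v \<and> coeff2 v 0 0 = coeff2 (r e) 0 N"
    proof
      fix e
      show "\<exists>p v. e \<in> E \<longrightarrow> r e = xS * p + yS ^ N * v \<and> coeff2 v 0 0 = coeff2 (r e) 0 N"
      proof (cases "e \<in> E")
        case True
        obtain p v where "r e = xS * p + yS ^ N * v" "coeff2 v 0 0 = coeff2 (r e) 0 N"
          using fps2_mod_xS_truncate[of N "r e"] low[OF _ True] by blast
        then show ?thesis by blast
      qed blast
    qed
    then obtain p v where pv: "\<And>e. e \<in> E \<Longrightarrow> r e = xS * p e + yS ^ N * v e"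
      "\<And>e. e \<in> E \<Longrightarrow> coeff2 (v e) 0 0 = coeff2 (r e) 0 N" by metis
    have "lin r E = lin (\<lambda>e. xS * p e + yS ^ N * v e) E" using car pv(1) by (rule lin_cong)
    also have "\<dots> = xS \<bullet> lin p E \<oplus> yS ^ N \<bullet> lin v E" using fin car by (simp add: lin_add lin_act)
    finally have "yS ^ N \<bullet> lin v E = lin r E \<ominus> xS \<bullet> lin p E"
      using car by (simp add: add_minus_cancel)
    moreover have "xS \<bullet> lin p E \<in> act_image xS" using car by (auto simp: act_image_def)
    ultimately have "yS ^ N \<bullet> lin v E \<in> act_image xS"
      using act_submoduleD(5)[OF act_submodule_image r] by simp
    then have "lin v E \<in> act_image xS" using Yn[of "lin v E" N] car by simp
    then have "coeff2 (v e0) 0 0 = 0" using coeffs e0(1) by blast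
    then show False using e0 pv(2) by simp
  qed
  have "xS ^ n dvd r e" if "lin r E = \<zero>" "e \<in> E" for n r e
    using that
  proof (induction n arbitrary: r e)
    case (Suc n)
    have "\<zero> \<in> act_image xS" using act_submoduleD(2)[OF act_submodule_image] .
    then have "\<forall>e. \<exists>p. e \<in> E \<longrightarrow> r e = xS * p" using divisible[of r] Suc.prems(1) by (metis dvdE)
    then obtain p where p: "\<And>e. e \<in> E \<Longrightarrow> r e = xS * p e" by metis
    have "xS \<bullet> lin p E = lin (\<lambda>e. xS * p e) E" using fin car by (simp add: lin_act)
    also have "\<dots> = lin r E" by (rule lin_cong[OF car]) (simp add: p)
    finally have "lin p E = \<zero>" using X[of "lin p E"] Suc.prems(1) car by simp
    then have "xS ^ n dvd p e" using Suc.IH Suc.prems(2) by blast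
    then show ?case unfolding p[OF Suc.prems(2)] power_Suc by (rule mult_dvd_mono[OF dvd_refl])
  qed simp
  then have "\<forall>n. xS ^ n dvd s e" using zero e by blast
  then show ?thesis using adic_complete_xS unfolding adic_complete_def by blast
qed

end

lemma e7_max_decomp:
  assumes "b \<in> (e7_max :: 'k::field e7 set)"
  obtains u v c where "b = u * cS xS + v * cS yS + c * zR"
proof -
  have "coeff2 (cpart b) 0 0 = 0" using assms by (simp add: e7_max_def)
  then obtain A B where AB: "cpart b = xS * A + yS * B" using fps2_linear_decomp by metis
  have "b = cS A * cS xS + cS B * cS yS + cS (zpart b) * zR"
    by (simp add: e7_eq_iff e7_defs AB)
  then show ?thesis using that by blast
qed

lemma zR_square_factor: "zR * zR = (- cS (xS\<^sup>2 + yS ^ 3)) * cS xS"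
  by (simp add: e7_defs algebra_simps power2_eq_square power3_eq_cube)

locale e7_module = type_module M act
  for M :: "('m, 'e) ring_scheme" (structure) and act :: "'k::field e7 \<Rightarrow> 'm \<Rightarrow> 'm" (infixr "\<bullet>" 75)
begin

sublocale S: fps2_module M "\<lambda>s. act (cS s)"
  unfolding fps2_module_def by (rule restrict_scalars[OF ring_map_cS])

text \<open>
  If \<open>M / N\<close> has no nonzero element annihilated by the maximal ideal, then it has none annihilated by \<open>x\<close> and \<open>y\<close>: since
  \<open>z\<^sup>2\<close> is a multiple of \<open>x\<close>, the maximal ideal kills \<open>z \<bullet> w\<close>, and then \<open>w\<close>.
\<close>

lemma socle_free_imp_xy_torsion_free:
  assumes N: "act_submodule N"
    and H: "\<And>w. w \<in> carrier M \<Longrightarrow> (\<And>b. b \<in> e7_max \<Longrightarrow> b \<bullet> w \<in> N) \<Longrightarrow> w \<in> N"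
    and w: "w \<in> carrier M" "cS xS \<bullet> w \<in> N" "cS yS \<bullet> w \<in> N"
  shows "w \<in> N"
proof -
  note ND = act_submoduleD[OF N]
  have zw: "zR \<bullet> w \<in> N"
  proof (rule H)
    show "zR \<bullet> w \<in> carrier M" using w(1) by simp
    fix b :: "'k e7" assume "b \<in> e7_max"
    then obtain u v c where b: "b = u * cS xS + v * cS yS + c * zR" by (rule e7_max_decomp)
    have "b * zR = (u * zR) * cS xS + (v * zR) * cS yS + c * (zR * zR)"
      by (simp add: b algebra_simps)
    also have "\<dots> = (u * zR + c * (- cS (xS\<^sup>2 + yS ^ 3))) * cS xS + (v * zR) * cS yS"
      unfolding zR_square_factor by (simp only: algebra_simps)
    finally obtain p q where "b * zR = p * cS xS + q * cS yS" by blast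
    then have "b \<bullet> zR \<bullet> w = p \<bullet> cS xS \<bullet> w \<oplus> q \<bullet> cS yS \<bullet> w"
      using w(1) by (simp add: act_add act_mult flip: act_mult[of w b])
    then show "b \<bullet> zR \<bullet> w \<in> N" using ND(3)[OF ND(4)[OF w(2)] ND(4)[OF w(3)]] by simp
  qed
  show ?thesis
  proof (rule H[OF w(1)])
    fix b :: "'k e7" assume "b \<in> e7_max"
    then obtain u v c where b: "b = u * cS xS + v * cS yS + c * zR" by (rule e7_max_decomp)
    have "b \<bullet> w = u \<bullet> cS xS \<bullet> w \<oplus> v \<bullet> cS yS \<bullet> w \<oplus> c \<bullet> zR \<bullet> w"
      unfolding b using w(1) by (simp add: act_add act_mult)
    then show "b \<bullet> w \<in> N"
      using ND(3)[OF ND(3)[OF ND(4)[OF w(2)] ND(4)[OF w(3)]] ND(4)[OF zw]] by simp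
  qed
qed

end

text \<open>
  \<open>M\<close> is finitely generated and \<open>a, b\<close> is an arbitrary regular sequence on it. In what follows \<open>x, y\<close> is shown to be
  regular as well; the crux is that the elements killed by \<open>x\<close> vanish.
\<close>

locale e7_depth_two = e7_module M act
  for M :: "('m, 'e) ring_scheme" (structure) and act :: "'k::field e7 \<Rightarrow> 'm \<Rightarrow> 'm" (infixr "\<bullet>" 75) +
  fixes a b :: "'k e7" and G
  assumes ab_max: "a \<in> e7_max" "b \<in> e7_max"
    and regular1: "\<And>m. m \<in> carrier M \<Longrightarrow> a \<bullet> m = \<zero> \<Longrightarrow> m = \<zero>"
    and regular2: "\<And>m. m \<in> carrier M \<Longrightarrow> b \<bullet> m \<in> act_image a \<Longrightarrow> m \<in> act_image a"
    and generators: "S.spans G"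
begin

lemma y_torsion_free_on_x_torsion:
  assumes "u \<in> carrier M" "cS xS \<bullet> u = \<zero>" "cS (yS ^ n) \<bullet> u = \<zero>"
  shows "u = \<zero>"
  using assms
proof (induction n arbitrary: u)
  case 0
  then show ?case by (simp flip: one_e7_def)
next
  case (Suc n)
  have "cS (yS ^ n) \<bullet> cS yS \<bullet> u = \<zero>"
    using Suc.prems(1,3) by (simp only: power_Suc2 S.act_mult)
  moreover have "cS xS \<bullet> cS yS \<bullet> u = \<zero>"
    using Suc.prems(1,2) by (simp add: act_commute[of u "cS xS"])
  ultimately have y: "cS yS \<bullet> u = \<zero>" using Suc.IH[of "cS yS \<bullet> u"] Suc.prems(1) by simp
  have "u \<in> {\<zero>}"
  proof (rule socle_free_imp_xy_torsion_free[OF act_submodule_0])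
    fix w assume "w \<in> carrier M" "\<And>b. b \<in> e7_max \<Longrightarrow> b \<bullet> w \<in> {\<zero>}"
    then show "w \<in> {\<zero>}" using regular1 ab_max(1) by blast
  qed (use Suc.prems y in auto)
  then show ?case by simp
qed

lemma y_power_image_a:
  assumes "u \<in> carrier M" "cS xS \<bullet> u = \<zero>" "cS (yS ^ n) \<bullet> u \<in> act_image a"
  shows "u \<in> act_image a"
  using assms
proof (induction n arbitrary: u)
  case 0
  then show ?case by (simp flip: one_e7_def)
next
  case (Suc n)
  have "cS (yS ^ n) \<bullet> cS yS \<bullet> u \<in> act_image a"
    using Suc.prems(1,3) by (simp only: power_Suc2 S.act_mult)
  moreover have "cS xS \<bullet> cS yS \<bullet> u = \<zero>"
    using Suc.prems(1,2) by (simp add: act_commute[of u "cS xS"])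
  ultimately have y: "cS yS \<bullet> u \<in> act_image a" using Suc.IH[of "cS yS \<bullet> u"] Suc.prems(1) by simp
  show ?case
  proof (rule socle_free_imp_xy_torsion_free[OF act_submodule_image])
    fix w assume "w \<in> carrier M" "\<And>b. b \<in> e7_max \<Longrightarrow> b \<bullet> w \<in> act_image a"
    then show "w \<in> act_image a" using regular2 ab_max(2) by blast
  qed (use Suc.prems y act_submoduleD(2)[OF act_submodule_image] in auto)
qed

lemma x_torsion_act:
  assumes "u \<in> carrier M" "cS xS \<bullet> u = \<zero>"
  shows "cS (xS * p + yS ^ n * v) \<bullet> u = cS (v * yS ^ n) \<bullet> u"
  using assms by (simp add: S.act_add S.act_mult act_commute[of u "cS xS"] mult.commute[of v])

text \<open>
  On elements killed by \<open>x\<close> a scalar of \<open>k\<lbrakk>x, y\<rbrakk>\<close> outside \<open>(x)\<close> acts as a power of \<open>y\<close> times a unit.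
\<close>

lemma unit_part:
  assumes "u \<in> carrier M" "cS xS \<bullet> u = \<zero>" "\<not> xS dvd s"
  obtains n w where "cS (yS ^ n) \<bullet> u = cS w \<bullet> cS s \<bullet> u"
proof -
  obtain p n v where s: "s = xS * p + yS ^ n * v" "v dvd 1" using fps2_mod_xS[OF assms(3)] by metis
  from s(2) obtain w where w: "1 = v * w" by (rule dvdE)
  have "cS s \<bullet> u = cS (v * yS ^ n) \<bullet> u" unfolding s(1) by (rule x_torsion_act[OF assms(1,2)])
  then have "cS w \<bullet> cS s \<bullet> u = cS (w * (v * yS ^ n)) \<bullet> u" using assms(1) by (simp add: S.act_mult)
  also have "w * (v * yS ^ n) = (v * w) * yS ^ n" by (simp only: mult_ac)
  finally have "cS w \<bullet> cS s \<bullet> u = cS (yS ^ n) \<bullet> u" by (simp only: w[symmetric] mult_1)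
  then show ?thesis using that by metis
qed

text \<open>
  Up to a unit of \<open>k\<lbrakk>x, y\<rbrakk>\<close>, the norm of \<open>a\<close> acts on the \<open>x\<close>-torsion as a power of \<open>y\<close> or as zero. In the first case
  \<open>y ^ n \<bullet> u = a \<bullet> u''\<close> for some \<open>u''\<close>. In the second, \<open>a\<close> being regular, the conjugate of \<open>a\<close> kills \<open>u\<close>, so \<open>a\<close> acts as its trace
  and the same alternative applies to the trace. In either case the powers of \<open>y\<close> cancel modulo \<open>a\<close>.
\<close>

lemma x_torsion_a_divisible:
  assumes u: "u \<in> carrier M" "cS xS \<bullet> u = \<zero>"
  obtains u' where "u' \<in> carrier M" "cS xS \<bullet> u' = \<zero>" "u = a \<bullet> u'"
proof -
  have "u \<in> act_image a"
  proof (cases "xS dvd e7_norm a")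
    case False
    then obtain n w where n: "cS (yS ^ n) \<bullet> u = cS w \<bullet> cS (e7_norm a) \<bullet> u" using unit_part[OF u] by metis
    have "cS w \<bullet> cS (e7_norm a) \<bullet> u = a \<bullet> cS w \<bullet> e7_conj a \<bullet> u"
      using u(1) by (simp add: act_commute[of _ "cS w"] act_mult flip: mult_e7_conj)
    then have "cS (yS ^ n) \<bullet> u \<in> act_image a" using n u(1) by (auto simp: act_image_def)
    then show ?thesis by (rule y_power_image_a[OF u])
  next
    case True
    then obtain p where "e7_norm a = xS * p" by (rule dvdE)
    then have "cS (e7_norm a) \<bullet> u = \<zero>" using u by (simp add: S.act_mult act_commute[of u "cS xS"])
    then have "a \<bullet> e7_conj a \<bullet> u = \<zero>" using u(1) by (simp add: act_mult flip: mult_e7_conj)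
    then have "e7_conj a \<bullet> u = \<zero>" using regular1[of "e7_conj a \<bullet> u"] u(1) by simp
    then have tr: "cS (2 * cpart a) \<bullet> u = a \<bullet> u" using u(1) by (simp add: act_add flip: add_e7_conj)
    show ?thesis
    proof (cases "xS dvd 2 * cpart a")
      case False
      then obtain n w where "cS (yS ^ n) \<bullet> u = cS w \<bullet> cS (2 * cpart a) \<bullet> u" using unit_part[OF u] by metis
      then have "cS (yS ^ n) \<bullet> u = a \<bullet> cS w \<bullet> u" unfolding tr using u(1) by (simp add: act_commute[of u a])
      then have "cS (yS ^ n) \<bullet> u \<in> act_image a" using u(1) by (auto simp: act_image_def)
      then show ?thesis by (rule y_power_image_a[OF u])
    next
      case True
      then obtain p where "2 * cpart a = xS * p" by (rule dvdE)
      then have "a \<bullet> u = \<zero>" using u by (simp add: S.act_mult act_commute[of u "cS xS"] flip: tr)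
      then have "u = \<zero>" using regular1 u(1) by blast
      then show ?thesis using act_submoduleD(2)[OF act_submodule_image] by simp
    qed
  qed
  then obtain u' where u': "u' \<in> carrier M" "u = a \<bullet> u'" by (auto simp: act_image_def)
  have "a \<bullet> cS xS \<bullet> u' = \<zero>" using u(2) u' by (simp add: act_commute[of u' a])
  then have "cS xS \<bullet> u' = \<zero>" using regular1[of "cS xS \<bullet> u'"] u'(1) by simp
  then show ?thesis using that u' by blast
qed

text \<open>
  Divide by \<open>a\<close> twice and use \<open>a\<^sup>2 = tr a * a - norm a\<close>, where trace and norm lie in \<open>(x, y)\<close>.
\<close>

lemma x_torsion_y_divisible:
  assumes u: "u \<in> carrier M" "cS xS \<bullet> u = \<zero>"
  obtains u' where "u' \<in> carrier M" "cS xS \<bullet> u' = \<zero>" "u = cS yS \<bullet> u'"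
proof -
  obtain u1 where u1: "u1 \<in> carrier M" "cS xS \<bullet> u1 = \<zero>" "u = a \<bullet> u1"
    using x_torsion_a_divisible[OF u] .
  obtain u2 where u2: "u2 \<in> carrier M" "cS xS \<bullet> u2 = \<zero>" "u1 = a \<bullet> u2"
    using x_torsion_a_divisible[OF u1(1,2)] .
  have a0: "coeff2 (cpart a) 0 0 = 0" using ab_max(1) by (simp add: e7_max_def)
  have "coeff2 (2 * cpart a) 0 0 = 0" using a0 by simp
  then obtain t1 t2 where t: "2 * cpart a = xS * t1 + yS * t2" using fps2_linear_decomp by metis
  have "coeff2 (e7_norm a) 0 0 = 0" using a0 by (simp add: e7_norm_def power2_eq_square)
  then obtain n1 n2 where n: "e7_norm a = xS * n1 + yS * n2" using fps2_linear_decomp by metis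
  have "a * a = a * (a + e7_conj a) - a * e7_conj a" by (simp add: distrib_left)
  also have "\<dots> = a * cS (xS * t1 + yS * t2) - cS (xS * n1 + yS * n2)"
    unfolding add_e7_conj mult_e7_conj t n ..
  also have "\<dots> = cS yS * (cS t2 * a - cS n2) + (a * cS t1 - cS n1) * cS xS"
    unfolding cS_simps by (simp only: algebra_simps)
  finally have aa: "a * a = \<dots>" .
  define u' where "u' = (cS t2 * a - cS n2) \<bullet> u2"
  have u'M: "u' \<in> carrier M" using u2(1) by (simp add: u'_def)
  have "u = (a * a) \<bullet> u2" using u1(3) u2(1,3) by (simp add: act_mult)
  also have "\<dots> = cS yS \<bullet> u' \<oplus> (a * cS t1 - cS n1) \<bullet> cS xS \<bullet> u2"
    unfolding aa u'_def using u2(1) by (simp only: act_add act_mult act_closed)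
  also have "\<dots> = cS yS \<bullet> u'" using u2(2) u'M by simp
  finally have "u = cS yS \<bullet> u'" .
  moreover have "cS xS \<bullet> u' = \<zero>"
    unfolding u'_def using u2(1,2) by (simp add: act_commute[of u2 "cS xS"])
  ultimately show ?thesis using that u'M by blast
qed

text \<open>
  The \<open>x\<close>-torsion is \<open>y\<close>-divisible, hence killed by some \<open>d\<close> outside \<open>(x)\<close>, that is, by a power of \<open>y\<close>. But it has no
  \<open>y\<close>-torsion.
\<close>

lemma x_regular:
  assumes "u \<in> carrier M" "cS xS \<bullet> u = \<zero>"
  shows "u = \<zero>"
proof -
  define K where "K = {u \<in> carrier M. cS xS \<bullet> u = \<zero>}"
  have "\<exists>d. \<not> xS dvd d \<and> (\<forall>u\<in>K. cS d \<bullet> u \<in> {\<zero>})"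
  proof (rule S.divisible_finitely_generated[of G])
    show "finite G" "G \<subseteq> carrier M" using generators by (auto simp: S.spans_def)
    show "S.act_submodule {\<zero>}" by (rule S.act_submodule_0)
    show "K \<subseteq> carrier M" by (auto simp: K_def)
    fix u assume u: "u \<in> K"
    then have uM: "u \<in> carrier M" by (simp add: K_def)
    then obtain s where "u = S.lin s G" using generators by (auto simp: S.spans_def)
    then have "u = S.lin s G \<oplus> \<zero>" using uM by simp
    then show "\<exists>s l. l \<in> {\<zero>} \<and> u = S.lin s G \<oplus> l" by blast
    obtain u' where "u' \<in> carrier M" "cS xS \<bullet> u' = \<zero>" "u = cS yS \<bullet> u'"
      using x_torsion_y_divisible u by (auto simp: K_def)
    then show "\<exists>u'\<in>K. \<exists>l\<in>{\<zero>}. u = cS yS \<bullet> u' \<oplus> l" by (intro bexI[of _ u'] bexI[of _ \<zero>]) (auto simp: K_def)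
  qed
  then obtain d where d: "\<not> xS dvd d" "cS d \<bullet> u = \<zero>" using assms by (auto simp: K_def)
  obtain n w where "cS (yS ^ n) \<bullet> u = cS w \<bullet> cS d \<bullet> u" using unit_part[OF assms d(1)] .
  then have "cS (yS ^ n) \<bullet> u = \<zero>" by (simp add: d(2))
  then show ?thesis by (rule y_torsion_free_on_x_torsion[OF assms])
qed

text \<open>
  Here \<open>M / x M\<close> must have no socle. If \<open>a \<bullet> w = x \<bullet> u1\<close> and \<open>b \<bullet> w = x \<bullet> u2\<close>, then \<open>b \<bullet> u1 = a \<bullet> u2\<close>, so \<open>u1 = a \<bullet> v\<close> by
  regularity of \<open>a, b\<close>, and \<open>w = x \<bullet> v\<close>.
\<close>

lemma y_regular:
  assumes "m \<in> carrier M" "cS yS \<bullet> m \<in> act_image (cS xS)"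
  shows "m \<in> act_image (cS xS)"
proof (rule socle_free_imp_xy_torsion_free[OF act_submodule_image])
  fix w assume w: "w \<in> carrier M" and H: "\<And>b. b \<in> e7_max \<Longrightarrow> b \<bullet> w \<in> act_image (cS xS)"
  obtain u1 where u1: "u1 \<in> carrier M" "a \<bullet> w = cS xS \<bullet> u1" using H[OF ab_max(1)] by (auto simp: act_image_def)
  obtain u2 where u2: "u2 \<in> carrier M" "b \<bullet> w = cS xS \<bullet> u2" using H[OF ab_max(2)] by (auto simp: act_image_def)
  have "cS xS \<bullet> b \<bullet> u1 = b \<bullet> a \<bullet> w" using u1 by (simp add: act_commute[of u1 b])
  also have "\<dots> = a \<bullet> b \<bullet> w" using w by (rule act_commute)
  also have "\<dots> = cS xS \<bullet> a \<bullet> u2" using u2 by (simp add: act_commute[of u2 a])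
  finally have "b \<bullet> u1 = a \<bullet> u2"
    using act_cancel[of "cS xS"] x_regular u1(1) u2(1) by (meson act_closed)
  then have "b \<bullet> u1 \<in> act_image a" using u2(1) by (auto simp: act_image_def)
  then have "u1 \<in> act_image a" by (rule regular2[OF u1(1)])
  then obtain v where v: "v \<in> carrier M" "u1 = a \<bullet> v" by (auto simp: act_image_def)
  have "a \<bullet> w = a \<bullet> cS xS \<bullet> v" using u1(2) v by (simp add: act_commute[of v a])
  then have "w = cS xS \<bullet> v" using act_cancel[of a] regular1 w v(1) by (meson act_closed)
  then show "w \<in> act_image (cS xS)" using v(1) by (auto simp: act_image_def)
qed (use assms in \<open>auto simp: act_image_def\<close>)

text \<open>
  \<open>T\<close> contains all values of \<open>R\<close>-linear functionals on \<open>M\<close>. The functional attached to a basis vector \<open>e\<close> is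
  \<open>m \<mapsto> \<lambda> (z m) + z * \<lambda> m\<close>, with \<open>\<lambda>\<close> the coordinate at \<open>e\<close>; it is linear because \<open>z\<^sup>2 = - g\<close>.
\<close>

theorem linear_functionals_detect:
  assumes two: "(2 :: 'k) \<noteq> 0" and nonzero: "carrier M \<noteq> {\<zero>}" and T: "ideal_set T"
    and trace: "\<And>f m. (\<And>m n. m \<in> carrier M \<Longrightarrow> n \<in> carrier M \<Longrightarrow> f (m \<oplus> n) = f m + f n) \<Longrightarrow>
      (\<And>u m. m \<in> carrier M \<Longrightarrow> f (u \<bullet> m) = u * f m) \<Longrightarrow> m \<in> carrier M \<Longrightarrow> f m \<in> T"
  shows "cS xS \<in> T" "cS (yS ^ 3) \<in> T" "zR \<in> T"
proof -
  define n where "n = (LEAST n. \<exists>E. S.spans E \<and> card E = n)"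
  have "\<exists>E. S.spans E \<and> card E = n"
    unfolding n_def by (rule LeastI_ex) (use generators in blast)
  then obtain E where E: "S.spans E" "card E = n" by blast
  have min: "card E \<le> card E'" if "S.spans E'" for E'
    unfolding E(2) n_def using that by (intro Least_le) blast
  have fin: "finite E" and car: "E \<subseteq> carrier M" using E(1) by (auto simp: S.spans_def)
  have S_image: "S.act_image s = act_image (cS s)" for s by (simp add: S.act_image_def act_image_def)
  have indep: "s e = 0" if "S.lin s E = \<zero>" "e \<in> E" for s e
    using S.regular_pair_basis[OF _ _ E(1) min that] x_regular y_regular unfolding S_image by blast
  have inj: "s e = t e" if "S.lin s E = S.lin t E" "e \<in> E" for s t e
  proof -
    have "S.lin (\<lambda>e. s e - t e) E = \<zero>" using fin car that(1) by (simp add: S.lin_diff minus_eq r_neg)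
    from indep[OF this that(2)] show ?thesis by simp
  qed
  have "\<forall>m. \<exists>s. m \<in> carrier M \<longrightarrow> m = S.lin s E" using E(1) by (auto simp: S.spans_def)
  then obtain coord where coord: "\<And>m. m \<in> carrier M \<Longrightarrow> S.lin (coord m) E = m" by metis
  have coord_eq: "coord m e = s e" if "S.lin s E = m" "e \<in> E" for m s e
    by (rule inj) (use coord[of m] that car in auto)
  have coord_add: "coord (m \<oplus> m') e = coord m e + coord m' e"
    if "m \<in> carrier M" "m' \<in> carrier M" "e \<in> E" for m m' e
    by (rule coord_eq[OF _ that(3), of "\<lambda>e. coord m e + coord m' e"])
      (use that car coord in \<open>simp add: S.lin_add\<close>)
  have coord_act: "coord (cS s \<bullet> m) e = s * coord m e" if "m \<in> carrier M" "e \<in> E" for s m e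
    by (rule coord_eq[OF _ that(2), of "\<lambda>e. s * coord m e"])
      (use that fin car coord in \<open>simp add: S.lin_act\<close>)
  have coord_basis: "coord e' e = (if e = e' then 1 else 0)" if "e \<in> E" "e' \<in> E" for e e'
    by (rule coord_eq[OF _ that(1), of "\<lambda>e. if e = e' then 1 else 0"]) (use S.lin_single[OF fin car that(2)] in simp)
  have zz: "zR \<bullet> zR \<bullet> m = cS (- gS) \<bullet> m" if "m \<in> carrier M" for m
    using that by (simp only: act_mult[symmetric] zR_square cS_simps(5))
  define f where "f e m = E7 (coord (zR \<bullet> m) e) (coord m e)" for e m
  have f_add: "f e (m \<oplus> m') = f e m + f e m'" if "e \<in> E" "m \<in> carrier M" "m' \<in> carrier M" for e m m'
    using that by (simp add: f_def act_r_add coord_add plus_e7_def)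
  have f_act: "f e (u \<bullet> m) = u * f e m" if e: "e \<in> E" and m: "m \<in> carrier M" for e u m
  proof -
    have s: "f e (cS s \<bullet> m) = cS s * f e m" if "m \<in> carrier M" for s m
      using that e by (simp add: f_def act_commute[of m zR] coord_act times_e7_def)
    have z: "f e (zR \<bullet> m) = zR * f e m"
      by (simp only: f_def zz[OF m] coord_act[OF m e] times_e7_def e7.sel
          mult_zero_left mult_1 diff_0 add_0 mult_minus_left)
    have "u \<bullet> m = cS (cpart u) \<bullet> m \<oplus> cS (zpart u) \<bullet> zR \<bullet> m"
    proof -
      have "u = cS (cpart u) + cS (zpart u) * zR" by (simp add: e7_defs)
      then have "u \<bullet> m = (cS (cpart u) + cS (zpart u) * zR) \<bullet> m" by simp
      then show ?thesis using m by (simp add: act_add act_mult)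
    qed
    then have "f e (u \<bullet> m) = cS (cpart u) * f e m + cS (zpart u) * (zR * f e m)"
      using e m by (simp add: f_add s z)
    also have "\<dots> = (cS (cpart u) + cS (zpart u) * zR) * f e m" by (simp only: distrib_right mult.assoc)
    also have "cS (cpart u) + cS (zpart u) * zR = u" by (simp add: e7_defs)
    finally show ?thesis .
  qed
  define \<phi> where "\<phi> i j = coord (zR \<bullet> j) i" for i j
  have sq: "(\<Sum>l\<in>E. \<phi> i l * \<phi> l j) = (if i = j then - gS else 0)" if i: "i \<in> E" and j: "j \<in> E" for i j
  proof -
    have jM: "j \<in> carrier M" using j car by blast
    have summand: "zR \<bullet> cS (\<phi> l j) \<bullet> l = S.lin (\<lambda>i. \<phi> i l * \<phi> l j) E" if l: "l \<in> E" for l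
    proof -
      have lM: "l \<in> carrier M" using l car by blast
      have "zR \<bullet> cS (\<phi> l j) \<bullet> l = cS (\<phi> l j) \<bullet> zR \<bullet> l" using lM by (rule act_commute)
      also have "\<dots> = cS (\<phi> l j) \<bullet> S.lin (coord (zR \<bullet> l)) E" using lM by (simp add: coord)
      also have "\<dots> = S.lin (\<lambda>i. \<phi> l j * coord (zR \<bullet> l) i) E" by (rule S.lin_act[OF fin car, symmetric])
      finally show ?thesis by (simp add: \<phi>_def mult.commute)
    qed
    have zsum: "zR \<bullet> (\<Oplus>l\<in>F. g l) = (\<Oplus>l\<in>F. zR \<bullet> g l)"
      if "finite F" "\<And>l. l \<in> F \<Longrightarrow> g l \<in> carrier M" for F and g :: "'m \<Rightarrow> 'm"
      using that
    proof (induction F rule: finite_induct)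
      case (insert l F)
      have "(\<Oplus>l\<in>insert l F. g l) = g l \<oplus> (\<Oplus>l\<in>F. g l)"
        "(\<Oplus>l\<in>insert l F. zR \<bullet> g l) = zR \<bullet> g l \<oplus> (\<Oplus>l\<in>F. zR \<bullet> g l)"
        using insert by (auto intro!: finsum_insert)
      moreover have "(\<Oplus>l\<in>F. g l) \<in> carrier M" using insert by (auto intro!: finsum_closed)
      ultimately show ?case using insert by (simp add: act_r_add)
    qed simp
    have "zR \<bullet> zR \<bullet> j = zR \<bullet> S.lin (\<lambda>l. \<phi> l j) E"
      using coord[of "zR \<bullet> j"] jM by (simp add: \<phi>_def)
    also have "\<dots> = (\<Oplus>l\<in>E. zR \<bullet> cS (\<phi> l j) \<bullet> l)"
      unfolding S.lin_def by (rule zsum[OF fin]) (use car in auto)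
    also have "\<dots> = S.lin (\<lambda>i. \<Sum>l\<in>E. \<phi> i l * \<phi> l j) E"
      by (rule S.finsum_lin[OF fin car]) (rule summand)
    finally have "coord (zR \<bullet> zR \<bullet> j) i = (\<Sum>l\<in>E. \<phi> i l * \<phi> l j)"
      by (intro coord_eq[OF _ i]) simp
    moreover have "coord (zR \<bullet> zR \<bullet> j) i = - gS * coord j i"
      unfolding zz[OF jM] by (rule coord_act[OF jM i])
    ultimately have "(\<Sum>l\<in>E. \<phi> i l * \<phi> l j) = - gS * (if i = j then 1 else 0)"
      by (simp only: coord_basis[OF i j])
    then show ?thesis by (cases "i = j") simp_all
  qed
  have nonempty: "E \<noteq> {}"
  proof
    assume "E = {}"
    then have "carrier M \<subseteq> {\<zero>}" using coord by force
    then show False using nonzero by auto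
  qed
  have mem: "E7 (\<phi> i j) (if i = j then 1 else 0) \<in> T" if "i \<in> E" "j \<in> E" for i j
  proof -
    have "f i j \<in> T" using trace[of "f i" j] f_add f_act that car by blast
    then show ?thesis using that by (simp add: f_def \<phi>_def coord_basis)
  qed
  show "cS xS \<in> T" "cS (yS ^ 3) \<in> T" "zR \<in> T"
    using matrix_factorization_trace[OF two fin nonempty sq T mem] by auto
qed

end

section \<open>Coordinates on the quotient ring\<close>

definition e7_proj :: "'k::field fps3 \<Rightarrow> 'k e7" where
  "e7_proj = (SOME \<pi>. ring_map \<pi> \<and> (\<forall>s. \<pi> (fps_const s) = cS s) \<and> \<pi> fps_X = zR \<and>
     (\<forall>p. \<pi> p = 0 \<longleftrightarrow> fps_X\<^sup>2 + fps_const gS dvd p))"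

lemma e7_proj:
  shows ring_map_e7_proj: "ring_map (e7_proj :: 'k::field fps3 \<Rightarrow> 'k e7)"
    and e7_proj_const: "e7_proj (fps_const s) = (cS s :: 'k e7)"
    and e7_proj_X: "e7_proj fps_X = (zR :: 'k e7)"
    and e7_proj_eq_0_iff: "(e7_proj p :: 'k e7) = 0 \<longleftrightarrow> fps_X\<^sup>2 + fps_const gS dvd p"
proof -
  have "\<exists>\<pi> :: 'k fps3 \<Rightarrow> 'k e7. ring_map \<pi> \<and> (\<forall>s. \<pi> (fps_const s) = cS s) \<and> \<pi> fps_X = zR \<and>
     (\<forall>p. \<pi> p = 0 \<longleftrightarrow> fps_X\<^sup>2 + fps_const gS dvd p)"
    by (rule e7_presentation) blast
  from someI_ex[OF this, folded e7_proj_def]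
  show "ring_map (e7_proj :: 'k fps3 \<Rightarrow> 'k e7)" "e7_proj (fps_const s) = (cS s :: 'k e7)"
    "e7_proj fps_X = (zR :: 'k e7)" "(e7_proj p :: 'k e7) = 0 \<longleftrightarrow> fps_X\<^sup>2 + fps_const gS dvd p" by blast+
qed

lemma type_ring_simps:
  "carrier (ring_of_type_algebra :: 'a::ring_1 ring) = UNIV"
  "x \<otimes>\<^bsub>ring_of_type_algebra\<^esub> y = x * (y :: 'a)" "x \<oplus>\<^bsub>ring_of_type_algebra\<^esub> y = x + y"
  "\<one>\<^bsub>ring_of_type_algebra\<^esub> = (1 :: 'a)" "\<zero>\<^bsub>ring_of_type_algebra\<^esub> = (0 :: 'a)"
  by (simp_all add: ring_of_type_algebra_def)

lemma E7_equation:
  "var_z ^ 2 + var_x ^ 3 + var_x * var_y ^ 3 = (fps_X\<^sup>2 + fps_const gS :: 'k::field fps3)"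
  unfolding var_x_def var_y_def var_z_def
  by (simp only: fps_const_power fps_const_mult fps_const_add add.assoc)

lemma E7_ideal_eq: "E7_ideal = {p :: 'k::field fps3. e7_proj p = 0}"
proof -
  interpret P: cring "ring_of_type_algebra :: 'k fps3 ring" ..
  have "E7_ideal = PIdl\<^bsub>ring_of_type_algebra\<^esub> (fps_X\<^sup>2 + fps_const gS :: 'k fps3)"
    unfolding E7_ideal_def E7_equation by (rule P.cgenideal_eq_genideal[symmetric]) (simp add: type_ring_simps)
  then show ?thesis
    by (auto simp: cgenideal_def type_ring_simps e7_proj_eq_0_iff dvd_def mult.commute)
qed

lemma E7_ideal_ideal: "ideal (E7_ideal :: 'k::field fps3 set) ring_of_type_algebra"
proof -
  interpret P: cring "ring_of_type_algebra :: 'k fps3 ring" ..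
  show ?thesis unfolding E7_ideal_def by (rule P.genideal_ideal) (simp add: type_ring_simps)
qed

lemma E7_class_eq: "E7_class p = {q :: 'k::field fps3. e7_proj q = e7_proj p}"
proof -
  have "q \<in> E7_class p \<longleftrightarrow> e7_proj q = e7_proj p" for q
  proof -
    have "q \<in> E7_class p \<longleftrightarrow> (\<exists>h. e7_proj h = 0 \<and> q = h + p)"
      by (auto simp: E7_class_def a_r_coset_def' E7_ideal_eq type_ring_simps)
    also have "\<dots> \<longleftrightarrow> e7_proj (q - p) = 0" by (metis add_diff_cancel diff_add_cancel)
    finally show ?thesis by (simp add: ring_map_simps[OF ring_map_e7_proj])
  qed
  then show ?thesis by blast
qed

text \<open>
  The coset in \<open>E7_ring\<close> with normal form \<open>u\<close>.
\<close>

definition cls :: "'k::field e7 \<Rightarrow> 'k fps3 set" where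
  "cls u = {q. e7_proj q = u}"

lemma E7_class_cls: "E7_class p = cls (e7_proj p)"
  by (simp add: E7_class_eq cls_def)

lemma e7_proj_surj: "\<exists>p. e7_proj p = (u :: 'k::field e7)"
proof
  have "e7_proj (fps_const (cpart u) + fps_X * fps_const (zpart u)) = cS (cpart u) + zR * cS (zpart u)"
    by (simp add: ring_map_simps[OF ring_map_e7_proj] e7_proj_const e7_proj_X)
  then show "e7_proj (fps_const (cpart u) + fps_X * fps_const (zpart u)) = u"
    by (simp add: e7_eq_iff e7_defs)
qed

lemma cls_inject [simp]: "cls u = cls v \<longleftrightarrow> u = v"
  using e7_proj_surj[of u] by (auto simp: cls_def)

lemma carrier_E7_ring: "carrier E7_ring = range (cls :: 'k::field e7 \<Rightarrow> 'k fps3 set)"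
proof -
  have "carrier E7_ring = range (E7_class :: 'k fps3 \<Rightarrow> _)"
    by (auto simp: E7_ring_def FactRing_def A_RCOSETS_def' E7_class_def type_ring_simps)
  also have "\<dots> = cls ` range e7_proj" by (simp add: E7_class_cls image_image)
  also have "range e7_proj = (UNIV :: 'k e7 set)" 
    by (auto simp: image_iff) (metis e7_proj_surj)
  finally show ?thesis .
qed

lemma cls_closed [simp]: "cls u \<in> carrier E7_ring"
  by (simp add: carrier_E7_ring)

lemma E7_ring_ops:
  fixes u v :: "'k::field e7"
  shows "cls u \<oplus>\<^bsub>E7_ring\<^esub> cls v = cls (u + v)" "cls u \<otimes>\<^bsub>E7_ring\<^esub> cls v = cls (u * v)"
    "\<one>\<^bsub>E7_ring\<^esub> = cls (1 :: 'k e7)" "\<zero>\<^bsub>E7_ring\<^esub> = cls (0 :: 'k e7)"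
proof -
  interpret I: ideal "E7_ideal :: 'k fps3 set" ring_of_type_algebra by (rule E7_ideal_ideal)
  obtain p q where pq: "e7_proj p = u" "e7_proj q = v" using e7_proj_surj by metis
  have c: "cls u = E7_class p" "cls v = E7_class q" by (simp_all add: E7_class_cls pq)
  have "E7_class p \<oplus>\<^bsub>E7_ring\<^esub> E7_class q = E7_class (p + q)"
    using I.a_rcos_sum[of p q] by (simp add: E7_ring_def FactRing_def E7_class_def type_ring_simps)
  then show "cls u \<oplus>\<^bsub>E7_ring\<^esub> cls v = cls (u + v)"
    unfolding c by (simp add: E7_class_cls pq ring_map_simps[OF ring_map_e7_proj])
  have "E7_class p \<otimes>\<^bsub>E7_ring\<^esub> E7_class q = E7_class (p * q)"
    using I.rcoset_mult_add[of p q] by (simp add: E7_ring_def FactRing_def E7_class_def type_ring_simps)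
  then show "cls u \<otimes>\<^bsub>E7_ring\<^esub> cls v = cls (u * v)"
    unfolding c by (simp add: E7_class_cls pq ring_map_simps[OF ring_map_e7_proj])
  have "\<one>\<^bsub>E7_ring\<^esub> = E7_class (1 :: 'k fps3)"
    by (simp add: E7_ring_def FactRing_def E7_class_def type_ring_simps)
  then show "\<one>\<^bsub>E7_ring\<^esub> = cls (1 :: 'k e7)"
    by (simp add: E7_class_cls ring_map_simps[OF ring_map_e7_proj])
  show "\<zero>\<^bsub>E7_ring\<^esub> = cls (0 :: 'k e7)"
    by (simp add: E7_ring_def FactRing_def E7_ideal_eq cls_def)
qed

lemma E7_class_vars:
  "E7_class var_x = cls (cS xS :: 'k::field e7)" "E7_class (var_y ^ 3) = cls (cS (yS ^ 3) :: 'k e7)"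
  "E7_class var_z = cls (zR :: 'k e7)"
proof -
  have "(var_y ^ 3 :: 'k fps3) = fps_const (yS ^ 3)" by (simp only: var_y_def fps_const_power)
  then show "E7_class (var_y ^ 3) = cls (cS (yS ^ 3) :: 'k e7)" by (simp only: E7_class_cls e7_proj_const)
  show "E7_class var_x = cls (cS xS :: 'k e7)" "E7_class var_z = cls (zR :: 'k e7)"
    by (simp_all only: E7_class_cls var_x_def var_z_def e7_proj_const e7_proj_X)
qed

lemma E7_cring: "cring (E7_ring :: 'k::field fps3 set ring)"
  unfolding E7_ring_def by (rule ideal.quotient_is_cring[OF E7_ideal_ideal]) auto

lemma E7_a_inv: "\<ominus>\<^bsub>E7_ring\<^esub> cls u = cls (- u :: 'k::field e7)"
proof -
  interpret R: cring "E7_ring :: 'k fps3 set ring" by (rule E7_cring)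
  show ?thesis by (rule R.minus_equality) (simp_all add: E7_ring_ops)
qed

lemma ideal_set_vimage_cls:
  assumes "ideal K (E7_ring :: 'k::field fps3 set ring)"
  shows "ideal_set {u. cls u \<in> K}"
proof -
  interpret K: ideal K "E7_ring :: 'k fps3 set ring" by fact
  show ?thesis
    unfolding ideal_set_def
    using K.a_closed K.I_l_closed[OF _ cls_closed] K.zero_closed
    by (auto simp flip: E7_ring_ops(1,2)) (simp flip: E7_ring_ops(4))
qed

lemma ideal_image_cls:
  assumes "ideal_set P"
  shows "ideal (cls ` P) (E7_ring :: 'k::field fps3 set ring)"
proof -
  interpret R: cring "E7_ring :: 'k fps3 set ring" by (rule E7_cring)
  note D = ideal_setD[OF assms]
  show ?thesis
  proof (rule idealI[OF R.ring_axioms])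
    show "subgroup (cls ` P) (add_monoid E7_ring)"
    proof (rule R.add.subgroupI)
      show "cls ` P \<subseteq> carrier E7_ring" by auto
      show "cls ` P \<noteq> {}" using D(1) by auto
      fix a assume "a \<in> cls ` P"
      then show "\<ominus>\<^bsub>E7_ring\<^esub> a \<in> cls ` P" using D(5)[OF D(1)] by (force simp: E7_a_inv)
    next
      fix a b assume "a \<in> cls ` P" "b \<in> cls ` P"
      then show "a \<oplus>\<^bsub>E7_ring\<^esub> b \<in> cls ` P" using D(2) by (auto simp: E7_ring_ops)
    qed
  qed (use D(3,4) in \<open>auto simp: carrier_E7_ring E7_ring_ops\<close>)
qed

lemma prime_set_vimage_cls:
  assumes "primeideal K (E7_ring :: 'k::field fps3 set ring)"
  shows "prime_set {u. cls u \<in> K}"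
proof -
  interpret K: primeideal K "E7_ring :: 'k fps3 set ring" by fact
  have "cls 1 \<notin> K"
    using K.one_imp_carrier K.I_notcarr by (auto simp flip: E7_ring_ops(3))
  moreover have "u \<in> {u. cls u \<in> K} \<or> v \<in> {u. cls u \<in> K}" if "cls (u * v) \<in> K" for u v
    using K.I_prime[of "cls u" "cls v"] that by (simp add: E7_ring_ops)
  ultimately show ?thesis
    using ideal_set_vimage_cls[OF K.is_ideal] by (auto simp: prime_set_def)
qed

lemma prime_image_cls:
  assumes "prime_set P"
  shows "primeideal (cls ` P) (E7_ring :: 'k::field fps3 set ring)"
proof (rule primeidealI[OF ideal_image_cls E7_cring])
  show "ideal_set P" using prime_setD(1)[OF assms] .
  have "cls 1 \<notin> cls ` P" using prime_setD(2)[OF assms] by auto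
  then show "carrier E7_ring \<noteq> cls ` P" using cls_closed by blast
  fix a b assume ab: "a \<in> carrier E7_ring" "b \<in> carrier E7_ring" "a \<otimes>\<^bsub>E7_ring\<^esub> b \<in> cls ` P"
  then obtain u v where uv: "a = cls u" "b = cls v" by (auto simp: carrier_E7_ring)
  then have "u * v \<in> P" using ab(3) by (auto simp: E7_ring_ops)
  then have "u \<in> P \<or> v \<in> P" by (rule prime_setD(3)[OF assms])
  then show "a \<in> cls ` P \<or> b \<in> cls ` P" using uv by blast
qed

text \<open>
  The chain \<open>0 \<subset> (x, z) \<subset> (x, y, z)\<close> has the greatest possible length.
\<close>

theorem krull_dim_E7_ring: "krull_dim (E7_ring :: 'k::field fps3 set ring) = 2"
proof -
  let ?R = "E7_ring :: 'k fps3 set ring"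
  let ?S = "{enat n | n P. (\<forall>i\<le>n. primeideal (P i) ?R) \<and> (\<forall>i<n. P i \<subset> P (Suc i))}"
  have "e \<le> 2" if "e \<in> ?S" for e
  proof -
    obtain n P where e: "e = enat n" and P: "\<And>i. i \<le> n \<Longrightarrow> primeideal (P i) ?R"
      and chain: "\<And>i. i < n \<Longrightarrow> P i \<subset> P (Suc i)" using \<open>e \<in> ?S\<close> by blast
    have "\<not> n \<ge> 3"
    proof
      assume n: "n \<ge> 3"
      define Q where "Q i = {u. cls u \<in> P i}" for i
      have Q: "prime_set (Q i)" if "i \<le> 3" for i
        unfolding Q_def using P n that by (intro prime_set_vimage_cls) simp
      have strict: "Q i \<subset> Q (Suc i)" if "i < 3" for i
      proof -
        interpret Pi: primeideal "P (Suc i)" ?R using P n that by simp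
        have c: "P i \<subset> P (Suc i)" using chain n that by simp
        then obtain a where a: "a \<in> P (Suc i)" "a \<notin> P i" by blast
        then obtain u where "a = cls u" using Pi.a_subset by (auto simp: carrier_E7_ring)
        then show ?thesis using a c by (auto simp: Q_def)
      qed
      show False
        using e7_no_prime_chain[OF Q[of 0] Q[of 1] Q[of 2] Q[of 3]] strict[of 0] strict[of 1] strict[of 2]
        by (simp add: numeral_2_eq_2 numeral_3_eq_3)
    qed
    then show ?thesis by (simp add: e numeral_eq_enat)
  qed
  moreover have "2 \<in> ?S"
  proof -
    define P :: "nat \<Rightarrow> 'k fps3 set set" where
      "P i = (if i = 0 then cls ` {0} else if i = 1 then cls ` e7_line else cls ` e7_max)" for i
    have "primeideal (P i) ?R" for i
      using prime_image_cls[OF e7_prime_chain(1)[where 'k = 'k]]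
        prime_image_cls[OF prime_e7_line[where 'k = 'k]] prime_image_cls[OF prime_e7_max[where 'k = 'k]]
      unfolding P_def by simp
    moreover have "P i \<subset> P (Suc i)" if "i < 2" for i
    proof -
      have "inj (cls :: 'k e7 \<Rightarrow> 'k fps3 set)" by (rule injI) simp
      note eq = inj_image_eq_iff[OF this]
      have inj: "cls ` A \<subset> cls ` B" if "A \<subset> B" for A B :: "'k e7 set"
        using that unfolding psubset_eq eq by blast
      have "i = 0 \<or> i = 1" using that by auto
      then show ?thesis using inj[OF e7_prime_chain(2)] inj[OF e7_prime_chain(3)] by (auto simp: P_def)
    qed
    ultimately have "enat 2 \<in> ?S" by blast
    then show ?thesis by (simp add: numeral_eq_enat)
  qed
  ultimately show ?thesis
    unfolding krull_dim_def by (intro antisym Sup_least Sup_upper)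
qed

section \<open>Multiplication by ideals and regular sequences\<close>

context module
begin

lemma submodule_Inter:
  assumes "\<And>N. N \<in> C \<Longrightarrow> submodule N R M" "C \<noteq> {}"
  shows "submodule (\<Inter>C) R M"
proof (rule submoduleI)
  note E = submoduleE[OF assms(1)]
  show "\<Inter>C \<subseteq> carrier M" using E(1) assms(2) by blast
  show "\<zero>\<^bsub>M\<^esub> \<in> \<Inter>C"
    using subgroup.one_closed[OF submodule.axioms(1)[OF assms(1)]] by simp
qed (use submoduleE(3-5)[OF assms(1)] in auto)

lemma gen_submodule_least: "submodule N R M \<Longrightarrow> S \<subseteq> N \<Longrightarrow> gen_submodule R M S \<subseteq> N"
  by (auto simp: gen_submodule_def)

lemma gen_submodule_incl: "S \<subseteq> gen_submodule R M S"
  by (auto simp: gen_submodule_def)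

lemma gen_submodule_submodule:
  assumes "S \<subseteq> carrier M"
  shows "submodule (gen_submodule R M S) R M"
  unfolding gen_submodule_def
  using assms carrier_is_submodule by (intro submodule_Inter) auto

text \<open>
  Multiplication by the ideal generated by \<open>A\<close> only involves the multiples by elements of \<open>A\<close>.
\<close>

lemma ideal_smult_Idl:
  assumes A: "A \<subseteq> carrier R" and N: "submodule N R M"
    and gen: "N \<subseteq> gen_submodule R M {x \<odot>\<^bsub>M\<^esub> m | x m. x \<in> A \<and> m \<in> carrier M}"
    and mem: "\<And>x m. x \<in> A \<Longrightarrow> m \<in> carrier M \<Longrightarrow> x \<odot>\<^bsub>M\<^esub> m \<in> N"
  shows "ideal_smult R (Idl\<^bsub>R\<^esub> A) M = N"
proof
  note E = submoduleE[OF N]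
  have zero: "\<zero>\<^bsub>M\<^esub> \<in> N" using subgroup.one_closed[OF submodule.axioms(1)[OF N]] by simp
  have "ideal {r \<in> carrier R. \<forall>m\<in>carrier M. r \<odot>\<^bsub>M\<^esub> m \<in> N} R"
  proof (rule idealI[OF R.ring_axioms])
    show "subgroup {r \<in> carrier R. \<forall>m\<in>carrier M. r \<odot>\<^bsub>M\<^esub> m \<in> N} (add_monoid R)"
    proof (rule R.add.subgroupI)
      show "{r \<in> carrier R. \<forall>m\<in>carrier M. r \<odot>\<^bsub>M\<^esub> m \<in> N} \<noteq> {}"
        using zero by (auto intro!: exI[of _ \<zero>])
    qed (use E in \<open>auto simp: smult_l_minus smult_l_distr\<close>)
  next
    fix a x assume *: "a \<in> {r \<in> carrier R. \<forall>m\<in>carrier M. r \<odot>\<^bsub>M\<^esub> m \<in> N}" "x \<in> carrier R"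
    then show "x \<otimes> a \<in> {r \<in> carrier R. \<forall>m\<in>carrier M. r \<odot>\<^bsub>M\<^esub> m \<in> N}"
      using E(4) by (auto simp: smult_assoc1)
    then show "a \<otimes> x \<in> {r \<in> carrier R. \<forall>m\<in>carrier M. r \<odot>\<^bsub>M\<^esub> m \<in> N}"
      using * by (simp add: R.m_comm)
  qed
  then have "Idl A \<subseteq> {r \<in> carrier R. \<forall>m\<in>carrier M. r \<odot>\<^bsub>M\<^esub> m \<in> N}"
    by (rule R.genideal_minimal) (use A mem in auto)
  then show "ideal_smult R (Idl A) M \<subseteq> N"
    unfolding ideal_smult_def by (intro gen_submodule_least[OF N]) auto
  have "A \<subseteq> Idl A" using A by (rule R.genideal_self)
  then have "gen_submodule R M {x \<odot>\<^bsub>M\<^esub> m | x m. x \<in> A \<and> m \<in> carrier M} \<subseteq> ideal_smult R (Idl A) M"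
    unfolding ideal_smult_def gen_submodule_def by blast
  then show "N \<subseteq> ideal_smult R (Idl A) M" using gen by blast
qed

lemma ideal_smult_empty: "ideal_smult R (Idl\<^bsub>R\<^esub> {}) M = {\<zero>\<^bsub>M\<^esub>}"
proof (rule ideal_smult_Idl)
  show "submodule {\<zero>\<^bsub>M\<^esub>} R M" by (rule submoduleI) auto
  have "submodule (gen_submodule R M {}) R M" by (rule gen_submodule_submodule) simp
  then have "\<zero>\<^bsub>M\<^esub> \<in> gen_submodule R M {}"
    using subgroup.one_closed[OF submodule.axioms(1)] by fastforce
  then show "{\<zero>\<^bsub>M\<^esub>} \<subseteq> gen_submodule R M {x \<odot>\<^bsub>M\<^esub> m | x m. x \<in> {} \<and> m \<in> carrier M}" by simp
qed auto

lemma ideal_smult_pair: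
  assumes a: "a \<in> carrier R" and b: "b \<in> carrier R"
  shows "ideal_smult R (Idl\<^bsub>R\<^esub> {a, b}) M =
    {a \<odot>\<^bsub>M\<^esub> m \<oplus>\<^bsub>M\<^esub> b \<odot>\<^bsub>M\<^esub> n | m n. m \<in> carrier M \<and> n \<in> carrier M}" (is "_ = ?N")
proof (rule ideal_smult_Idl)
  show "{a, b} \<subseteq> carrier R" using assms by simp
  show "submodule ?N R M"
  proof (rule submoduleI)
    show "?N \<subseteq> carrier M" using assms by auto
    show "\<zero>\<^bsub>M\<^esub> \<in> ?N" using assms by (intro CollectI exI[of _ "\<zero>\<^bsub>M\<^esub>"]) simp
  next
    fix x assume "x \<in> ?N"
    then obtain m n where x: "x = a \<odot>\<^bsub>M\<^esub> m \<oplus>\<^bsub>M\<^esub> b \<odot>\<^bsub>M\<^esub> n" "m \<in> carrier M" "n \<in> carrier M" by blast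
    have "\<ominus>\<^bsub>M\<^esub> x = a \<odot>\<^bsub>M\<^esub> (\<ominus>\<^bsub>M\<^esub> m) \<oplus>\<^bsub>M\<^esub> b \<odot>\<^bsub>M\<^esub> (\<ominus>\<^bsub>M\<^esub> n)"
      using x assms by (simp add: smult_r_minus M.minus_add)
    then show "\<ominus>\<^bsub>M\<^esub> x \<in> ?N" using x(2,3) by blast
    fix r assume r: "r \<in> carrier R"
    have "r \<odot>\<^bsub>M\<^esub> x = a \<odot>\<^bsub>M\<^esub> (r \<odot>\<^bsub>M\<^esub> m) \<oplus>\<^bsub>M\<^esub> b \<odot>\<^bsub>M\<^esub> (r \<odot>\<^bsub>M\<^esub> n)"
      using x assms r by (simp add: smult_r_distr R.m_comm flip: smult_assoc1)
    then show "r \<odot>\<^bsub>M\<^esub> x \<in> ?N" using x(2,3) r by blast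
  next
    fix x y assume "x \<in> ?N" "y \<in> ?N"
    then obtain m n m' n' where x: "x = a \<odot>\<^bsub>M\<^esub> m \<oplus>\<^bsub>M\<^esub> b \<odot>\<^bsub>M\<^esub> n" "m \<in> carrier M" "n \<in> carrier M"
      and y: "y = a \<odot>\<^bsub>M\<^esub> m' \<oplus>\<^bsub>M\<^esub> b \<odot>\<^bsub>M\<^esub> n'" "m' \<in> carrier M" "n' \<in> carrier M" by blast
    have "x \<oplus>\<^bsub>M\<^esub> y = a \<odot>\<^bsub>M\<^esub> (m \<oplus>\<^bsub>M\<^esub> m') \<oplus>\<^bsub>M\<^esub> b \<odot>\<^bsub>M\<^esub> (n \<oplus>\<^bsub>M\<^esub> n')"
      using x y assms by (simp add: smult_r_distr M.a_ac)
    then show "x \<oplus>\<^bsub>M\<^esub> y \<in> ?N" using x(2,3) y(2,3) by blast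
  qed
  let ?G = "gen_submodule R M {x \<odot>\<^bsub>M\<^esub> m | x m. x \<in> {a, b} \<and> m \<in> carrier M}"
  have "submodule ?G R M" by (rule gen_submodule_submodule) (use assms in auto)
  note G = submoduleE(5)[OF this]
  show "?N \<subseteq> ?G"
  proof
    fix x assume "x \<in> ?N"
    then obtain m n where x: "x = a \<odot>\<^bsub>M\<^esub> m \<oplus>\<^bsub>M\<^esub> b \<odot>\<^bsub>M\<^esub> n" "m \<in> carrier M" "n \<in> carrier M" by blast
    have "a \<odot>\<^bsub>M\<^esub> m \<in> ?G" by (rule subsetD[OF gen_submodule_incl]) (use x(2) in blast)
    moreover have "b \<odot>\<^bsub>M\<^esub> n \<in> ?G" by (rule subsetD[OF gen_submodule_incl]) (use x(3) in blast)
    ultimately show "x \<in> ?G" unfolding x(1) by (rule G)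
  qed
  fix x m assume *: "x \<in> {a, b}" "m \<in> carrier M"
  have "a \<odot>\<^bsub>M\<^esub> m = a \<odot>\<^bsub>M\<^esub> m \<oplus>\<^bsub>M\<^esub> b \<odot>\<^bsub>M\<^esub> \<zero>\<^bsub>M\<^esub>" "b \<odot>\<^bsub>M\<^esub> m = a \<odot>\<^bsub>M\<^esub> \<zero>\<^bsub>M\<^esub> \<oplus>\<^bsub>M\<^esub> b \<odot>\<^bsub>M\<^esub> m"
    using * assms by simp_all
  then show "x \<odot>\<^bsub>M\<^esub> m \<in> ?N" using * M.zero_closed by blast
qed

lemma ideal_smult_single:
  assumes a: "a \<in> carrier R"
  shows "ideal_smult R (Idl\<^bsub>R\<^esub> {a}) M = {a \<odot>\<^bsub>M\<^esub> m | m. m \<in> carrier M}"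
proof -
  have "ideal_smult R (Idl\<^bsub>R\<^esub> {a, a}) M = {a \<odot>\<^bsub>M\<^esub> m | m. m \<in> carrier M}"
    unfolding ideal_smult_pair[OF a a]
  proof (intro equalityI subsetI)
    fix x assume "x \<in> {a \<odot>\<^bsub>M\<^esub> m \<oplus>\<^bsub>M\<^esub> a \<odot>\<^bsub>M\<^esub> n | m n. m \<in> carrier M \<and> n \<in> carrier M}"
    then obtain m n where "x = a \<odot>\<^bsub>M\<^esub> (m \<oplus>\<^bsub>M\<^esub> n)" "m \<in> carrier M" "n \<in> carrier M"
      using a by (auto simp: smult_r_distr)
    then show "x \<in> {a \<odot>\<^bsub>M\<^esub> m | m. m \<in> carrier M}" by blast
  next
    fix x assume "x \<in> {a \<odot>\<^bsub>M\<^esub> m | m. m \<in> carrier M}"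
    then obtain m where "x = a \<odot>\<^bsub>M\<^esub> m \<oplus>\<^bsub>M\<^esub> a \<odot>\<^bsub>M\<^esub> \<zero>\<^bsub>M\<^esub>" "m \<in> carrier M" using a by auto
    then show "x \<in> {a \<odot>\<^bsub>M\<^esub> m \<oplus>\<^bsub>M\<^esub> a \<odot>\<^bsub>M\<^esub> n | m n. m \<in> carrier M \<and> n \<in> carrier M}"
      using M.zero_closed by blast
  qed
  then show ?thesis by simp
qed

lemma regular_sequence_step:
  assumes "regular_sequence R M xs" "i < length xs" "m \<in> carrier M"
    "xs ! i \<odot>\<^bsub>M\<^esub> m \<in> ideal_smult R (Idl\<^bsub>R\<^esub> (set (take i xs))) M"
  shows "m \<in> ideal_smult R (Idl\<^bsub>R\<^esub> (set (take i xs))) M"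
  using assms unfolding regular_sequence_def by blast

lemma regular_sequence_no_unit:
  assumes xs: "regular_sequence R M xs" and x: "x \<in> set xs"
  shows "x \<notin> Units R"
proof
  assume u: "x \<in> Units R"
  have sub: "set xs \<subseteq> carrier R" using xs by (simp add: regular_sequence_def)
  have self: "set xs \<subseteq> Idl (set xs)" using sub by (rule R.genideal_self)
  have I: "Idl (set xs) \<subseteq> carrier R"
    by (rule additive_subgroup.a_subset[OF ideal.axioms(1)[OF R.genideal_ideal[OF sub]]])
  have "carrier M \<subseteq> ideal_smult R (Idl (set xs)) M"
  proof
    fix m assume m: "m \<in> carrier M"
    have eq: "m = x \<odot>\<^bsub>M\<^esub> (inv x \<odot>\<^bsub>M\<^esub> m)"
      using u m by (simp add: R.Units_closed flip: smult_assoc1)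
    show "m \<in> ideal_smult R (Idl (set xs)) M"
      unfolding ideal_smult_def
      by (rule subsetD[OF gen_submodule_incl]) (use eq x self u m in \<open>blast intro: R.Units_inv_closed smult_closed\<close>)
  qed
  moreover have "ideal_smult R (Idl (set xs)) M \<subseteq> carrier M"
    unfolding ideal_smult_def using I carrier_is_submodule by (intro gen_submodule_least) auto
  ultimately show False using xs by (auto simp: regular_sequence_def)
qed

end

section \<open>Traces and test ideals\<close>

lemma frag_extend_pair: "frag_extend (\<lambda>(m, l). frag_of (m, l)) = (\<lambda>c. c)"
proof
  fix c :: "('a \<times> 'b) \<Rightarrow>\<^sub>0 int"
  have "(\<lambda>(m :: 'a, l :: 'b). frag_of (m, l)) = frag_of" by auto
  then show "frag_extend (\<lambda>(m, l). frag_of (m, l)) c = c" using frag_expansion[of c] by simp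
qed

definition tensor_gens ::
    "('r, 's) ring_scheme \<Rightarrow> ('r, 'm, 't) module_scheme \<Rightarrow> ('r, 'n, 'u) module_scheme \<Rightarrow>
     (('m \<times> 'n) \<Rightarrow>\<^sub>0 int) set" where
  "tensor_gens R M N =
     {frag_of (m \<oplus>\<^bsub>M\<^esub> m', n) - frag_of (m, n) - frag_of (m', n) | m m' n.
         m \<in> carrier M \<and> m' \<in> carrier M \<and> n \<in> carrier N} \<union>
      {frag_of (m, n \<oplus>\<^bsub>N\<^esub> n') - frag_of (m, n) - frag_of (m, n') | m n n'.
         m \<in> carrier M \<and> n \<in> carrier N \<and> n' \<in> carrier N} \<union>
      {frag_of (r \<odot>\<^bsub>M\<^esub> m, n) - frag_of (m, r \<odot>\<^bsub>N\<^esub> n) | r m n.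
         r \<in> carrier R \<and> m \<in> carrier M \<and> n \<in> carrier N}"

lemma tensor_rels_generate: "tensor_rels R M N = generate (tensor_free M N) (tensor_gens R M N)"
  by (simp only: tensor_rels_def tensor_gens_def)

lemma keys_diff_subset:
  "Poly_Mapping.keys a \<subseteq> S \<Longrightarrow> Poly_Mapping.keys b \<subseteq> S \<Longrightarrow> Poly_Mapping.keys (a - b :: 'a \<Rightarrow>\<^sub>0 int) \<subseteq> S"
  using keys_diff[of a b] by blast

lemma tensor_gens_carrier:
  assumes "module R M" "module R N"
  shows "tensor_gens R M N \<subseteq> carrier (tensor_free M N)"
proof -
  interpret M: module R M by fact
  interpret N: module R N by fact
  show ?thesis
  proof
    fix g assume "g \<in> tensor_gens R M N"
    then show "g \<in> carrier (tensor_free M N)"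
      unfolding tensor_gens_def tensor_free_def
      by (elim UnE CollectE exE conjE) (simp_all add: keys_diff_subset keys_frag_of)
  qed
qed

lemma tensor_rels_subgroup:
  assumes "module R M" "module R N"
  shows "subgroup (tensor_rels R M N) (tensor_free M N)"
  unfolding tensor_rels_generate
  by (rule group.generate_is_subgroup[OF _ tensor_gens_carrier[OF assms]]) (simp add: tensor_free_def)

lemma tensor_rels_closed:
  assumes "module R M" "module R N"
  shows "0 \<in> tensor_rels R M N"
    "a \<in> tensor_rels R M N \<Longrightarrow> b \<in> tensor_rels R M N \<Longrightarrow> a + b \<in> tensor_rels R M N"
    "a \<in> tensor_rels R M N \<Longrightarrow> b \<in> tensor_rels R M N \<Longrightarrow> a - b \<in> tensor_rels R M N"
    "a \<in> tensor_rels R M N \<Longrightarrow> Poly_Mapping.keys a \<subseteq> carrier M \<times> carrier N"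
    "g \<in> tensor_gens R M N \<Longrightarrow> g \<in> tensor_rels R M N"
proof -
  interpret T: subgroup "tensor_rels R M N" "tensor_free M N" by (rule tensor_rels_subgroup[OF assms])
  show "0 \<in> tensor_rels R M N" using T.one_closed by (simp add: tensor_free_def)
  show add: "a \<in> tensor_rels R M N \<Longrightarrow> b \<in> tensor_rels R M N \<Longrightarrow> a + b \<in> tensor_rels R M N" for a b
    using T.m_closed by (simp add: tensor_free_def)
  show keys: "a \<in> tensor_rels R M N \<Longrightarrow> Poly_Mapping.keys a \<subseteq> carrier M \<times> carrier N" for a
    using T.mem_carrier by (simp add: tensor_free_def)
  have "b \<in> tensor_rels R M N \<Longrightarrow> - b \<in> tensor_rels R M N" for b
    using T.m_inv_closed[of b] keys[of b] by (simp add: tensor_free_def)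
  then show "a \<in> tensor_rels R M N \<Longrightarrow> b \<in> tensor_rels R M N \<Longrightarrow> a - b \<in> tensor_rels R M N"
    using add[of a "- b"] by simp
  show "g \<in> tensor_gens R M N \<Longrightarrow> g \<in> tensor_rels R M N"
    unfolding tensor_rels_generate by (rule generate.incl)
qed

lemma tensor_rels_least:
  assumes M: "module R M" "module R N" and h: "h \<in> tensor_rels R M N"
    and gens: "\<And>g. g \<in> tensor_gens R M N \<Longrightarrow> P g"
    and zero: "P 0" and diff: "\<And>a b. P a \<Longrightarrow> P b \<Longrightarrow> P (a - b)"
  shows "P h"
proof -
  have grp: "group (tensor_free M N)" by (simp add: tensor_free_def)
  have neg: "P (- a)" if "P a" for a using diff[OF zero that] by simp
  have add: "P (a + b)" if "P a" "P b" for a b using diff[OF that(1) neg[OF that(2)]] by simp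
  have "subgroup {c \<in> carrier (tensor_free M N). P c} (tensor_free M N)"
  proof (rule group.subgroupI[OF grp])
    show "{c \<in> carrier (tensor_free M N). P c} \<noteq> {}"
      using zero by (auto simp: tensor_free_def intro!: exI[of _ 0])
    fix a assume "a \<in> {c \<in> carrier (tensor_free M N). P c}"
    then show "inv\<^bsub>tensor_free M N\<^esub> a \<in> {c \<in> carrier (tensor_free M N). P c}"
      using neg by (simp add: tensor_free_def keys_minus)
    fix b assume "b \<in> {c \<in> carrier (tensor_free M N). P c}"
    then show "a \<otimes>\<^bsub>tensor_free M N\<^esub> b \<in> {c \<in> carrier (tensor_free M N). P c}"
      using add \<open>a \<in> _\<close> keys_add[of a b] by (auto simp: tensor_free_def)
  qed auto
  then have "tensor_rels R M N \<subseteq> {c \<in> carrier (tensor_free M N). P c}"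
    unfolding tensor_rels_generate using gens tensor_gens_carrier[OF M]
    by (intro group.generate_subgroup_incl[OF grp]) auto
  then show ?thesis using h by blast
qed

lemma tensor_rels_submodule:
  assumes "module R M" "module R B" "submodule A R B"
  shows "tensor_rels R M (B\<lparr>carrier := A\<rparr>) \<subseteq> tensor_rels R M B"
proof
  interpret B: module R B by fact
  have A: "A \<subseteq> carrier B" using B.submoduleE(1)[OF assms(3)] .
  have A_mod: "module R (B\<lparr>carrier := A\<rparr>)"
    by (rule submodule.submodule_is_module[OF assms(3,2)])
  note cl = tensor_rels_closed[OF assms(1,2)]
  fix h assume "h \<in> tensor_rels R M (B\<lparr>carrier := A\<rparr>)"
  then show "h \<in> tensor_rels R M B"
  proof (rule tensor_rels_least[OF assms(1) A_mod])
    fix g assume "g \<in> tensor_gens R M (B\<lparr>carrier := A\<rparr>)"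
    then have "g \<in> tensor_gens R M B"
      unfolding tensor_gens_def using A by simp blast
    then show "g \<in> tensor_rels R M B" by (rule cl(5))
  qed (rule cl(1), rule cl(3))
qed

text \<open>
  The cosets and induced maps of the tensor product disappear: \<open>x \<otimes> b\<close> comes from \<open>M \<otimes> A\<close> iff it differs from a formal sum
  over \<open>M \<times> A\<close> by a relation of \<open>M \<otimes> B\<close>.
\<close>

lemma module_closure_iff:
  assumes "module R M" "module R B" "submodule A R B"
  shows "b \<in> module_closure R M B A \<longleftrightarrow> b \<in> carrier B \<and> (\<forall>x\<in>carrier M.
     \<exists>w. Poly_Mapping.keys w \<subseteq> carrier M \<times> A \<and> frag_of (x, b) - w \<in> tensor_rels R M B)"
proof -
  let ?A = "B\<lparr>carrier := A\<rparr>"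
  let ?TA = "tensor_rels R M ?A" and ?TB = "tensor_rels R M B"
  note cl = tensor_rels_closed[OF assms(1,2)]
  have A_mod: "module R ?A" by (rule submodule.submodule_is_module[OF assms(3,2)])
  have sub: "?TA \<subseteq> ?TB" by (rule tensor_rels_submodule[OF assms])
  have zero: "0 \<in> ?TA" by (rule tensor_rels_closed(1)[OF assms(1) A_mod])
  have car: "carrier (tensor_prod R M ?A) = {{t + w | t. t \<in> ?TA} | w. Poly_Mapping.keys w \<subseteq> carrier M \<times> A}"
  proof -
    have "?TA #>\<^bsub>tensor_free M ?A\<^esub> w = {t + w | t. t \<in> ?TA}" for w
      by (auto simp: r_coset_def tensor_free_def)
    then show ?thesis by (auto simp: tensor_prod_def carrier_FactGroup tensor_free_def) blast
  qed
  have map: "tensor_map R M B (\<lambda>a. a) {t + w | t. t \<in> ?TA} = {t + w | t. t \<in> ?TB}" for w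
  proof -
    have "tensor_map R M B (\<lambda>a. a) {t + w | t. t \<in> ?TA} = {t + (t' + w) | t t'. t \<in> ?TB \<and> t' \<in> ?TA}"
      by (auto simp: tensor_map_def frag_extend_pair set_mult_def tensor_free_def)
    also have "\<dots> = {t + w | t. t \<in> ?TB}"
    proof (intro equalityI subsetI)
      fix c assume "c \<in> {t + (t' + w) | t t'. t \<in> ?TB \<and> t' \<in> ?TA}"
      then obtain t t' where "c = (t + t') + w" "t \<in> ?TB" "t' \<in> ?TA" by (auto simp: add.assoc)
      then show "c \<in> {t + w | t. t \<in> ?TB}" using cl(2) sub by blast
    next
      fix c assume "c \<in> {t + w | t. t \<in> ?TB}"
      then obtain t where "c = t + (0 + w)" "t \<in> ?TB" by auto
      then show "c \<in> {t + (t' + w) | t t'. t \<in> ?TB \<and> t' \<in> ?TA}" using zero by blast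
    qed
    finally show ?thesis .
  qed
  have pure: "pure_tensor R M B x b = {t + frag_of (x, b) | t. t \<in> ?TB}" for x
    by (auto simp: pure_tensor_def r_coset_def tensor_free_def)
  have coset: "{t + c | t. t \<in> ?TB} = {t + w | t. t \<in> ?TB} \<longleftrightarrow> c - w \<in> ?TB" for c w
  proof
    assume eq: "{t + c | t. t \<in> ?TB} = {t + w | t. t \<in> ?TB}"
    have "0 + c \<in> {t + c | t. t \<in> ?TB}" using cl(1) by blast
    then obtain t where "0 + c = t + w" "t \<in> ?TB" unfolding eq by blast
    then show "c - w \<in> ?TB" by simp
  next
    assume cw: "c - w \<in> ?TB"
    show "{t + c | t. t \<in> ?TB} = {t + w | t. t \<in> ?TB}"
    proof (intro equalityI subsetI)
      fix e assume "e \<in> {t + c | t. t \<in> ?TB}"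
      then obtain t where "e = (t + (c - w)) + w" "t \<in> ?TB" by auto
      then show "e \<in> {t + w | t. t \<in> ?TB}" using cl(2)[OF _ cw] by blast
    next
      fix e assume "e \<in> {t + w | t. t \<in> ?TB}"
      then obtain t where "e = (t - (c - w)) + c" "t \<in> ?TB" by auto
      then show "e \<in> {t + c | t. t \<in> ?TB}" using cl(3)[OF _ cw] by blast
    qed
  qed
  have "pure_tensor R M B x b \<in> tensor_map R M B (\<lambda>a. a) ` carrier (tensor_prod R M ?A) \<longleftrightarrow>
      (\<exists>w. Poly_Mapping.keys w \<subseteq> carrier M \<times> A \<and> frag_of (x, b) - w \<in> ?TB)" for x
  proof -
    have "tensor_map R M B (\<lambda>a. a) ` carrier (tensor_prod R M ?A) =
        {{t + w | t. t \<in> ?TB} | w. Poly_Mapping.keys w \<subseteq> carrier M \<times> A}"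
      unfolding car by (auto simp: map image_iff) (metis map)
    then show ?thesis by (auto simp: pure coset)
  qed
  then show ?thesis by (simp add: module_closure_def)
qed

text \<open>
  The assignment \<open>(m, b) \<mapsto> f m \<odot> b\<close> is biadditive and balanced, so its additive extension \<open>h\<close> to formal sums kills the
  relations of \<open>M \<otimes> B\<close>. If \<open>x \<otimes> c\<close> comes from a formal sum \<open>w\<close> over \<open>M \<times> A\<close>, then \<open>f x \<odot> c = h w\<close> lies in \<open>A\<close>.
\<close>

theorem trace_subset_test_ideal:
  fixes R :: "('r, 's) ring_scheme" and M :: "('r, 'm, 't) module_scheme" and f :: "'m \<Rightarrow> 'r"
  assumes M: "module R M" and f: "\<And>m. m \<in> carrier M \<Longrightarrow> f m \<in> carrier R"
    and f_add: "\<And>m n. m \<in> carrier M \<Longrightarrow> n \<in> carrier M \<Longrightarrow> f (m \<oplus>\<^bsub>M\<^esub> n) = f m \<oplus>\<^bsub>R\<^esub> f n"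
    and f_act: "\<And>r m. r \<in> carrier R \<Longrightarrow> m \<in> carrier M \<Longrightarrow> f (r \<odot>\<^bsub>M\<^esub> m) = r \<otimes>\<^bsub>R\<^esub> f m"
    and x: "x \<in> carrier M"
  shows "f x \<in> test_ideal (U :: 'b itself) R M"
proof -
  interpret M: module R M by fact
  have "f x \<odot>\<^bsub>B\<^esub> c \<in> A"
    if B_mod: "module R B" and A: "submodule A R B" and c: "c \<in> module_closure R M B A"
    for B :: "('r, 'b) module" and A c
  proof -
    interpret B: module R B by fact
    note AE = B.submoduleE[OF A]
    let ?S = "carrier M \<times> carrier B"
    have cg: "comm_group (add_monoid B)" by (rule B.a_comm_group)
    have im: "(\<lambda>(m, b). f m \<odot>\<^bsub>B\<^esub> b) ` ?S \<subseteq> carrier (add_monoid B)" using f by auto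
    obtain h where hom: "h \<in> hom (free_Abelian_group ?S) (add_monoid B)"
      and h': "\<And>p. p \<in> ?S \<Longrightarrow> h (frag_of p) = (\<lambda>(m, b). f m \<odot>\<^bsub>B\<^esub> b) p"
      using comm_group.free_Abelian_group_universal[OF cg im] by metis
    have h: "h (frag_of (m, b)) = f m \<odot>\<^bsub>B\<^esub> b" if "m \<in> carrier M" "b \<in> carrier B" for m b
      using h'[of "(m, b)"] that by simp
    have h_car: "h a \<in> carrier B" if "Poly_Mapping.keys a \<subseteq> ?S" for a
      using hom_in_carrier[OF hom, of a] that by simp
    have h_add: "h (a + b) = h a \<oplus>\<^bsub>B\<^esub> h b" if "Poly_Mapping.keys a \<subseteq> ?S" "Poly_Mapping.keys b \<subseteq> ?S" for a b
      using hom_mult[OF hom, of a b] that by simp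
    have h_diff: "h (a - b) = h a \<ominus>\<^bsub>B\<^esub> h b" if ab: "Poly_Mapping.keys a \<subseteq> ?S" "Poly_Mapping.keys b \<subseteq> ?S" for a b
    proof -
      have "h (a - b) \<oplus>\<^bsub>B\<^esub> h b = h a" using h_add[OF keys_diff_subset[OF ab] ab(2)] by simp
      then have "h a \<ominus>\<^bsub>B\<^esub> h b = h (a - b) \<oplus>\<^bsub>B\<^esub> (h b \<oplus>\<^bsub>B\<^esub> \<ominus>\<^bsub>B\<^esub> h b)"
        using h_car[OF keys_diff_subset[OF ab]] h_car ab by (metis B.a_assoc B.a_inv_closed B.minus_eq)
      then show ?thesis using h_car[OF keys_diff_subset[OF ab]] h_car[OF ab(2)] by (simp add: B.r_neg)
    qed
    have h0: "h 0 = \<zero>\<^bsub>B\<^esub>" using h_diff[of 0 0] h_car[of 0] by (simp add: B.minus_eq B.r_neg)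
    have rels: "Poly_Mapping.keys t \<subseteq> ?S \<and> h t = \<zero>\<^bsub>B\<^esub>" if "t \<in> tensor_rels R M B" for t
      using that
    proof (rule tensor_rels_least[OF M B_mod])
      fix g assume g: "g \<in> tensor_gens R M B"
      have keys: "Poly_Mapping.keys (frag_of p) \<subseteq> ?S" if "p \<in> ?S" for p using that by (simp add: keys_frag_of)
      have "h g = \<zero>\<^bsub>B\<^esub>"
        using g unfolding tensor_gens_def
      proof (elim UnE CollectE exE conjE)
        fix m m' n assume g: "g = frag_of (m \<oplus>\<^bsub>M\<^esub> m', n) - frag_of (m, n) - frag_of (m', n)"
          and c: "m \<in> carrier M" "m' \<in> carrier M" "n \<in> carrier B"
        have "h g = (f m \<oplus>\<^bsub>R\<^esub> f m') \<odot>\<^bsub>B\<^esub> n \<ominus>\<^bsub>B\<^esub> f m \<odot>\<^bsub>B\<^esub> n \<ominus>\<^bsub>B\<^esub> f m' \<odot>\<^bsub>B\<^esub> n"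
          unfolding g using c by (simp add: h_diff keys_diff_subset keys_frag_of h f_add)
        also have "\<dots> = (f m \<odot>\<^bsub>B\<^esub> n \<ominus>\<^bsub>B\<^esub> f m \<odot>\<^bsub>B\<^esub> n) \<oplus>\<^bsub>B\<^esub> (f m' \<odot>\<^bsub>B\<^esub> n \<ominus>\<^bsub>B\<^esub> f m' \<odot>\<^bsub>B\<^esub> n)"
          using c f by (simp add: B.smult_l_distr B.minus_eq B.a_ac)
        finally show ?thesis using c f by (simp add: B.minus_eq B.r_neg)
      next
        fix m n n' assume g: "g = frag_of (m, n \<oplus>\<^bsub>B\<^esub> n') - frag_of (m, n) - frag_of (m, n')"
          and c: "m \<in> carrier M" "n \<in> carrier B" "n' \<in> carrier B"
        have "h g = f m \<odot>\<^bsub>B\<^esub> (n \<oplus>\<^bsub>B\<^esub> n') \<ominus>\<^bsub>B\<^esub> f m \<odot>\<^bsub>B\<^esub> n \<ominus>\<^bsub>B\<^esub> f m \<odot>\<^bsub>B\<^esub> n'"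
          unfolding g using c by (simp add: h_diff keys_diff_subset keys_frag_of h)
        also have "\<dots> = (f m \<odot>\<^bsub>B\<^esub> n \<ominus>\<^bsub>B\<^esub> f m \<odot>\<^bsub>B\<^esub> n) \<oplus>\<^bsub>B\<^esub> (f m \<odot>\<^bsub>B\<^esub> n' \<ominus>\<^bsub>B\<^esub> f m \<odot>\<^bsub>B\<^esub> n')"
          using c f by (simp add: B.smult_r_distr B.minus_eq B.a_ac)
        finally show ?thesis using c f by (simp add: B.minus_eq B.r_neg)
      next
        fix r m n assume g: "g = frag_of (r \<odot>\<^bsub>M\<^esub> m, n) - frag_of (m, r \<odot>\<^bsub>B\<^esub> n)"
          and c: "r \<in> carrier R" "m \<in> carrier M" "n \<in> carrier B"
        have "h g = (r \<otimes>\<^bsub>R\<^esub> f m) \<odot>\<^bsub>B\<^esub> n \<ominus>\<^bsub>B\<^esub> f m \<odot>\<^bsub>B\<^esub> (r \<odot>\<^bsub>B\<^esub> n)"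
          unfolding g using c by (simp add: h_diff keys_frag_of h f_act)
        also have "f m \<odot>\<^bsub>B\<^esub> (r \<odot>\<^bsub>B\<^esub> n) = (r \<otimes>\<^bsub>R\<^esub> f m) \<odot>\<^bsub>B\<^esub> n"
          using c f by (simp add: M.m_comm flip: B.smult_assoc1)
        finally show ?thesis using c f by (simp add: B.minus_eq B.r_neg)
      qed
      moreover have "Poly_Mapping.keys g \<subseteq> ?S"
        using subsetD[OF tensor_gens_carrier[OF M B_mod] g] by (simp add: tensor_free_def)
      ultimately show "Poly_Mapping.keys g \<subseteq> ?S \<and> h g = \<zero>\<^bsub>B\<^esub>" by blast
    next
      fix a b assume "Poly_Mapping.keys a \<subseteq> ?S \<and> h a = \<zero>\<^bsub>B\<^esub>" "Poly_Mapping.keys b \<subseteq> ?S \<and> h b = \<zero>\<^bsub>B\<^esub>"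
      then show "Poly_Mapping.keys (a - b) \<subseteq> ?S \<and> h (a - b) = \<zero>\<^bsub>B\<^esub>"
        using keys_diff_subset[of a ?S b] by (simp add: h_diff B.minus_eq)
    qed (simp add: h0)
    have cB: "c \<in> carrier B" using c by (simp add: module_closure_def)
    obtain w where w: "Poly_Mapping.keys w \<subseteq> carrier M \<times> A" "frag_of (x, c) - w \<in> tensor_rels R M B"
      using c x module_closure_iff[OF M B_mod A] by blast
    have wS: "Poly_Mapping.keys w \<subseteq> ?S" using w(1) AE(1) by blast
    have "h w \<in> A"
    proof -
      have "Poly_Mapping.keys w \<subseteq> ?S \<and> h w \<in> A"
        using w(1)
      proof (induction w rule: frag_induction)
        case zero
        then show ?case using AE(2,3,5) by (simp add: h0) (metis B.r_neg AE(1) ex_in_conv subsetD)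
      next
        case (one p)
        then show ?case using AE(1,4) f by (auto simp: keys_frag_of h subsetD)
      next
        case (diff a b)
        then show ?case using keys_diff_subset[of a ?S b] AE(3,5) by (simp add: h_diff B.minus_eq)
      qed
      then show ?thesis by blast
    qed
    moreover have "h (frag_of (x, c)) \<ominus>\<^bsub>B\<^esub> h w = \<zero>\<^bsub>B\<^esub>"
      using rels[OF w(2)] h_diff[of "frag_of (x, c)" w] wS x cB by (simp add: keys_frag_of)
    then have "h (frag_of (x, c)) = h w"
      using h_car[OF wS] h_car[of "frag_of (x, c)"] x cB
      by (metis B.a_inv_closed B.add.inv_comm B.minus_eq B.minus_equality B.minus_minus keys_frag_of
          empty_subsetI insert_subset mem_Sigma_iff)
    ultimately show ?thesis using x cB by (simp add: h)
  qed
  then show ?thesis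
    unfolding test_ideal_def module_colon_def using f[OF x] by blast
qed

section \<open>The trace of a maximal Cohen-Macaulay module\<close>

lemma (in e7_module) spans_of_generators:
  assumes G: "finite G" "G \<subseteq> carrier M"
    and gen: "\<And>N. act_submodule N \<Longrightarrow> G \<subseteq> N \<Longrightarrow> carrier M \<subseteq> N"
  shows "S.spans (G \<union> (\<lambda>g. zR \<bullet> g) ` G)"
proof -
  define E where "E = G \<union> (\<lambda>g. zR \<bullet> g) ` G"
  have fin: "finite E" and car: "E \<subseteq> carrier M" using G by (auto simp: E_def)
  define N where "N = {S.lin s E | s. True}"
  have N_S: "S.act_submodule N"
    unfolding S.act_submodule_def
  proof (intro conjI ballI allI)
    show "N \<subseteq> carrier M" using car by (auto simp: N_def)
    show "\<zero> \<in> N" unfolding N_def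
      by (intro CollectI exI[of _ "\<lambda>_. 0"]) (simp add: S.lin_zero[OF car])
    fix m assume "m \<in> N"
    then obtain s where m: "m = S.lin s E" by (auto simp: N_def)
    show "cS c \<bullet> m \<in> N" for c unfolding m S.lin_act[OF fin car, symmetric] by (auto simp: N_def)
    fix n assume "n \<in> N"
    then obtain t where n: "n = S.lin t E" by (auto simp: N_def)
    show "m \<oplus> n \<in> N" unfolding m n S.lin_add[OF car, symmetric] by (auto simp: N_def)
  qed
  note ND = S.act_submoduleD[OF N_S]
  have E_N: "e \<in> N" if "e \<in> E" for e
    unfolding N_def
    by (intro CollectI exI[of _ "\<lambda>e'. if e' = e then 1 else 0"]) (simp add: S.lin_single[OF fin car that])
  have zE: "zR \<bullet> e \<in> N" if e: "e \<in> E" for e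
  proof (cases "e \<in> G")
    case True
    then show ?thesis by (intro E_N) (simp add: E_def)
  next
    case False
    then obtain g where g: "g \<in> G" "e = zR \<bullet> g" using e by (auto simp: E_def)
    have "zR \<bullet> e = cS (- gS) \<bullet> g"
      unfolding g(2) using g(1) G(2) by (simp only: act_mult[symmetric] zR_square cS_simps(5) subsetD)
    moreover have "g \<in> N" using g(1) by (intro E_N) (simp add: E_def)
    ultimately show ?thesis using ND(4)[of g "- gS"] by (simp only:)
  qed
  have z_lin: "zR \<bullet> S.lin s F \<in> N" if "finite F" "F \<subseteq> E" for s F
    using that
  proof (induction F rule: finite_induct)
    case empty
    then show ?case using ND(2) by simp
  next
    case (insert e F)
    have c: "insert e F \<subseteq> carrier M" and eM: "e \<in> carrier M" using insert.prems car by auto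
    have "zR \<bullet> S.lin s (insert e F) = cS (s e) \<bullet> zR \<bullet> e \<oplus> zR \<bullet> S.lin s F"
      using S.lin_insert[OF insert.hyps c, of s] c eM by (simp add: act_r_add act_commute[of e zR])
    then show ?case using ND(3)[OF ND(4)[OF zE] insert.IH] insert.prems by simp
  qed
  have "act_submodule N"
    unfolding act_submodule_def
  proof (intro conjI ballI allI)
    show "N \<subseteq> carrier M" using ND(1) by blast
    show "\<zero> \<in> N" by (rule ND(2))
    fix m assume m: "m \<in> N"
    show "m \<oplus> n \<in> N" if "n \<in> N" for n using m that by (rule ND(3))
    obtain s where s: "m = S.lin s E" using m by (auto simp: N_def)
    have dec: "u \<bullet> m = cS (cpart u) \<bullet> m \<oplus> cS (zpart u) \<bullet> zR \<bullet> m" for u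
    proof -
      have "u = cS (cpart u) + cS (zpart u) * zR" by (simp add: e7_defs)
      then have "u \<bullet> m = (cS (cpart u) + cS (zpart u) * zR) \<bullet> m" by simp
      then show ?thesis using ND(1)[OF m] by (simp add: act_add act_mult)
    qed
    have zm: "zR \<bullet> m \<in> N" unfolding s by (rule z_lin[OF fin subset_refl])
    show "u \<bullet> m \<in> N" for u unfolding dec[of u] by (rule ND(3)[OF ND(4)[OF m] ND(4)[OF zm]])
  qed
  moreover have "G \<subseteq> N" using E_N by (auto simp: E_def)
  ultimately have "carrier M \<subseteq> N" by (rule gen)
  then show ?thesis using fin car unfolding S.spans_def N_def E_def by blast
qed

locale E7_quotient_module = module "E7_ring :: 'k::field fps3 set ring" M for M :: "('k::field fps3 set, 'm) module"
begin

definition act :: "'k e7 \<Rightarrow> 'm \<Rightarrow> 'm" where "act u m = cls u \<odot>\<^bsub>M\<^esub> m"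

sublocale A: e7_module M act
proof -
  have "type_module M act"
  proof (intro_locales, unfold_locales)
    fix m n u v assume m: "m \<in> carrier M"
    show "act u m \<in> carrier M" using m by (simp add: act_def)
    show "act (u + v) m = act u m \<oplus>\<^bsub>M\<^esub> act v m" using m smult_l_distr[of "cls u" "cls v" m] by (simp add: act_def E7_ring_ops)
    show "act (u * v) m = act u (act v m)" using m smult_assoc1[of "cls u" "cls v" m] by (simp add: act_def E7_ring_ops)
    show "act 1 m = m" using m smult_one[of m] by (simp add: act_def E7_ring_ops)
    assume n: "n \<in> carrier M"
    show "act u (m \<oplus>\<^bsub>M\<^esub> n) = act u m \<oplus>\<^bsub>M\<^esub> act u n" using m n smult_r_distr[of "cls u" m n] by (simp add: act_def)
  qed
  then show "e7_module M act" by (simp add: e7_module_def)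
qed

lemma act_submodule_iff: "submodule N E7_ring M \<longleftrightarrow> A.act_submodule N"
proof
  assume "submodule N E7_ring M"
  note E = submoduleE[OF this] and z = subgroup.one_closed[OF submodule.axioms(1)[OF this]]
  then show "A.act_submodule N"
    unfolding A.act_submodule_def act_def by simp
next
  assume "A.act_submodule N"
  note D = A.act_submoduleD[OF this]
  show "submodule N E7_ring M"
  proof (rule submoduleI)
    fix a x assume "a \<in> carrier (E7_ring :: 'k fps3 set ring)" "x \<in> N"
    then show "a \<odot>\<^bsub>M\<^esub> x \<in> N" using D(4) by (auto simp: carrier_E7_ring act_def)
  qed (use D in auto)
qed

lemma nonunit_in_max:
  assumes "cls u \<notin> Units E7_ring"
  shows "u \<in> e7_max"
proof (rule ccontr)
  assume "u \<notin> e7_max"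
  then have "u dvd 1" by (intro e7_unit) (simp add: e7_max_def)
  then obtain v where "1 = u * v" by (rule dvdE)
  then have "cls u \<otimes>\<^bsub>E7_ring\<^esub> cls v = \<one>\<^bsub>E7_ring\<^esub>" "cls v \<otimes>\<^bsub>E7_ring\<^esub> cls u = \<one>\<^bsub>E7_ring\<^esub>"
    by (simp_all add: E7_ring_ops mult.commute)
  then have "cls u \<in> Units E7_ring" unfolding Units_def using cls_closed by blast
  then show False using assms by blast
qed

lemma depth_two_of_MCM:
  assumes mcm: "MCM_module E7_ring M"
  obtains a b G where "e7_depth_two M act a b G"
proof -
  have depth: "module_depth E7_ring M = 2" using mcm by (simp add: MCM_module_def krull_dim_E7_ring)
  have "\<exists>xs. regular_sequence E7_ring M xs \<and> length xs \<ge> 2"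
  proof (rule ccontr)
    assume "\<not> ?thesis"
    then have "length xs \<le> 1" if "regular_sequence E7_ring M xs" for xs
      using that by (metis Suc_1 not_less_eq_eq One_nat_def)
    then have "module_depth E7_ring M \<le> enat 1" unfolding module_depth_def by (intro Sup_least) auto
    then show False by (simp add: depth numeral_eq_enat)
  qed
  then obtain xs where xs: "regular_sequence E7_ring M xs" "length xs \<ge> 2" by blast
  have ne: "xs \<noteq> []" using xs(2) by auto
  have "xs ! 0 \<in> set xs" by (rule nth_mem) (use xs(2) in linarith)
  moreover have "xs ! 1 \<in> set xs" by (rule nth_mem) (use xs(2) in linarith)
  moreover have "set xs \<subseteq> carrier E7_ring" using xs(1) by (simp add: regular_sequence_def)
  ultimately have "xs ! 0 \<in> range cls" "xs ! 1 \<in> range cls" "xs ! 0 \<in> set xs" "xs ! 1 \<in> set xs"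
    unfolding carrier_E7_ring by blast+
  then obtain a b where ab: "xs ! 0 = cls a" "xs ! 1 = cls b" "cls a \<in> set xs" "cls b \<in> set xs"
    by (metis rangeE)
  obtain G where G: "finite G" "G \<subseteq> carrier M" "gen_submodule E7_ring M G = carrier M"
    using mcm by (auto simp: MCM_module_def fin_gen_module_def)
  have take1: "set (take 1 xs) = {cls a}" using ab(1) xs(2) by (cases xs) auto
  have image: "A.act_image u = {cls u \<odot>\<^bsub>M\<^esub> m | m. m \<in> carrier M}" for u
    by (simp add: A.act_image_def act_def)
  have "e7_depth_two M act a b (G \<union> (\<lambda>g. act zR g) ` G)"
  proof (unfold_locales)
    show "a \<in> e7_max" "b \<in> e7_max"
      using regular_sequence_no_unit[OF xs(1)] ab(3,4) nonunit_in_max by blast+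
    fix m assume m: "m \<in> carrier M"
    show "m = \<zero>\<^bsub>M\<^esub>" if "act a m = \<zero>\<^bsub>M\<^esub>"
      using regular_sequence_step[OF xs(1), of 0 m] ne m that
      by (simp add: ideal_smult_empty ab(1) act_def)
    show "m \<in> A.act_image a" if "act b m \<in> A.act_image a"
    proof -
      have "xs ! 1 \<odot>\<^bsub>M\<^esub> m \<in> ideal_smult E7_ring (Idl\<^bsub>E7_ring\<^esub> (set (take 1 xs))) M"
        using that unfolding take1 ideal_smult_single[OF cls_closed] ab(2) image by (simp add: act_def)
      then have "m \<in> ideal_smult E7_ring (Idl\<^bsub>E7_ring\<^esub> (set (take 1 xs))) M"
        using regular_sequence_step[OF xs(1), of 1 m] xs(2) m by simp
      then show ?thesis unfolding take1 ideal_smult_single[OF cls_closed] image .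
    qed
  next
    show "A.S.spans (G \<union> (\<lambda>g. act zR g) ` G)"
    proof (rule A.spans_of_generators[OF G(1,2)])
      fix N assume "A.act_submodule N" "G \<subseteq> N"
      then show "carrier M \<subseteq> N" using gen_submodule_least[of N G] G(3) by (simp add: act_submodule_iff)
    qed
  qed
  then show ?thesis by (rule that)
qed

lemma test_ideal_ideal_set: "ideal_set {u. cls u \<in> test_ideal U E7_ring M}"
proof -
  have "cls u \<in> test_ideal U E7_ring M \<longleftrightarrow> (\<forall>(B :: ('k fps3 set, 'b) module) A c.
      module E7_ring B \<longrightarrow> submodule A E7_ring B \<longrightarrow> c \<in> module_closure E7_ring M B A \<longrightarrow> cls u \<odot>\<^bsub>B\<^esub> c \<in> A)"
    for u and U :: "'b itself"
    by (auto simp: test_ideal_def module_colon_def)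
  note iff = this
  have facts: "cls 0 \<odot>\<^bsub>B\<^esub> c \<in> A"
    "cls u \<odot>\<^bsub>B\<^esub> c \<in> A \<Longrightarrow> cls v \<odot>\<^bsub>B\<^esub> c \<in> A \<Longrightarrow> cls (u + v) \<odot>\<^bsub>B\<^esub> c \<in> A"
    "cls u \<odot>\<^bsub>B\<^esub> c \<in> A \<Longrightarrow> cls (r * u) \<odot>\<^bsub>B\<^esub> c \<in> A"
    if B: "module E7_ring B" and A: "submodule A E7_ring B" and c: "c \<in> module_closure E7_ring M B A"
    for B :: "('k fps3 set, 'b) module" and A c and u v r :: "'k e7"
  proof -
    interpret B: module E7_ring B by fact
    note E = B.submoduleE[OF A] and z = subgroup.one_closed[OF submodule.axioms(1)[OF A]]
    have cB: "c \<in> carrier B" using c by (simp add: module_closure_def)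
    show "cls 0 \<odot>\<^bsub>B\<^esub> c \<in> A" using B.smult_l_null[OF cB] z by (simp add: E7_ring_ops)
    show "cls u \<odot>\<^bsub>B\<^esub> c \<in> A \<Longrightarrow> cls v \<odot>\<^bsub>B\<^esub> c \<in> A \<Longrightarrow> cls (u + v) \<odot>\<^bsub>B\<^esub> c \<in> A"
      using B.smult_l_distr[of "cls u" "cls v" c] cB E(5) by (simp add: E7_ring_ops)
    show "cls u \<odot>\<^bsub>B\<^esub> c \<in> A \<Longrightarrow> cls (r * u) \<odot>\<^bsub>B\<^esub> c \<in> A"
      using B.smult_assoc1[of "cls r" "cls u" c] cB E(4)[of "cls r"] by (simp add: E7_ring_ops)
  qed
  show ?thesis
    unfolding ideal_set_def by (auto simp: iff intro: facts)
qed

theorem MCM_test_ideal_lower_bound: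
  assumes two: "(2 :: 'k) \<noteq> 0" and mcm: "MCM_module E7_ring M"
  shows "cls (cS xS) \<in> test_ideal U E7_ring M" "cls (cS (yS ^ 3)) \<in> test_ideal U E7_ring M"
    "cls zR \<in> test_ideal U E7_ring M"
proof -
  obtain a b G where "e7_depth_two M act a b G" using depth_two_of_MCM[OF mcm] .
  then interpret D: e7_depth_two M act a b G .
  define T where "T = {u. cls u \<in> test_ideal U E7_ring M}"
  have "carrier M \<noteq> {\<zero>\<^bsub>M\<^esub>}" using mcm by (simp add: MCM_module_def)
  moreover have "ideal_set T" unfolding T_def by (rule test_ideal_ideal_set)
  moreover have "f m \<in> T"
    if f_add: "\<And>m n. m \<in> carrier M \<Longrightarrow> n \<in> carrier M \<Longrightarrow> f (m \<oplus>\<^bsub>M\<^esub> n) = f m + f n"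
      and f_act: "\<And>u m. m \<in> carrier M \<Longrightarrow> f (act u m) = u * f m" and m: "m \<in> carrier M" for f m
  proof -
    have "cls (f m) \<in> test_ideal U E7_ring M"
    proof (rule trace_subset_test_ideal[of E7_ring M "\<lambda>m. cls (f m)", OF module_axioms])
      fix r m assume "r \<in> carrier (E7_ring :: 'k fps3 set ring)" "m \<in> carrier M"
      then show "cls (f (r \<odot>\<^bsub>M\<^esub> m)) = r \<otimes>\<^bsub>E7_ring\<^esub> cls (f m)"
        using f_act by (auto simp: carrier_E7_ring E7_ring_ops simp flip: act_def)
    qed (use m in \<open>simp_all add: f_add E7_ring_ops\<close>)
    then show ?thesis by (simp add: T_def)
  qed
  ultimately have "cS xS \<in> T" "cS (yS ^ 3) \<in> T" "zR \<in> T"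
    using D.linear_functionals_detect[OF two] by blast+
  then show "cls (cS xS) \<in> test_ideal U E7_ring M" "cls (cS (yS ^ 3)) \<in> test_ideal U E7_ring M"
    "cls zR \<in> test_ideal U E7_ring M" by (simp_all add: T_def)
qed

end

section \<open>The maximal Cohen-Macaulay ideal (x, z)\<close>

text \<open>
  The ideal \<open>C\<close> as a module whose elements are relabelled by an injection \<open>\<iota>\<close> into another type.
\<close>

definition ideal_module :: "('k::field e7 \<Rightarrow> 'b) \<Rightarrow> 'k e7 set \<Rightarrow> ('k fps3 set, 'b) module" where
  "ideal_module \<iota> C = \<lparr>carrier = \<iota> ` C, monoid.mult = (\<lambda>a b. a), one = \<iota> 0, ring.zero = \<iota> 0,
     add = (\<lambda>a b. \<iota> (inv_into UNIV \<iota> a + inv_into UNIV \<iota> b)),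
     module.smult = (\<lambda>r a. \<iota> (inv_into UNIV cls r * inv_into UNIV \<iota> a))\<rparr>"

lemma inj_cls: "inj (cls :: 'k::field e7 \<Rightarrow> 'k fps3 set)"
  by (rule injI) simp

locale embedded_ideal =
  fixes \<iota> :: "'k::field e7 \<Rightarrow> 'b" and C :: "'k e7 set"
  assumes inj: "inj \<iota>" and C: "ideal_set C"
begin

abbreviation "M \<equiv> ideal_module \<iota> C"

lemma \<iota>_eq [simp]: "\<iota> u = \<iota> v \<longleftrightarrow> u = v"
  using inj by (auto dest: injD)

lemma \<iota>_mem [simp]: "\<iota> u \<in> \<iota> ` C' \<longleftrightarrow> u \<in> C'"
  by auto

lemma M_ops:
  "carrier M = \<iota> ` C" "\<zero>\<^bsub>M\<^esub> = \<iota> 0" "\<iota> u \<oplus>\<^bsub>M\<^esub> \<iota> v = \<iota> (u + v)" "cls r \<odot>\<^bsub>M\<^esub> \<iota> u = \<iota> (r * u)"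
  by (simp_all add: ideal_module_def inv_into_f_f[OF inj] inv_into_f_f[OF inj_cls])

lemma module_M: "module E7_ring M"
proof (rule moduleI[OF E7_cring])
  note D = ideal_setD[OF C]
  show "abelian_group M"
  proof (rule abelian_groupI)
    show "\<zero>\<^bsub>M\<^esub> \<in> carrier M" using D(1) by (simp add: M_ops)
    fix x assume "x \<in> carrier M"
    then obtain u where u: "x = \<iota> u" "u \<in> C" by (auto simp: M_ops)
    have "- u \<in> C" using D(5)[OF D(1) u(2)] by simp
    then show "\<exists>y\<in>carrier M. y \<oplus>\<^bsub>M\<^esub> x = \<zero>\<^bsub>M\<^esub>" unfolding u(1) by (intro bexI[of _ "\<iota> (- u)"]) (simp_all add: M_ops)
  qed (use D(2) in \<open>auto simp: M_ops add_ac\<close>)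
qed (use ideal_setD(3,4)[OF C] in \<open>auto simp: carrier_E7_ring M_ops E7_ring_ops distrib_left distrib_right mult.assoc\<close>)

sublocale module E7_ring M by (rule module_M)

lemma single_image: "{cls a \<odot>\<^bsub>M\<^esub> m | m. m \<in> carrier M} = \<iota> ` (times a ` C)"
proof -
  have "{cls a \<odot>\<^bsub>M\<^esub> m | m. m \<in> carrier M} = (\<lambda>m. cls a \<odot>\<^bsub>M\<^esub> m) ` carrier M" by blast
  then show ?thesis by (simp only: M_ops(1) image_image M_ops(4))
qed

lemma pair_image:
  "{cls a \<odot>\<^bsub>M\<^esub> m \<oplus>\<^bsub>M\<^esub> cls b \<odot>\<^bsub>M\<^esub> n | m n. m \<in> carrier M \<and> n \<in> carrier M} = \<iota> ` two_gen a b C"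
proof -
  have "{cls a \<odot>\<^bsub>M\<^esub> m \<oplus>\<^bsub>M\<^esub> cls b \<odot>\<^bsub>M\<^esub> n | m n. m \<in> carrier M \<and> n \<in> carrier M} =
      {cls a \<odot>\<^bsub>M\<^esub> \<iota> i \<oplus>\<^bsub>M\<^esub> cls b \<odot>\<^bsub>M\<^esub> \<iota> j | i j. i \<in> C \<and> j \<in> C}"
    unfolding M_ops(1) by blast
  also have "\<dots> = \<iota> ` two_gen a b C"
    unfolding M_ops(3,4) two_gen_def by blast
  finally show ?thesis .
qed

end

lemma line_MCM:
  fixes \<iota> :: "'k::field e7 \<Rightarrow> 'b"
  assumes inj: "inj \<iota>"
  shows "MCM_module E7_ring (ideal_module \<iota> e7_line)"
proof -
  let ?L = "e7_line :: 'k e7 set"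
  have L: "ideal_set ?L" by (rule prime_setD(1)[OF prime_e7_line])
  interpret embedded_ideal \<iota> ?L by unfold_locales (rule inj, rule L)
  have xL: "cS xS \<in> ?L" and zL: "zR \<in> ?L" by (simp_all add: e7_line_def)
  have "fin_gen_module E7_ring M"
    unfolding fin_gen_module_def
  proof (intro conjI exI)
    show "module E7_ring M" by (rule module_M)
    let ?G = "{\<iota> (cS xS), \<iota> zR}"
    show "finite ?G" by simp
    show sub: "?G \<subseteq> carrier M" by (simp add: M_ops xL zL)
    show "gen_submodule E7_ring M ?G = carrier M"
    proof
      show "gen_submodule E7_ring M ?G \<subseteq> carrier M" using gen_submodule_least carrier_is_submodule sub by blast
      note E = submoduleE[OF gen_submodule_submodule[OF sub]]
      show "carrier M \<subseteq> gen_submodule E7_ring M ?G"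
      proof
        fix m assume "m \<in> carrier M"
        then obtain u where u: "m = \<iota> u" "u \<in> ?L" by (auto simp: M_ops)
        then have "xS dvd cpart u" by (simp add: e7_line_def)
        then obtain A where A: "cpart u = xS * A" by (rule dvdE)
        have "u = cS A * cS xS + cS (zpart u) * zR" by (simp add: e7_eq_iff e7_defs A)
        then have "m = cls (cS A) \<odot>\<^bsub>M\<^esub> \<iota> (cS xS) \<oplus>\<^bsub>M\<^esub> cls (cS (zpart u)) \<odot>\<^bsub>M\<^esub> \<iota> zR"
          unfolding u(1) by (simp only: M_ops)
        moreover have "\<iota> (cS xS) \<in> gen_submodule E7_ring M ?G" "\<iota> zR \<in> gen_submodule E7_ring M ?G"
          using gen_submodule_incl[of ?G] by auto
        ultimately show "m \<in> gen_submodule E7_ring M ?G"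
          using E(5)[OF E(4)[OF cls_closed] E(4)[OF cls_closed]] by simp
      qed
    qed
  qed
  moreover have "carrier M \<noteq> {\<zero>\<^bsub>M\<^esub>}"
  proof -
    have "\<iota> zR \<in> carrier M" "\<iota> zR \<noteq> \<zero>\<^bsub>M\<^esub>" by (simp_all add: M_ops zL) (simp add: zero_e7_def)
    then show ?thesis by blast
  qed
  moreover have "module_depth E7_ring M = krull_dim E7_ring"
  proof -
    have "length xs \<le> 2" if xs: "regular_sequence E7_ring M xs" for xs
    proof (rule ccontr)
      assume "\<not> length xs \<le> 2"
      then have "Suc (Suc (Suc 0)) \<le> length xs" by linarith
      then obtain p q r ys where xs_eq: "xs = p # q # r # ys" by (auto simp: Suc_le_length_iff)
      have "set xs \<subseteq> carrier E7_ring" using xs by (simp add: regular_sequence_def)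
      then obtain a b c where abc: "p = cls a" "q = cls b" "r = cls c"
        unfolding xs_eq by (auto simp: carrier_E7_ring)
      have "u \<in> e7_max" if "cls u \<in> set xs" for u
        by (rule E7_quotient_module.nonunit_in_max[OF E7_quotient_module.intro[OF module_M]])
          (rule regular_sequence_no_unit[OF xs that])
      then have max: "a \<in> e7_max" "b \<in> e7_max" "c \<in> e7_max" by (simp_all add: xs_eq abc)
      have a: "a \<noteq> 0"
      proof
        assume "a = 0"
        then have "\<iota> zR \<in> {\<zero>\<^bsub>M\<^esub>}"
          using regular_sequence_step[OF xs, of 0 "\<iota> zR"]
          by (simp add: xs_eq abc ideal_smult_empty M_ops zL)
        then show False by (simp add: M_ops zero_e7_def)
      qed
      have b: "u \<in> times a ` ?L" if "u \<in> ?L" "b * u \<in> times a ` ?L" for u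
        using regular_sequence_step[OF xs, of 1 "\<iota> u"] that
        by (simp add: xs_eq abc ideal_smult_single single_image) (simp add: M_ops)
      have c: "u \<in> two_gen a b ?L" if "u \<in> ?L" "c * u \<in> two_gen a b ?L" for u
        using regular_sequence_step[OF xs, of 2 "\<iota> u"] that
        by (simp add: xs_eq abc ideal_smult_pair pair_image numeral_2_eq_2) (simp add: M_ops)
      show False by (rule e7_line_no_three_term_regular_sequence[OF max a b c])
    qed
    moreover have "regular_sequence E7_ring M [cls (cS xS), cls (cS yS)]"
      unfolding regular_sequence_def
    proof (intro conjI allI impI ballI)
      show "set [cls (cS xS), cls (cS yS)] \<subseteq> carrier E7_ring" by simp
      have "ideal_smult E7_ring (Idl\<^bsub>E7_ring\<^esub> (set [cls (cS xS), cls (cS yS)])) M = \<iota> ` two_gen (cS xS) (cS yS) ?L"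
        by (simp add: ideal_smult_pair pair_image)
      moreover have "\<iota> (cS xS) \<notin> \<iota> ` two_gen (cS xS) (cS yS) ?L" using e7_line_socle(3) by simp
      moreover have "\<iota> (cS xS) \<in> carrier M" using e7_line_socle(1) by (simp add: M_ops)
      ultimately show "ideal_smult E7_ring (Idl\<^bsub>E7_ring\<^esub> (set [cls (cS xS), cls (cS yS)])) M \<noteq> carrier M"
        by metis
    next
      fix i m
      let ?xs = "[cls (cS xS), cls (cS yS)] :: 'k fps3 set list"
      assume i: "i < length ?xs" and m: "m \<in> carrier M"
        and mem: "?xs ! i \<odot>\<^bsub>M\<^esub> m \<in> ideal_smult E7_ring (Idl\<^bsub>E7_ring\<^esub> (set (take i ?xs))) M"
      obtain u where u: "m = \<iota> u" "u \<in> ?L" using m by (auto simp: M_ops)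
      have "i = 0 \<or> i = 1" using i by auto
      then show "m \<in> ideal_smult E7_ring (Idl\<^bsub>E7_ring\<^esub> (set (take i ?xs))) M"
      proof
        assume "i = 0"
        then show ?thesis using mem
          by (auto simp: ideal_smult_empty u M_ops) (simp add: zero_e7_def)
      next
        assume i1: "i = 1"
        then have "cS yS * u \<in> times (cS xS) ` ?L"
          using mem by (simp add: ideal_smult_single single_image u) (simp add: M_ops)
        then have "u \<in> times (cS xS) ` ?L" by (rule e7_line_regular[OF u(2)])
        then show ?thesis by (simp add: i1 ideal_smult_single single_image u)
      qed
    qed
    then have "enat 2 \<le> module_depth E7_ring M"
      unfolding module_depth_def by (intro Sup_upper) force
    ultimately have "module_depth E7_ring M = 2"
      unfolding numeral_eq_enat module_depth_def by (intro antisym Sup_least) auto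
    then show ?thesis by (simp add: krull_dim_E7_ring)
  qed
  ultimately show ?thesis by (simp add: MCM_module_def)
qed

lemma ideal_set_UNIV: "ideal_set UNIV"
  by (simp add: ideal_set_def)

lemma ideal_set_xy3: "ideal_set {u :: 'k::field e7. \<exists>s t. u = s * cS xS + t * cS (yS ^ 3)}"
proof -
  have "0 = 0 * cS xS + 0 * cS (yS ^ 3 :: 'k fps2)" by simp
  moreover have "s * cS xS + t * cS (yS ^ 3) + (s' * cS xS + t' * cS (yS ^ 3)) =
      (s + s') * cS xS + (t + t') * cS (yS ^ 3 :: 'k fps2)" for s t s' t' by (simp add: algebra_simps)
  moreover have "r * (s * cS xS + t * cS (yS ^ 3)) = (r * s) * cS xS + (r * t) * cS (yS ^ 3 :: 'k fps2)"
    for r s t by (simp add: algebra_simps)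
  ultimately show ?thesis unfolding ideal_set_def by blast
qed

text \<open>
  For \<open>m = x * A + c * z\<close> in \<open>(x, z)\<close> one has \<open>z * m = x * m1 + y ^ 3 * m2\<close> with \<open>m1 = A * z - c * x\<^sup>2\<close> and \<open>m2 = - c * x\<close>, both again
  in \<open>(x, z)\<close>. Hence \<open>m \<otimes> z = m1 \<otimes> x + m2 \<otimes> y ^ 3\<close>, and \<open>z\<close> lies in the closure of \<open>J = (x, y ^ 3)\<close>. Finally \<open>r * z \<in> J\<close> forces
  \<open>cpart r\<close>, the \<open>z\<close>-coordinate of \<open>r * z\<close>, into \<open>(x, y ^ 3)\<close>.
\<close>

theorem MCM_test_ideal_upper_bound:
  fixes \<iota> :: "'k::field e7 \<Rightarrow> 'b"
  assumes inj: "inj \<iota>" and r: "cls r \<in> test_ideal TYPE('b) E7_ring (ideal_module \<iota> e7_line)"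
  obtains s t v where "r = s * cS xS + t * cS (yS ^ 3) + v * zR"
proof -
  let ?L = "e7_line :: 'k e7 set"
  interpret L: embedded_ideal \<iota> ?L by unfold_locales (rule inj, rule prime_setD(1)[OF prime_e7_line])
  interpret B: embedded_ideal \<iota> UNIV by unfold_locales (rule inj, rule ideal_set_UNIV)
  let ?M = "ideal_module \<iota> ?L" and ?B = "ideal_module \<iota> UNIV"
  define J where "J = {u :: 'k e7. \<exists>s t. u = s * cS xS + t * cS (yS ^ 3)}"
  have J: "ideal_set J" unfolding J_def by (rule ideal_set_xy3)
  note JD = ideal_setD[OF J]
  have sub: "submodule (\<iota> ` J) E7_ring ?B"
  proof (rule B.submoduleI)
    fix a assume "a \<in> \<iota> ` J"
    then obtain u where u: "a = \<iota> u" "u \<in> J" by blast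
    have "\<ominus>\<^bsub>?B\<^esub> \<iota> u = \<iota> (- u)"
      by (rule B.M.minus_equality) (simp_all add: B.M_ops)
    then show "\<ominus>\<^bsub>?B\<^esub> a \<in> \<iota> ` J" unfolding u(1) using JD(5)[OF JD(1) u(2)] by simp
  qed (use JD in \<open>auto simp: B.M_ops carrier_E7_ring\<close>)
  have xJ: "cS xS \<in> J" unfolding J_def by (intro CollectI exI[of _ 1] exI[of _ 0]) simp
  have yJ: "cS (yS ^ 3) \<in> J" unfolding J_def by (intro CollectI exI[of _ 0] exI[of _ 1]) simp
  have "\<iota> zR \<in> module_closure E7_ring ?M ?B (\<iota> ` J)"
    unfolding module_closure_iff[OF L.module_M B.module_M sub]
  proof (intro conjI ballI)
    show "\<iota> zR \<in> carrier ?B" by (simp add: B.M_ops)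
    fix x assume "x \<in> carrier ?M"
    then obtain m where "x = \<iota> m" "m \<in> ?L" by (auto simp: L.M_ops)
    then have m: "x = \<iota> m" "xS dvd cpart m" by (simp_all add: e7_line_def)
    obtain A where A: "cpart m = xS * A" using m(2) by (rule dvdE)
    define m1 where "m1 = E7 (xS * - (zpart m * xS)) A"
    define m2 where "m2 = E7 (xS * - zpart m) 0"
    have mem: "m \<in> ?L" "zR * m \<in> ?L" "cS xS * m1 \<in> ?L" "cS (yS ^ 3) * m2 \<in> ?L" "m1 \<in> ?L" "m2 \<in> ?L"
    proof -
      show "m \<in> ?L" using m(2) by (simp add: e7_line_def)
      show m1: "m1 \<in> ?L" unfolding m1_def e7_line_def by (simp only: mem_Collect_eq e7.sel dvd_triv_left)
      show m2: "m2 \<in> ?L" unfolding m2_def e7_line_def by (simp only: mem_Collect_eq e7.sel dvd_triv_left)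
      show "zR * m \<in> ?L" "cS xS * m1 \<in> ?L" "cS (yS ^ 3) * m2 \<in> ?L"
        using ideal_setD(3)[OF L.C] \<open>m \<in> ?L\<close> m1 m2 by blast+
    qed
    have eq: "zR * m = cS xS * m1 + cS (yS ^ 3) * m2"
      by (simp only: e7_eq_iff times_e7_def plus_e7_def m1_def m2_def A e7.sel mult_zero_left
          mult_zero_right mult_1 mult_1_right diff_0 diff_0_right add_0_left add_0_right)
        (simp only: algebra_simps power3_eq_cube mult_minus_left mult_minus_right minus_add_distrib simp_thms)
    define w where "w = frag_of (\<iota> m1, \<iota> (cS xS)) + frag_of (\<iota> m2, \<iota> (cS (yS ^ 3)))"
    note cl = tensor_rels_closed[OF L.module_M B.module_M]
    have bal: "frag_of (\<iota> (r * u), \<iota> v) - frag_of (\<iota> u, \<iota> (r * v)) \<in> tensor_rels E7_ring ?M ?B"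
      if "u \<in> ?L" for r u v
    proof (rule cl(5))
      have "frag_of (cls r \<odot>\<^bsub>?M\<^esub> \<iota> u, \<iota> v) - frag_of (\<iota> u, cls r \<odot>\<^bsub>?B\<^esub> \<iota> v) \<in> tensor_gens E7_ring ?M ?B"
        unfolding tensor_gens_def using that by (auto simp: L.M_ops(1) B.M_ops(1) intro!: exI)
      then show "frag_of (\<iota> (r * u), \<iota> v) - frag_of (\<iota> u, \<iota> (r * v)) \<in> tensor_gens E7_ring ?M ?B"
        by (simp only: L.M_ops(4) B.M_ops(4))
    qed
    have add: "frag_of (\<iota> (u + v), \<iota> 1) - frag_of (\<iota> u, \<iota> 1) - frag_of (\<iota> v, \<iota> 1) \<in> tensor_rels E7_ring ?M ?B"
      if "u \<in> ?L" "v \<in> ?L" for u v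
    proof (rule cl(5))
      have "frag_of (\<iota> u \<oplus>\<^bsub>?M\<^esub> \<iota> v, \<iota> 1) - frag_of (\<iota> u, \<iota> 1) - frag_of (\<iota> v, \<iota> 1) \<in> tensor_gens E7_ring ?M ?B"
        unfolding tensor_gens_def using that by (auto simp: L.M_ops(1) B.M_ops(1) intro!: exI)
      then show "frag_of (\<iota> (u + v), \<iota> 1) - frag_of (\<iota> u, \<iota> 1) - frag_of (\<iota> v, \<iota> 1) \<in> tensor_gens E7_ring ?M ?B"
        by (simp only: L.M_ops(3))
    qed
    let ?t1 = "frag_of (\<iota> (zR * m), \<iota> 1) - frag_of (\<iota> m, \<iota> (zR * 1))"
    let ?t2 = "frag_of (\<iota> (cS xS * m1 + cS (yS ^ 3) * m2), \<iota> 1)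
        - frag_of (\<iota> (cS xS * m1), \<iota> 1) - frag_of (\<iota> (cS (yS ^ 3) * m2), \<iota> 1)"
    let ?t3 = "frag_of (\<iota> (cS xS * m1), \<iota> 1) - frag_of (\<iota> m1, \<iota> (cS xS * 1))"
    let ?t4 = "frag_of (\<iota> (cS (yS ^ 3) * m2), \<iota> 1) - frag_of (\<iota> m2, \<iota> (cS (yS ^ 3) * 1))"
    have "?t2 + ?t3 + ?t4 - ?t1 \<in> tensor_rels E7_ring ?M ?B"
      by (rule cl(3)[OF cl(2)[OF cl(2)[OF add[OF mem(3,4)] bal[OF mem(5)]] bal[OF mem(6)]] bal[OF mem(1)]])
    also have "?t2 + ?t3 + ?t4 - ?t1 = frag_of (x, \<iota> zR) - w"
      unfolding w_def m(1) eq by simp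
    finally have "frag_of (x, \<iota> zR) - w \<in> tensor_rels E7_ring ?M ?B" .
    moreover have "Poly_Mapping.keys w \<subseteq> carrier ?M \<times> \<iota> ` J"
      using keys_add[of "frag_of (\<iota> m1, \<iota> (cS xS))" "frag_of (\<iota> m2, \<iota> (cS (yS ^ 3)))"] mem(5,6) xJ yJ
      by (auto simp: w_def keys_frag_of L.M_ops)
    ultimately show "\<exists>w. Poly_Mapping.keys w \<subseteq> carrier ?M \<times> \<iota> ` J \<and>
        frag_of (x, \<iota> zR) - w \<in> tensor_rels E7_ring ?M ?B" by blast
  qed
  then have "cls r \<odot>\<^bsub>?B\<^esub> \<iota> zR \<in> \<iota> ` J"
    using r B.module_M sub by (auto simp: test_ideal_def module_colon_def)
  then have "r * zR \<in> J" by (simp add: B.M_ops)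
  then obtain s t where "r * zR = s * cS xS + t * cS (yS ^ 3)" by (auto simp: J_def)
  then have "zpart (r * zR) = zpart (s * cS xS + t * cS (yS ^ 3))" by (rule arg_cong)
  then have "cpart r = zpart s * xS + zpart t * yS ^ 3" by (simp add: times_e7_def plus_e7_def)
  then have "r = cS (zpart s) * cS xS + cS (zpart t) * cS (yS ^ 3) + cS (zpart r) * zR"
    by (simp add: e7_eq_iff times_e7_def plus_e7_def)
  then show ?thesis by (rule that)
qed

text \<open>
  All modules used for the upper bound live on copies of subsets of the surface ring, which the universe contains.
\<close>

theorem proposition6p10:
  assumes "CHAR('k::alg_closed_field) \<notin> {2, 3, 5}"
  shows "MCM_test_ideal TYPE(('k, 'u) E7_universe) (E7_ring :: 'k fps3 set ring) =
    Idl\<^bsub>E7_ring\<^esub> {E7_class var_x, E7_class (var_y ^ 3), E7_class var_z}"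
proof -
  let ?R = "E7_ring :: 'k fps3 set ring"
  let ?U = "TYPE(('k, 'u) E7_universe)"
  interpret R: cring ?R by (rule E7_cring)
  have two: "(2 :: 'k) \<noteq> 0"
  proof
    assume "(2 :: 'k) = 0"
    then have "of_nat 2 = (0 :: 'k)" by simp
    then have "CHAR('k) dvd 2" by (simp only: of_nat_eq_0_iff_char_dvd)
    then have "CHAR('k) = 1 \<or> CHAR('k) = 2" by (metis prime_nat_iff two_is_prime_nat)
    then show False using assms CHAR_not_1'[where 'a = 'k] by auto
  qed
  have gens: "{E7_class var_x, E7_class (var_y ^ 3), E7_class var_z} = {cls (cS xS), cls (cS (yS ^ 3)), cls (zR :: 'k e7)}"
    by (simp only: E7_class_vars)
  let ?I = "Idl\<^bsub>?R\<^esub> {cls (cS xS), cls (cS (yS ^ 3)), cls (zR :: 'k e7)}"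
  have car: "{cls (cS xS), cls (cS (yS ^ 3)), cls (zR :: 'k e7)} \<subseteq> carrier ?R" by simp
  interpret I: ideal ?I ?R by (rule R.genideal_ideal[OF car])
  have "MCM_test_ideal ?U ?R \<subseteq> ?I"
  proof
    fix a assume a: "a \<in> MCM_test_ideal ?U ?R"
    then obtain r where r: "a = cls r" by (auto simp: MCM_test_ideal_def carrier_E7_ring)
    define \<iota> :: "'k e7 \<Rightarrow> ('k, 'u) E7_universe" where "\<iota> u = Inl (cls u)" for u
    have inj: "inj \<iota>" by (rule injI) (simp add: \<iota>_def)
    have "cls r \<in> test_ideal ?U ?R (ideal_module \<iota> e7_line)"
      using a line_MCM[OF inj] unfolding r by (simp add: MCM_test_ideal_def)
    then obtain s t v where "r = s * cS xS + t * cS (yS ^ 3) + v * zR"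
      using MCM_test_ideal_upper_bound[OF inj] by metis
    then have "a = cls s \<otimes>\<^bsub>?R\<^esub> cls (cS xS) \<oplus>\<^bsub>?R\<^esub> cls t \<otimes>\<^bsub>?R\<^esub> cls (cS (yS ^ 3)) \<oplus>\<^bsub>?R\<^esub> cls v \<otimes>\<^bsub>?R\<^esub> cls zR"
      unfolding r by (simp only: E7_ring_ops)
    moreover have "cls (cS xS) \<in> ?I" "cls (cS (yS ^ 3)) \<in> ?I" "cls zR \<in> ?I"
      using R.genideal_self[OF car] by auto
    ultimately show "a \<in> ?I" using I.a_closed I.I_l_closed[OF _ cls_closed] by simp
  qed
  moreover have "?I \<subseteq> MCM_test_ideal ?U ?R"
  proof -
    have "?I \<subseteq> test_ideal ?U ?R M" if "MCM_module ?R M" for M :: "('k fps3 set, ('k, 'u) E7_universe) module"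
    proof -
      have "module ?R M" using that by (simp add: MCM_module_def fin_gen_module_def)
      then interpret M: E7_quotient_module M by (rule E7_quotient_module.intro)
      have "ideal (cls ` {u. cls u \<in> test_ideal ?U ?R M}) ?R"
        by (rule ideal_image_cls[OF M.test_ideal_ideal_set])
      then have "?I \<subseteq> cls ` {u. cls u \<in> test_ideal ?U ?R M}"
        using M.MCM_test_ideal_lower_bound[OF two that, where U = ?U]
        by (intro R.genideal_minimal) auto
      then show ?thesis by auto
    qed
    then show ?thesis using I.a_subset by (auto simp: MCM_test_ideal_def)
  qed
  ultimately show ?thesis unfolding gens by blast
qed

end
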